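(* For integers $n\geq5$ and $m\ge1$ let $g_\rho^m$ be the Poisson wavelet of order $m$ at scale $\rho>0$ over $\mathcal S^n$, and let $U(g_\rho^m)$ be its uncertainty product. Then for every $n\geq5$, $$\min_{m\in\mathbb N}\lim_{\rho\to0}U(g_\rho^m)=\frac12\sqrt{\frac{n(n-1)(2n-1)}{2n-3}},$$ and the minimum is attained for $m=\left[\frac{n-1}{2}\right]$ (integer part). Moreover, as $n\to\infty$ this minimal value is asymptotic to $\frac n2$, i.e. its ratio to $\frac n2$ tends to $1$.
   Context: Here $\mathbb N=\{1,2,\dots\}$ and $\rho\to0$ means $\rho\to0^+$. Let $\mathcal S^n=\{x\in\mathbb R^{n+1}:|x|=1\}$ with (unnormalized) surface measure $\sigma$, $\lambda=\frac{n-1}{2}$, and $\Sigma_n=\sigma(\mathcal S^n)=\frac{2\pi^{\lambda+1}}{\Gamma(\lambda+1)}$. For $x\in\mathcal S^n$ let $\vartheta\in[0,\pi]$ be its first spherical variable, i.e. $\cos\vartheta=x_1$, the first coordinate of $x$. Poisson wavelets: for $\rho\in(0,\infty)$ put $r=e^{-\rho}$ and $\zeta=(r,0,\dots,0)\in\mathbb R^{n+1}$. The Poisson kernel is $$p_\rho(x)=\frac{1}{\Sigma_n}\frac{1-|\zeta|^2}{|\zeta-x|^{n+1}}=\frac1{\Sigma_n}\frac{1-r^2}{(1-2r\cos\vartheta+r^2)^{(n+1)/2}}.$$ The Poisson wavelet of order $m\in\mathbb N$ at scale $\rho$ is defined recursively by $g_\rho^1=\rho\, r\partial_r p_\rho$,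 $g_\rho^{m+1}=\rho\, r\partial_r g_\rho^m$, where the scale factors $\rho$ are not differentiated, i.e. $g_\rho^m=\rho^m(r\partial_r)^m p_\rho$. Equivalently, with the Gegenbauer polynomials $\mathcal C_l^\lambda$, $$g_\rho^m(x)=\frac1{\Sigma_n}\sum_{l=0}^\infty\frac{l+\lambda}{\lambda}(\rho l)^m e^{-\rho l}\,\mathcal C_l^\lambda(\cos\vartheta).$$ Variances and uncertainty product: for a twice differentiable function $f$ on $\mathcal S^n$ with $\int_{\mathcal S^n}x|f(x)|^2\,d\sigma(x)\neq0$, $$\mathrm{var}_S(f)=\left(\frac{\int_{\mathcal S^n}|f(x)|^2\,d\sigma(x)}{\int_{\mathcal S^n}x|f(x)|^2\,d\sigma(x)}\right)^2-1,\qquad \mathrm{var}_M(f)=-\frac{\int_{\mathcal S^n}\Delta^*f(x)\,\overline{f(x)}\,d\sigma(x)}{\int_{\mathcal S^n}|f(x)|^2\,d\sigma(x)},$$ where the square of the vector $\int x|f|^2\,d\sigma\in\mathbb R^{n+1}$ in the denominator means its squared Euclidean norm, and $\Delta^*$ is the Laplace–Beltrami operator on $\mathcal S^n$. The uncertainty product is $U(f)=\sqrt{\mathrm{var}_S(f)}\cdot\sqrt{\mathrm{var}_M(f)}$. *)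

theory Defs
  imports "HOL-Analysis.Analysis"
begin

text \<open>
  The dimension has to range over all natural numbers inside one statement (the value at
  dimension n is studied as n tends to infinity), so a point of the (n+1)-dimensional Euclidean
  space is an extensional function on the index set \<open>{1..n+1}\<close>, and its Euclidean norm is
  \<open>L2_set x {1..n+1}\<close>.
\<close>

definition lebesgue_space :: "nat \<Rightarrow> (nat \<Rightarrow> real) measure" where
  "lebesgue_space n = (\<Pi>\<^sub>M i\<in>{1..n+1}. lborel)"

definition unit_sphere :: "nat \<Rightarrow> (nat \<Rightarrow> real) set" where
  "unit_sphere n = {x \<in> {1..n+1} \<rightarrow>\<^sub>E UNIV. L2_set x {1..n+1} = 1}"

definition punctured_ball :: "nat \<Rightarrow> (nat \<Rightarrow> real) set" where
  "punctured_ball n = {x \<in> {1..n+1} \<rightarrow>\<^sub>E UNIV. 0 < L2_set x {1..n+1} \<and> L2_set x {1..n+1} < 1}"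

definition radial_proj :: "nat \<Rightarrow> (nat \<Rightarrow> real) \<Rightarrow> (nat \<Rightarrow> real)" where
  "radial_proj n x = (\<lambda>i\<in>{1..n+1}. x i / L2_set x {1..n+1})"

text \<open>
  Unnormalized surface measure, by polar coordinates: the measure of a Borel set A of the sphere
  is n+1 times the Lebesgue measure of the cone \<open>{t x | 0 < t < 1, x \<in> A}\<close>.
\<close>

definition surface_measure :: "nat \<Rightarrow> (nat \<Rightarrow> real) measure" where
  "surface_measure n =
     scale_measure (of_nat (n+1))
       (distr (restrict_space (lebesgue_space n) (punctured_ball n))
              (restrict_space (lebesgue_space n) (unit_sphere n))
              (radial_proj n))"

definition sphere_area :: "nat \<Rightarrow> real" where
  "sphere_area n = measure (surface_measure n) (unit_sphere n)"

text \<open>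
  The Laplace--Beltrami operator is the angular part of the Laplacian of the ambient space: the
  ambient Laplacian, at a point of the sphere, of the extension of f that is constant on rays.
  Functions on the sphere are real-valued here, as the Poisson wavelets are, so no conjugate
  appears in the variances.
\<close>

definition laplace_beltrami :: "nat \<Rightarrow> ((nat \<Rightarrow> real) \<Rightarrow> real) \<Rightarrow> (nat \<Rightarrow> real) \<Rightarrow> real" where
  "laplace_beltrami n f x =
     (\<Sum>i\<in>{1..n+1}. (deriv ^^ 2) (\<lambda>t. f (radial_proj n (x(i := t)))) (x i))"

definition var_S :: "nat \<Rightarrow> ((nat \<Rightarrow> real) \<Rightarrow> real) \<Rightarrow> real" where
  "var_S n f =
     ((\<integral>x. \<bar>f x\<bar>\<^sup>2 \<partial>surface_measure n) /
      L2_set (\<lambda>i. \<integral>x. x i * \<bar>f x\<bar>\<^sup>2 \<partial>surface_measure n) {1..n+1})\<^sup>2 - 1"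

definition var_M :: "nat \<Rightarrow> ((nat \<Rightarrow> real) \<Rightarrow> real) \<Rightarrow> real" where
  "var_M n f =
     - ((\<integral>x. laplace_beltrami n f x * f x \<partial>surface_measure n) /
        (\<integral>x. \<bar>f x\<bar>\<^sup>2 \<partial>surface_measure n))"

definition uncertainty_product :: "nat \<Rightarrow> ((nat \<Rightarrow> real) \<Rightarrow> real) \<Rightarrow> real" where
  "uncertainty_product n f = sqrt (var_S n f) * sqrt (var_M n f)"

definition axis_point :: "nat \<Rightarrow> real \<Rightarrow> (nat \<Rightarrow> real)" where
  "axis_point n r = (\<lambda>i\<in>{1..n+1}. if i = 1 then r else 0)"

text \<open>The kernel takes the radius r as its parameter; the kernel at scale \<open>\<rho>\<close> has \<open>r = exp (-\<rho>)\<close>.\<close>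

definition poisson_kernel :: "nat \<Rightarrow> real \<Rightarrow> (nat \<Rightarrow> real) \<Rightarrow> real" where
  "poisson_kernel n r x =
     1 / sphere_area n * ((1 - (L2_set (axis_point n r) {1..n+1})\<^sup>2) /
       L2_set (\<lambda>i. axis_point n r i - x i) {1..n+1} ^ (n+1))"

definition radial_deriv :: "(real \<Rightarrow> real) \<Rightarrow> real \<Rightarrow> real" where
  "radial_deriv h r = r * deriv h r"

definition poisson_wavelet :: "nat \<Rightarrow> nat \<Rightarrow> real \<Rightarrow> (nat \<Rightarrow> real) \<Rightarrow> real" where
  "poisson_wavelet n m \<rho> x =
     \<rho> ^ m * (radial_deriv ^^ m) (\<lambda>r. poisson_kernel n r x) (exp (- \<rho>))"

definition limit_uncertainty :: "nat \<Rightarrow> nat \<Rightarrow> real" where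
  "limit_uncertainty n m = Lim (at_right 0) (\<lambda>\<rho>. uncertainty_product n (poisson_wavelet n m \<rho>))"

end

theory Submission
  imports Defs "HOL-Probability.Probability" "HOL-Real_Asymp.Real_Asymp"
begin

text \<open>
  With \<open>a = (n - 1) / 2\<close> the wavelet is a zonal series \<open>\<Sum> (l + a) / a * w\<^sub>l C\<^sub>l(x\<^sub>1)\<close> in
  Gegenbauer polynomials, where \<open>w\<^sub>l = (\<rho> l)\<^sup>m exp (-\<rho> l)\<close>.  Gaussian integrals give the moments of
  the first coordinate under the surface measure, and the resulting recurrence is all that the
  orthogonality relations need.  So the three integrals in the uncertainty product are explicit
  series: the square norm is a sum of \<open>b\<^sub>l (w\<^sub>l\<^sup>2 + w\<^sub>l\<^sub>+\<^sub>1\<^sup>2)\<close>, its difference from the first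
  moment is the sum of \<open>b\<^sub>l (w\<^sub>l\<^sub>+\<^sub>1 - w\<^sub>l)\<^sup>2\<close>, and the energy carries the eigenvalues
  \<open>l (l + n - 1)\<close>; here \<open>b\<^sub>l\<close> is a polynomial in \<open>l\<close> of degree \<open>n - 1\<close>.  A sum of
  \<open>p(l) exp (-2 \<rho> l)\<close> over \<open>l\<close>, with \<open>p\<close> of degree \<open>d\<close> and leading coefficient \<open>c\<close>, behaves like
  \<open>c d! / (2 \<rho>)\<^sup>d\<^sup>+\<^sup>1\<close>, so the squared limit is a rational function of \<open>k = 2 m + n\<close>.  Its
  excess over the square of the claimed minimum has the sign of \<open>(k - 2 n + 1) (k - 2 n + 2)\<close>,
  a product of consecutive integers.
\<close>

section \<open>Gegenbauer polynomials\<close>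

text \<open>The obstacle is a cancellation in \<open>var_S\<close>. If \<open>N\<close> is the
  square norm and \<open>N - D\<close> the first moment, then
  \<open>var_S = D (2 N - D) / (N - D)^2\<close>, while \<open>D\<close> is smaller than
  \<open>N\<close> by a factor of order \<rho>^2; separate expansions of the two integrals would
  have to be carried to their third terms. As \<open>D\<close> is an exact sum of squared
  differences, leading orders suffice throughout, and the factor \<rho>^2 in \<open>var_S\<close>
  cancels the \<rho>^(-2) in \<open>var_M\<close>. Gaussian integrals enter because the surface
  measure is given through Lebesgue measure on a ball: a Gaussian weight is radial and at the same
  time a product over the coordinates, so moments on the sphere become quotients of one-dimensional
  ones. For a > 0 the polynomials satisfy |C_l(t)| \<le> C_l(1) on [-1, 1], so summability at t = 1
  controls a whole zonal series and justifies termwise integration. Differentiation takes place in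
  the open interval only; the two poles form a null set.\<close>

fun gegenbauer :: "real \<Rightarrow> nat \<Rightarrow> real poly" where
  "gegenbauer a 0 = 1"
| "gegenbauer a (Suc 0) = [:0, 2 * a:]"
| "gegenbauer a (Suc (Suc l)) =
     smult (2 * (real l + 1 + a) / (real l + 2)) ([:0, 1:] * gegenbauer a (Suc l)) -
     smult ((real l + 2 * a) / (real l + 2)) (gegenbauer a l)"

abbreviation geg :: "real \<Rightarrow> nat \<Rightarrow> real \<Rightarrow> real" where
  "geg a l t \<equiv> poly (gegenbauer a l) t"
abbreviation geg' :: "real \<Rightarrow> nat \<Rightarrow> real \<Rightarrow> real" where
  "geg' a l t \<equiv> poly (pderiv (gegenbauer a l)) t"
abbreviation geg'' :: "real \<Rightarrow> nat \<Rightarrow> real \<Rightarrow> real" where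
  "geg'' a l t \<equiv> poly (pderiv (pderiv (gegenbauer a l))) t"

lemma gegenbauer_recurrence_poly:
  "smult (real l + 2) (gegenbauer a (Suc (Suc l))) =
     smult (2 * (real l + 1 + a)) ([:0, 1:] * gegenbauer a (Suc l)) -
     smult (real l + 2 * a) (gegenbauer a l)"
proof -
  have [simp]: "real l + 2 \<noteq> 0" by linarith
  show ?thesis by (simp add: smult_diff_right del: mult_pCons_left)
qed

lemma gegenbauer_recurrence:
  "(real l + 2) * geg a (Suc (Suc l)) t =
     2 * (real l + 1 + a) * t * geg a (Suc l) t - (real l + 2 * a) * geg a l t"
  using arg_cong[OF gegenbauer_recurrence_poly[of l a], of "\<lambda>p. poly p t"] by (simp del: gegenbauer.simps)

lemma gegenbauer_deriv_recurrence:
  "(real l + 2) * geg' a (Suc (Suc l)) t =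
     2 * (real l + 1 + a) * (geg a (Suc l) t + t * geg' a (Suc l) t) - (real l + 2 * a) * geg' a l t"
  using arg_cong[OF gegenbauer_recurrence_poly[of l a], of "\<lambda>p. poly (pderiv p) t"]
  by (simp add: pderiv_diff pderiv_smult pderiv_mult pderiv_pCons algebra_simps del: gegenbauer.simps)

declare gegenbauer.simps(3) [simp del]

text \<open>The two identities have to be proved together: the second at \<open>l\<close> removes
  \<open>geg' a l t\<close> from the differentiated recurrence, which gives the first at
  \<open>l + 1\<close>; this and the three-term recurrence give the second at
  \<open>l + 1\<close>.\<close>

lemma gegenbauer_deriv_identities:
  "geg' a (Suc l) t = t * geg' a l t + (real l + 2 * a) * geg a l t \<and>
   t * geg' a (Suc l) t - geg' a l t = (real l + 1) * geg a (Suc l) t"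
proof (induction l)
  case 0
  show ?case by (simp add: pderiv_pCons)
next
  case (Suc l)
  let ?C = "geg a (Suc l) t" and ?D = "geg' a (Suc l) t"
  have I1: "geg' a l t = t * ?D - (real l + 1) * ?C" and I0: "?D = t * geg' a l t + (real l + 2 * a) * geg a l t"
    using Suc by auto
  have "(real l + 2) * geg' a (Suc (Suc l)) t = (real l + 2) * (t * ?D + (real l + 1 + 2 * a) * ?C)"
    unfolding gegenbauer_deriv_recurrence I1 by (simp add: algebra_simps)
  then have A: "geg' a (Suc (Suc l)) t = t * ?D + (real l + 1 + 2 * a) * ?C"
    by simp
  have B: "t * geg' a (Suc (Suc l)) t - ?D = (real l + 2) * geg a (Suc (Suc l)) t"
    unfolding A gegenbauer_recurrence using I0 I1 by (simp add: algebra_simps)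
  show ?case using A B by (simp add: algebra_simps)
qed

lemma gegenbauer_deriv_Suc: "geg' a (Suc l) t = t * geg' a l t + (real l + 2 * a) * geg a l t"
  using gegenbauer_deriv_identities by blast

text \<open>One derivative identity inserted into the other. At \<open>t = 1\<close> the left side
  vanishes and a two-term recursion for the end-point values remains.\<close>

lemma gegenbauer_first_order:
  "(1 - t\<^sup>2) * geg' a l t = (real l + 2 * a) * t * geg a l t - (real l + 1) * geg a (Suc l) t"
proof -
  have 1: "geg' a (Suc l) t = t * geg' a l t + (real l + 2 * a) * geg a l t"
    and 2: "t * geg' a (Suc l) t - geg' a l t = (real l + 1) * geg a (Suc l) t"
    using gegenbauer_deriv_identities[of a l t] by auto
  show ?thesis using 2 unfolding 1 by (simp add: power2_eq_square algebra_simps)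
qed

text \<open>For positive \<open>a\<close> all coefficients on the right are positive, which later
  carries the bound by the value at 1 from the polynomials to their derivatives.\<close>

lemma gegenbauer_deriv_step:
  "pderiv (gegenbauer a (Suc (Suc l))) =
     pderiv (gegenbauer a l) + smult (2 * (real l + 1 + a)) (gegenbauer a (Suc l))"
proof -
  have "geg' a (Suc (Suc l)) t = geg' a l t + 2 * (real l + 1 + a) * geg a (Suc l) t" for t
  proof -
    have "t * geg' a (Suc l) t = geg' a l t + (real l + 1) * geg a (Suc l) t"
      using gegenbauer_deriv_identities[of a l t] by linarith
    then show ?thesis
      unfolding gegenbauer_deriv_Suc[of a "Suc l"] by (simp add: algebra_simps)
  qed
  then show ?thesis
    by (simp add: poly_eq_poly_eq_iff[symmetric] fun_eq_iff)
qed

text \<open>Differentiate the first-order relation and eliminate the derivative of index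
  \<open>l + 1\<close>. The resulting equation yields the pointwise bound, orthogonality and the
  eigenvalues of the Laplace-Beltrami operator.\<close>

lemma gegenbauer_ode:
  "(1 - t\<^sup>2) * geg'' a l t - (2 * a + 1) * t * geg' a l t = - (real l * (real l + 2 * a)) * geg a l t"
proof -
  let ?q = "[:1, 0, -1:] :: real poly"
  have eq: "?q * pderiv (gegenbauer a l) =
      smult (real l + 2 * a) ([:0, 1:] * gegenbauer a l) - smult (real l + 1) (gegenbauer a (Suc l))"
    using gegenbauer_first_order[of _ a l]
    by (simp add: poly_eq_poly_eq_iff[symmetric] fun_eq_iff power2_eq_square algebra_simps)
  have "poly (pderiv (?q * pderiv (gegenbauer a l))) t =
      (real l + 2 * a) * (geg a l t + t * geg' a l t) - (real l + 1) * geg' a (Suc l) t"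
    unfolding eq by (simp add: pderiv_diff pderiv_smult pderiv_mult pderiv_pCons algebra_simps)
  moreover have "poly (pderiv (?q * pderiv (gegenbauer a l))) t = (1 - t\<^sup>2) * geg'' a l t - 2 * t * geg' a l t"
    by (simp only: pderiv_mult poly_add poly_mult) (simp add: pderiv_pCons power2_eq_square algebra_simps)
  ultimately show ?thesis
    unfolding gegenbauer_deriv_Suc by (simp add: algebra_simps)
qed

lemma gegenbauer_at_1: "geg a l 1 = pochhammer (2 * a) l / fact l"
proof (induction l)
  case (Suc l)
  have "(real l + 1) * geg a (Suc l) 1 = (real l + 2 * a) * geg a l 1"
    using gegenbauer_first_order[of 1 a l] by simp
  then have "geg a (Suc l) 1 = (real l + 2 * a) * geg a l 1 / (real l + 1)"
    by (simp add: field_simps)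
  then show ?case by (simp add: Suc pochhammer_Suc field_simps)
qed simp

lemma gegenbauer_uminus: "geg a l (-t) = (-1) ^ l * geg a l t"
proof (induction a l rule: gegenbauer.induct)
  case (3 a l)
  have "(real l + 2) * geg a (Suc (Suc l)) (-t) = (real l + 2) * ((-1) ^ l * geg a (Suc (Suc l)) t)"
    unfolding mult.left_commute[of "real l + 2"] gegenbauer_recurrence using 3 by (simp add: algebra_simps)
  then show ?case by simp
qed auto

text \<open>
  The quantity \<open>l (l + 2 a) C\<^sup>2 + (1 - t\<^sup>2) C'\<^sup>2\<close> has derivative \<open>4 a t C'\<^sup>2\<close>, so it is largest
  at the end points.
\<close>

lemma gegenbauer_abs_le:
  assumes a: "a > 0" and t: "\<bar>t\<bar> \<le> 1"
  shows "\<bar>geg a l t\<bar> \<le> geg a l 1"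
proof (cases "l = 0")
  case False
  have pos: "geg a l 1 \<ge> 0"
    using a by (simp add: gegenbauer_at_1 pochhammer_nonneg)
  have main: "\<bar>geg a l s\<bar> \<le> geg a l 1" if s: "0 \<le> s" "s \<le> 1" for s
  proof -
    define E where "E u = real l * (real l + 2 * a) * (geg a l u)\<^sup>2 + (1 - u\<^sup>2) * (geg' a l u)\<^sup>2" for u
    have "E s \<le> E 1"
    proof (rule DERIV_nonneg_imp_nondecreasing[OF s(2)])
      fix u assume u: "s \<le> u" "u \<le> 1"
      have ode: "(1 - u\<^sup>2) * geg'' a l u = (2 * a + 1) * u * geg' a l u - (real l * (real l + 2 * a)) * geg a l u"
        using gegenbauer_ode[of u a l] by (simp add: algebra_simps)
      have "(E has_field_derivative
          (real l * (real l + 2 * a) * (2 * geg a l u * geg' a l u)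
           + ((- (2 * u)) * (geg' a l u)\<^sup>2 + ((1 - u\<^sup>2) * geg'' a l u) * 2 * geg' a l u))) (at u)"
        unfolding E_def by (auto intro!: derivative_eq_intros simp: power2_eq_square algebra_simps)
      moreover have "real l * (real l + 2 * a) * (2 * geg a l u * geg' a l u)
           + ((- (2 * u)) * (geg' a l u)\<^sup>2 + ((1 - u\<^sup>2) * geg'' a l u) * 2 * geg' a l u)
           = 4 * a * u * (geg' a l u)\<^sup>2"
        unfolding ode by (simp add: power2_eq_square algebra_simps)
      moreover have "4 * a * u * (geg' a l u)\<^sup>2 \<ge> 0"
        using a u s by simp
      ultimately show "\<exists>y. (E has_real_derivative y) (at u) \<and> 0 \<le> y" by metis
    qed
    moreover have "(1 - s\<^sup>2) * (geg' a l s)\<^sup>2 \<ge> 0"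
      using s by (simp add: power_le_one)
    ultimately have "real l * (real l + 2 * a) * (geg a l s)\<^sup>2 \<le> real l * (real l + 2 * a) * (geg a l 1)\<^sup>2"
      by (simp add: E_def)
    moreover have "real l * (real l + 2 * a) > 0" using a False by simp
    ultimately have "(geg a l s)\<^sup>2 \<le> (geg a l 1)\<^sup>2" by (metis mult_le_cancel_left_pos)
    then show ?thesis using pos by (simp add: abs_le_square_iff[symmetric])
  qed
  show ?thesis
  proof (cases "t \<ge> 0")
    case True then show ?thesis using main t by auto
  next
    case False
    have "\<bar>geg a l (-t)\<bar> \<le> geg a l 1" using main[of "-t"] t False by auto
    then show ?thesis by (simp add: gegenbauer_uminus abs_mult power_abs)
  qed
qed simp

section \<open>Moments of the surface measure\<close>

text \<open>This is \<open>Gamma ((k + 1) / 2) / 2\<close>; the rule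
  \<open>half_moment_add_2\<close> is its functional equation.\<close>

definition half_moment :: "nat \<Rightarrow> real" where
  "half_moment k = (\<integral>s. indicator {0..} s *\<^sub>R (exp (- s\<^sup>2) * s ^ k) \<partial>lborel)"

lemma has_half_moment_explicit:
  "has_bochner_integral lborel (\<lambda>s. indicator {0..} s *\<^sub>R (exp (- s\<^sup>2) * s ^ k))
     (if even k then (sqrt pi / 2) * (fact k / (2 ^ k * fact (k div 2))) else fact (k div 2) / 2)"
proof (cases "even k")
  case True
  then obtain j where "k = 2 * j" by (auto elim: evenE)
  then show ?thesis using gaussian_moment_even_pos[of j] by simp
next
  case False
  then obtain j where "k = 2 * j + 1" by (auto elim: oddE)
  then show ?thesis using gaussian_moment_odd_pos[of j] by simp
qed

lemma half_moment_eq: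
  "half_moment k = (if even k then (sqrt pi / 2) * (fact k / (2 ^ k * fact (k div 2))) else fact (k div 2) / 2)"
  unfolding half_moment_def by (rule has_bochner_integral_integral_eq[OF has_half_moment_explicit])

lemma has_half_moment:
  "has_bochner_integral lborel (\<lambda>s. indicator {0..} s *\<^sub>R (exp (- s\<^sup>2) * s ^ k)) (half_moment k)"
  unfolding half_moment_eq by (rule has_half_moment_explicit)

lemma half_moment_pos: "half_moment k > 0"
  by (simp add: half_moment_eq)

lemma half_moment_add_2: "half_moment (k + 2) = (real k + 1) / 2 * half_moment k"
proof (cases "even k")
  case True
  then obtain j where "k = 2 * j" by (auto elim: evenE)
  then show ?thesis by (simp add: half_moment_eq divide_simps) (simp add: algebra_simps)
next
  case False
  then obtain j where k: "k = 2 * j + 1" by (auto elim: oddE)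
  have "half_moment (k + 2) = fact (Suc j) / 2" "half_moment k = fact j / 2"
    unfolding k by (simp_all add: half_moment_eq)
  then show ?thesis unfolding k by (simp only: fact_Suc) simp
qed

lemma gauss_moment:
  "has_bochner_integral lborel (\<lambda>s. s ^ k * exp (- s\<^sup>2)) (if even k then 2 * half_moment k else 0)"
  using has_bochner_integral_even_function[OF has_half_moment[of k]]
    has_bochner_integral_odd_function[OF has_half_moment[of k]]
  by (auto simp: mult.commute)

text \<open>
  \<open>layer d\<close> is minus the derivative of \<open>s\<^sup>d exp (-s\<^sup>2)\<close>, so a radial factor \<open>r\<^sup>d exp (-r\<^sup>2)\<close>
  is a (signed) superposition of indicators of balls.
\<close>

definition layer :: "nat \<Rightarrow> real \<Rightarrow> real" where
  "layer d s = 2 * s ^ Suc d * exp (- s\<^sup>2) - real d * s ^ (d - 1) * exp (- s\<^sup>2)"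

lemma layer_measurable [measurable]: "layer d \<in> borel_measurable borel"
  unfolding layer_def[abs_def] by measurable

lemma layer_integrable: "integrable lborel (\<lambda>s. indicator {0<..} s * (layer d s * s ^ k))"
proof -
  have "integrable lborel (\<lambda>s. indicator {0..} s *\<^sub>R (exp (- s\<^sup>2) * s ^ j) :: real)" for j
    using has_half_moment by (rule integrable.intros)
  then have "integrable lborel (\<lambda>s. 2 * (indicator {0..} s *\<^sub>R (exp (- s\<^sup>2) * s ^ (Suc d + k)))
      - real d * (indicator {0..} s *\<^sub>R (exp (- s\<^sup>2) * s ^ (d - 1 + k))))"
    by (intro Bochner_Integration.integrable_diff integrable_mult_right)
  then have "integrable lborel (\<lambda>s. indicator {0..} s * (layer d s * s ^ k))"
    by (rule Bochner_Integration.integrable_cong[THEN iffD1, rotated 2])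
       (auto simp: layer_def power_add algebra_simps)
  then have "integrable lborel (\<lambda>s. indicator {0<..} s *\<^sub>R (indicator {0..} s * (layer d s * s ^ k)))"
    by (rule integrable_mult_indicator[rotated]) simp
  then show ?thesis
    by (rule Bochner_Integration.integrable_cong[THEN iffD1, rotated 2]) (auto simp: indicator_def)
qed

text \<open>The functional equation gives the factor (n + d + 1) - d, so the dependence on
  \<open>d\<close> drops out and the normalising factor n + 1 of the surface measure is
  left.\<close>

lemma integral_layer:
  "(\<integral>s. indicator {0<..} s * (layer d s * s ^ Suc n) \<partial>lborel) = (real n + 1) * half_moment (n + d)"
proof -
  have ae: "AE s in lborel. s \<noteq> (0::real)"
    using AE_lborel_singleton by auto
  have eq: "(\<integral>s. indicator {0<..} s * (layer d s * s ^ Suc n) \<partial>lborel) =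
      (\<integral>s. 2 * (indicator {0..} s *\<^sub>R (exp (- s\<^sup>2) * s ^ (n + d + 2)))
        - real d * (indicator {0..} s *\<^sub>R (exp (- s\<^sup>2) * s ^ (n + d))) \<partial>lborel)"
  proof (rule integral_cong_AE)
    show "AE s in lborel. indicator {0<..} s * (layer d s * s ^ Suc n) =
        2 * (indicator {0..} s *\<^sub>R (exp (- s\<^sup>2) * s ^ (n + d + 2)))
        - real d * (indicator {0..} s *\<^sub>R (exp (- s\<^sup>2) * s ^ (n + d)))"
      using ae
    proof eventually_elim
      case (elim s)
      then show ?case
        by (cases d) (auto simp: layer_def indicator_def power_add algebra_simps)
    qed
  qed (measurable, measurable)
  also have "\<dots> = 2 * half_moment (n + d + 2) - real d * half_moment (n + d)"
    by (intro has_bochner_integral_integral_eq has_bochner_integral_diff has_bochner_integral_mult_right has_half_moment)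
  finally show ?thesis unfolding half_moment_add_2 by (simp add: algebra_simps)
qed

text \<open>Fundamental theorem of calculus on an unbounded interval. With \<open>a\<close> the norm
  of a point, the tail runs over the radii of the balls about the origin that contain the
  point.\<close>

lemma integral_layer_tail:
  assumes "a \<ge> 0"
  shows "(\<integral>s. indicator {a<..} s * layer d s \<partial>lborel) = a ^ d * exp (- a\<^sup>2)"
proof -
  let ?F = "\<lambda>s::real. - (s ^ d * exp (- s\<^sup>2))"
  have lim: "((\<lambda>s::real. s ^ d * exp (- s\<^sup>2)) \<longlongrightarrow> 0) at_top"
    by real_asymp
  have "(LBINT s=ereal a..\<infinity>. layer d s) = 0 - ?F a"
  proof (rule interval_integral_FTC_integrable[where F = ?F])
    show "(?F has_vector_derivative layer d s) (at s)" for s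
      unfolding has_real_derivative_iff_has_vector_derivative[symmetric] layer_def
      by (auto intro!: derivative_eq_intros simp: algebra_simps)
    show "isCont (layer d) s" for s
      unfolding layer_def[abs_def] by (intro continuous_intros)
    have "integrable lborel (\<lambda>s. indicator {a<..} s *\<^sub>R (indicator {0<..} s * (layer d s * s ^ 0)))"
      by (rule integrable_mult_indicator[OF _ layer_integrable]) simp
    then have "integrable lborel (\<lambda>s. indicator {a<..} s *\<^sub>R layer d s)"
      by (rule Bochner_Integration.integrable_cong[THEN iffD1, rotated 2])
         (use assms in \<open>auto simp: indicator_def\<close>)
    then show "set_integrable lborel (einterval (ereal a) \<infinity>) (layer d)"
      unfolding set_integrable_def by (simp add: einterval_eq)
    show "((?F \<circ> real_of_ereal) \<longlongrightarrow> ?F a) (at_right (ereal a))"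
      unfolding ereal_tendsto_simps by (intro tendsto_intros)
    show "((?F \<circ> real_of_ereal) \<longlongrightarrow> 0) (at_left \<infinity>)"
      unfolding ereal_tendsto_simps using tendsto_minus[OF lim] by simp
  qed simp
  then show ?thesis
    by (simp add: interval_integral_to_infinity_eq set_lebesgue_integral_def)
qed

section \<open>Dilations, null sets and balls for Lebesgue measure on the ambient space\<close>

interpretation lborel_product: product_sigma_finite "\<lambda>_::nat. lborel :: real measure"
  by standard

lemma scale_measure_eq_density: "scale_measure r M = density M (\<lambda>_. r)"
  by (rule measure_eqI) (simp_all add: emeasure_density_const)

lemma integral_scale_measure:
  fixes f :: "'a \<Rightarrow> real"
  assumes "f \<in> borel_measurable M" "r \<ge> 0"
  shows "(\<integral>x. f x \<partial>scale_measure (ennreal r) M) = r * (\<integral>x. f x \<partial>M)"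
  using integral_density[OF assms(1), of "\<lambda>_. r"] assms(2) by (simp add: scale_measure_eq_density)

context
  fixes n :: nat
begin

lemma space_lebesgue_space: "space (lebesgue_space n) = {1..n+1} \<rightarrow>\<^sub>E UNIV"
  by (simp add: lebesgue_space_def space_PiM)

lemma component_measurable [measurable]: "i \<in> {1..n+1} \<Longrightarrow> (\<lambda>x. x i) \<in> borel_measurable (lebesgue_space n)"
  unfolding lebesgue_space_def using measurable_component_singleton[of i "{1..n+1}" "\<lambda>_. lborel"] by simp

lemma L2_set_measurable [measurable]: "(\<lambda>x. L2_set x {1..n+1}) \<in> borel_measurable (lebesgue_space n)"
  unfolding L2_set_def
  by (rule measurable_compose[OF _ borel_measurable_sqrt])
     (intro borel_measurable_sum borel_measurable_power component_measurable)

lemma dilation_measurable [measurable]: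
  "(\<lambda>x. \<lambda>i\<in>{1..n+1}. c * x i) \<in> measurable (lebesgue_space n) (lebesgue_space n)"
proof -
  have "(\<lambda>x. \<lambda>i\<in>{1..n+1}. c * x i) \<in> measurable (lebesgue_space n) (\<Pi>\<^sub>M i\<in>{1..n+1}. lborel)"
    by (rule measurable_restrict) (simp add: component_measurable)
  then show ?thesis by (simp add: lebesgue_space_def)
qed

lemma radial_proj_measurable [measurable]:
  "radial_proj n \<in> measurable (lebesgue_space n) (lebesgue_space n)"
proof -
  have "(\<lambda>x. \<lambda>i\<in>{1..n+1}. x i / L2_set x {1..n+1}) \<in> measurable (lebesgue_space n) (\<Pi>\<^sub>M i\<in>{1..n+1}. lborel)"
    by (rule measurable_restrict, subst measurable_lborel1)
       (intro borel_measurable_divide component_measurable L2_set_measurable)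
  then show ?thesis by (simp add: lebesgue_space_def radial_proj_def[abs_def])
qed

lemma L2_set_dilation: "c \<ge> 0 \<Longrightarrow> L2_set (\<lambda>i\<in>{1..n+1}. c * x i) {1..n+1} = c * L2_set x {1..n+1}"
  using L2_set_cong[of "{1..n+1}" "{1..n+1}" "\<lambda>i\<in>{1..n+1}. c * x i" "\<lambda>i. c * x i"] L2_set_right_distrib[of c x "{1..n+1}"] by simp

text \<open>The product measure is determined by its values on boxes, and each of the n + 1 sides of
  a box contributes one factor \<open>c\<close>.\<close>

lemma lebesgue_space_dilation:
  assumes c: "c > 0"
  shows "scale_measure (ennreal (c ^ (n + 1))) (distr (lebesgue_space n) (lebesgue_space n) (\<lambda>x. \<lambda>i\<in>{1..n+1}. c * x i))
     = lebesgue_space n"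
  unfolding lebesgue_space_def
proof (rule lborel_product.PiM_eqI)
  let ?L = "\<Pi>\<^sub>M i\<in>{1..n+1}. (lborel :: real measure)" and ?T = "\<lambda>x. \<lambda>i\<in>{1..n+1}. c * x i"
  fix A :: "nat \<Rightarrow> real set" assume A: "\<And>i. i \<in> {1..n+1} \<Longrightarrow> A i \<in> sets lborel"
  have T: "?T \<in> measurable ?L ?L"
    using dilation_measurable by (simp add: lebesgue_space_def)
  have B: "(\<lambda>y. c * y) -` A i \<in> sets lborel" if "i \<in> {1..n+1}" for i
    using measurable_sets[of "\<lambda>y. c * y" borel borel "A i"] A[OF that] by simp
  have one: "ennreal c * emeasure lborel ((\<lambda>y. c * y) -` A i) = emeasure lborel (A i)" if i: "i \<in> {1..n+1}" for i
  proof -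
    have "emeasure lborel ((\<lambda>y. c * y) -` A i) = emeasure (distr lborel borel ((*) c)) (A i)"
      using A[OF i] by (subst emeasure_distr) auto
    also have "\<dots> = ennreal (inverse c) * emeasure lborel (A i)"
      using c A[OF i] by (simp add: lborel_distr_mult emeasure_density_const)
    finally show ?thesis
      using c by (simp add: mult.assoc[symmetric] ennreal_mult[symmetric])
  qed
  have "?T -` (Pi\<^sub>E {1..n+1} A) \<inter> space ?L = Pi\<^sub>E {1..n+1} (\<lambda>i. (\<lambda>y. c * y) -` A i)"
    by (auto simp: space_PiM PiE_iff extensional_def)
  then have "emeasure (distr ?L ?L ?T) (Pi\<^sub>E {1..n+1} A) = (\<Prod>i\<in>{1..n+1}. emeasure lborel ((\<lambda>y. c * y) -` A i))"
    using A B lborel_product.emeasure_PiM[of "{1..n+1}" "\<lambda>i. (\<lambda>y. c * y) -` A i"]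
    by (subst emeasure_distr[OF T]) (auto intro!: sets_PiM_I_finite simp del: prod.cl_ivl_Suc)
  then have "emeasure (scale_measure (ennreal (c ^ (n + 1))) (distr ?L ?L ?T)) (Pi\<^sub>E {1..n+1} A)
      = (\<Prod>i\<in>{1..n+1}. ennreal c) * (\<Prod>i\<in>{1..n+1}. emeasure lborel ((\<lambda>y. c * y) -` A i))"
    using c by (simp add: ennreal_power del: power_Suc prod.cl_ivl_Suc)
  also have "\<dots> = (\<Prod>i\<in>{1..n+1}. ennreal c * emeasure lborel ((\<lambda>y. c * y) -` A i))"
    by (rule prod.distrib[symmetric])
  also have "\<dots> = (\<Prod>i\<in>{1..n+1}. emeasure lborel (A i))"
    by (rule prod.cong) (auto simp: one simp del: One_nat_def)
  finally show "emeasure (scale_measure (ennreal (c ^ (n + 1))) (distr ?L ?L ?T)) (Pi\<^sub>E {1..n+1} A)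
      = (\<Prod>i\<in>{1..n+1}. emeasure lborel (A i))" .
qed auto

lemma integral_dilation:
  fixes g :: "(nat \<Rightarrow> real) \<Rightarrow> real"
  assumes [measurable]: "g \<in> borel_measurable (lebesgue_space n)" and c: "c > 0"
  shows "(\<integral>x. g x \<partial>lebesgue_space n) = c ^ (n + 1) * (\<integral>x. g (\<lambda>i\<in>{1..n+1}. c * x i) \<partial>lebesgue_space n)"
proof -
  have "(\<integral>x. g x \<partial>lebesgue_space n) =
      (\<integral>x. g x \<partial>scale_measure (ennreal (c ^ (n + 1))) (distr (lebesgue_space n) (lebesgue_space n) (\<lambda>x. \<lambda>i\<in>{1..n+1}. c * x i)))"
    using lebesgue_space_dilation[OF c] by simp
  also have "\<dots> = c ^ (n + 1) * (\<integral>x. g x \<partial>distr (lebesgue_space n) (lebesgue_space n) (\<lambda>x. \<lambda>i\<in>{1..n+1}. c * x i))"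
    using c by (intro integral_scale_measure) auto
  also have "(\<integral>x. g x \<partial>distr (lebesgue_space n) (lebesgue_space n) (\<lambda>x. \<lambda>i\<in>{1..n+1}. c * x i)) =
      (\<integral>x. g (\<lambda>i\<in>{1..n+1}. c * x i) \<partial>lebesgue_space n)"
    by (rule integral_distr[OF dilation_measurable assms(1)])
  finally show ?thesis .
qed

text \<open>The hyperplane is a box with one side of length zero. It disposes of the origin here
  and, after projection, of the poles of the sphere.\<close>

lemma hyperplane_null:
  assumes i: "i \<in> {1..n+1}"
  shows "AE x in lebesgue_space n. x i \<noteq> 0"
proof (rule AE_I')
  have "emeasure (lebesgue_space n) (Pi\<^sub>E {1..n+1} (\<lambda>j. if j = i then {0} else UNIV)) =
      (\<Prod>j\<in>{1..n+1}. emeasure lborel (if j = i then {0::real} else UNIV))"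
    unfolding lebesgue_space_def by (rule lborel_product.emeasure_PiM) auto
  also have "\<dots> = 0"
    using i by (intro prod_zero) auto
  finally show "Pi\<^sub>E {1..n+1} (\<lambda>j. if j = i then {0} else UNIV) \<in> null_sets (lebesgue_space n)"
    by (intro null_setsI) (auto simp: lebesgue_space_def intro!: sets_PiM_I_finite)
  show "{x \<in> space (lebesgue_space n). \<not> x i \<noteq> 0} \<subseteq> Pi\<^sub>E {1..n+1} (\<lambda>j. if j = i then {0} else UNIV)"
    by (auto simp: space_lebesgue_space PiE_iff extensional_def)
qed

lemma component_le_L2_set: "i \<in> {1..n+1} \<Longrightarrow> \<bar>x i\<bar> \<le> L2_set x {1..n+1}"
  using member_le_L2_set[of "{1..n+1}" i "\<lambda>i. \<bar>x i\<bar>"] by (simp add: L2_set_def)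

lemma ball_finite: "emeasure (lebesgue_space n) {x \<in> space (lebesgue_space n). L2_set x {1..n+1} < s} < \<infinity>"
proof -
  have "emeasure (lebesgue_space n) {x \<in> space (lebesgue_space n). L2_set x {1..n+1} < s} \<le>
      emeasure (lebesgue_space n) (Pi\<^sub>E {1..n+1} (\<lambda>j. {-s..s}))"
  proof (rule emeasure_mono)
    show "{x \<in> space (lebesgue_space n). L2_set x {1..n+1} < s} \<subseteq> Pi\<^sub>E {1..n+1} (\<lambda>j. {-s..s})"
    proof
      fix x assume x: "x \<in> {x \<in> space (lebesgue_space n). L2_set x {1..n+1} < s}"
      have "x i \<in> {-s..s}" if "i \<in> {1..n+1}" for i
        using component_le_L2_set[OF that, of x] x by (auto simp: abs_le_iff)
      then show "x \<in> Pi\<^sub>E {1..n+1} (\<lambda>j. {-s..s})"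
        using x by (auto simp: space_lebesgue_space PiE_iff)
    qed
  qed (auto simp: lebesgue_space_def intro!: sets_PiM_I_finite)
  also have "\<dots> = (\<Prod>j\<in>{1..n+1}. emeasure lborel {-s..s})"
    unfolding lebesgue_space_def by (rule lborel_product.emeasure_PiM) auto
  also have "\<dots> = ennreal (measure lborel {-s..s} ^ (n + 1))"
    by (simp add: emeasure_eq_ennreal_measure ennreal_power del: power_Suc prod.cl_ivl_Suc)
  also have "\<dots> < \<infinity>" by simp
  finally show ?thesis .
qed

end

section \<open>Radial projection and integration in polar coordinates\<close>

context
  fixes n :: nat
begin

lemma radial_proj_in_space: "radial_proj n x \<in> space (lebesgue_space n)"
  by (simp add: space_lebesgue_space radial_proj_def)

text \<open>Division by zero returns 0, so a point of norm zero is sent to the origin and not to the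
  sphere; hence the case distinction.\<close>

lemma L2_set_radial_proj: "L2_set (radial_proj n x) {1..n+1} = (if L2_set x {1..n+1} = 0 then 0 else 1)"
proof -
  have "L2_set (radial_proj n x) {1..n+1} = L2_set (\<lambda>i. (1 / L2_set x {1..n+1}) * x i) {1..n+1}"
    by (rule L2_set_cong) (auto simp: radial_proj_def)
  also have "\<dots> = (1 / L2_set x {1..n+1}) * L2_set x {1..n+1}"
    by (rule L2_set_right_distrib[symmetric]) simp
  finally show ?thesis by simp
qed

lemma radial_proj_dilation:
  assumes "c > 0"
  shows "radial_proj n (\<lambda>i\<in>{1..n+1}. c * x i) = radial_proj n x"
  unfolding radial_proj_def
  by (rule restrict_ext) (use assms L2_set_dilation[where c = c and n = n and x = x] in simp)

lemma dilation_radial_proj: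
  assumes "x \<in> space (lebesgue_space n)"
  shows "(\<lambda>i\<in>{1..n+1}. L2_set x {1..n+1} * radial_proj n x i) = x"
proof (rule extensionalityI[of _ "{1..n+1}"])
  show "x \<in> extensional {1..n+1}"
    using assms by (auto simp: space_lebesgue_space PiE_iff)
  fix i assume i: "i \<in> {1..n+1}"
  show "(\<lambda>i\<in>{1..n+1}. L2_set x {1..n+1} * radial_proj n x i) i = x i"
  proof (cases "L2_set x {1..n+1} = 0")
    case True
    then have "x i = 0" using component_le_L2_set[OF i, of x] by simp
    then show ?thesis using i True by simp
  next
    case False
    then show ?thesis using i by (simp add: radial_proj_def)
  qed
qed auto

lemma ball_set [measurable]: "{x \<in> space (lebesgue_space n). L2_set x {1..n+1} < s} \<in> sets (lebesgue_space n)"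
  using L2_set_measurable[of n] by measurable

lemma integrable_on_ball:
  fixes g :: "(nat \<Rightarrow> real) \<Rightarrow> real"
  assumes [measurable]: "g \<in> borel_measurable (lebesgue_space n)"
    and B: "\<And>x. x \<in> space (lebesgue_space n) \<Longrightarrow> \<bar>g x\<bar> \<le> B"
  shows "integrable (lebesgue_space n) (\<lambda>x. indicator {..<s} (L2_set x {1..n+1}) * g x)"
proof -
  note L2_set_measurable[of n, measurable]
  let ?A = "{x \<in> space (lebesgue_space n). L2_set x {1..n+1} < s}"
  have "integrable (lebesgue_space n) (\<lambda>x. indicator ?A x *\<^sub>R B)"
    using ball_finite[of n s] ball_set by (intro integrable_scaleR_left integrable_real_indicator) auto
  then show ?thesis
    by (rule Bochner_Integration.integrable_bound)
       (measurable, auto simp: indicator_def intro!: AE_I2 order.trans[OF B])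
qed

lemma punctured_ball_eq:
  "punctured_ball n = {x \<in> space (lebesgue_space n). 0 < L2_set x {1..n+1} \<and> L2_set x {1..n+1} < 1}"
  by (auto simp: punctured_ball_def space_lebesgue_space)

lemma punctured_ball_measurable: "punctured_ball n \<in> sets (lebesgue_space n)"
proof -
  note L2_set_measurable[of n, measurable]
  show ?thesis unfolding punctured_ball_eq by measurable
qed

lemma radial_proj_measurable_sphere:
  "radial_proj n \<in> restrict_space (lebesgue_space n) (punctured_ball n) \<rightarrow>\<^sub>M
     restrict_space (lebesgue_space n) (unit_sphere n)"
proof (rule measurable_restrict_space3[OF radial_proj_measurable])
  show "radial_proj n \<in> punctured_ball n \<rightarrow> unit_sphere n"
    using radial_proj_in_space
    by (auto simp: punctured_ball_def unit_sphere_def L2_set_radial_proj space_lebesgue_space simp del: One_nat_def)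
qed

text \<open>The definition unfolded as a scaled image measure. The puncture lies in a null
  hyperplane, so the indicator may be that of the whole open ball, which behaves well under
  dilations.\<close>

lemma surface_integral:
  fixes f :: "(nat \<Rightarrow> real) \<Rightarrow> real"
  assumes f [measurable]: "f \<in> borel_measurable (lebesgue_space n)"
  shows "(\<integral>x. f x \<partial>surface_measure n) =
     (real n + 1) * (\<integral>x. indicator {..<1} (L2_set x {1..n+1}) * f (radial_proj n x) \<partial>lebesgue_space n)"
proof -
  note L2_set_measurable[of n, measurable] radial_proj_measurable[of n, measurable]
  have f': "f \<in> borel_measurable (restrict_space (lebesgue_space n) (unit_sphere n))"
    by (rule measurable_restrict_space1) measurable
  have "(\<integral>x. f x \<partial>surface_measure n) = real (n + 1) *
      (\<integral>x. f x \<partial>distr (restrict_space (lebesgue_space n) (punctured_ball n))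
              (restrict_space (lebesgue_space n) (unit_sphere n)) (radial_proj n))"
    unfolding surface_measure_def using f'
    by (subst ennreal_of_nat_eq_real_of_nat, subst integral_scale_measure) simp_all
  also have "\<dots> = real (n + 1) * (\<integral>x. f (radial_proj n x) \<partial>restrict_space (lebesgue_space n) (punctured_ball n))"
    by (subst integral_distr[OF radial_proj_measurable_sphere f']) simp
  also have "\<dots> = real (n + 1) * (\<integral>x. indicator (punctured_ball n) x *\<^sub>R f (radial_proj n x) \<partial>lebesgue_space n)"
    using punctured_ball_measurable by (subst integral_restrict_space) auto
  also have "(\<integral>x. indicator (punctured_ball n) x *\<^sub>R f (radial_proj n x) \<partial>lebesgue_space n) =
      (\<integral>x. indicator {..<1} (L2_set x {1..n+1}) * f (radial_proj n x) \<partial>lebesgue_space n)"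
  proof (rule integral_cong_AE)
    have ae: "AE x in lebesgue_space n. x 1 \<noteq> 0"
      by (rule hyperplane_null) simp
    show "AE x in lebesgue_space n. indicator (punctured_ball n) x *\<^sub>R f (radial_proj n x) =
        indicator {..<1} (L2_set x {1..n+1}) * f (radial_proj n x)"
      using ae AE_space
    proof eventually_elim
      case (elim x)
      then have "L2_set x {1..n+1} > 0" using component_le_L2_set[of 1 n x] by auto
      then show ?case using elim by (auto simp: punctured_ball_eq indicator_def)
    qed
    show "(\<lambda>x. indicator (punctured_ball n) x *\<^sub>R f (radial_proj n x)) \<in> borel_measurable (lebesgue_space n)"
      using punctured_ball_measurable by measurable
  qed measurable
  finally show ?thesis by (simp add: add.commute)
qed

text \<open>Polar coordinates without a product decomposition of space. Split \<open>f\<close> into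
  the d-th power of the norm and a function \<open>g\<close> constant on rays, and write the radial
  factor as a superposition of indicators of balls. After Fubini the inner integral of
  \<open>g\<close> over a ball of radius s is s^(n + 1) times that over the unit ball, and
  \<open>integral_layer\<close> evaluates the rest.\<close>

lemma integral_homogeneous_gauss:
  fixes f :: "(nat \<Rightarrow> real) \<Rightarrow> real"
  assumes f [measurable]: "f \<in> borel_measurable (lebesgue_space n)"
    and hom: "\<And>c x. x \<in> space (lebesgue_space n) \<Longrightarrow> c \<ge> 0 \<Longrightarrow> f (\<lambda>i\<in>{1..n+1}. c * x i) = c ^ d * f x"
    and bound: "\<And>x. x \<in> space (lebesgue_space n) \<Longrightarrow> L2_set x {1..n+1} \<le> 1 \<Longrightarrow> \<bar>f x\<bar> \<le> B"
  shows "(\<integral>x. f x * exp (- (L2_set x {1..n+1})\<^sup>2) \<partial>lebesgue_space n) =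
     half_moment (n + d) * (\<integral>x. f x \<partial>surface_measure n)"
proof -
  note L2_set_measurable[of n, measurable] radial_proj_measurable[of n, measurable]
  let ?L = "lebesgue_space n"
  define g where "g x = f (radial_proj n x)" for x
  have [measurable]: "g \<in> borel_measurable ?L"
    unfolding g_def[abs_def] by measurable
  have gB: "\<bar>g x\<bar> \<le> B" for x
    unfolding g_def by (rule bound[OF radial_proj_in_space], subst L2_set_radial_proj) simp
  have fg: "f x = (L2_set x {1..n+1}) ^ d * g x" if "x \<in> space ?L" for x
    using hom[OF radial_proj_in_space, of "L2_set x {1..n+1}" x] dilation_radial_proj[OF that]
    by (simp add: g_def)
  interpret L: sigma_finite_measure ?L
    unfolding lebesgue_space_def by (rule lborel_product.sigma_finite) simp
  interpret P: pair_sigma_finite lborel ?L by standard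
  have ball: "(\<integral>x. indicator {..<s} (L2_set x {1..n+1}) * h x \<partial>?L) =
      s ^ Suc n * (\<integral>x. indicator {..<1} (L2_set x {1..n+1}) * h x \<partial>?L)"
    if s: "s > 0" and [measurable]: "h \<in> borel_measurable ?L" and h: "\<And>x. h (\<lambda>i\<in>{1..n+1}. s * x i) = h x"
    for s :: real and h :: "(nat \<Rightarrow> real) \<Rightarrow> real"
  proof -
    have "(\<integral>x. indicator {..<s} (L2_set x {1..n+1}) * h x \<partial>?L) =
        s ^ (n + 1) * (\<integral>x. indicator {..<s} (L2_set (\<lambda>i\<in>{1..n+1}. s * x i) {1..n+1}) * h (\<lambda>i\<in>{1..n+1}. s * x i) \<partial>?L)"
      using s by (intro integral_dilation) measurable
    also have "(\<lambda>x. indicator {..<s} (L2_set (\<lambda>i\<in>{1..n+1}. s * x i) {1..n+1}) * h (\<lambda>i\<in>{1..n+1}. s * x i)) =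
        (\<lambda>x. indicator {..<1} (L2_set x {1..n+1}) * h x)"
      using s by (simp only: L2_set_dilation[OF less_imp_le[OF s]] h) (auto simp: indicator_def fun_eq_iff)
    finally show ?thesis by simp
  qed
  have gs: "g (\<lambda>i\<in>{1..n+1}. s * x i) = g x" if "s > 0" for s x
    using radial_proj_dilation[OF that] by (simp add: g_def)
  define K where "K = (\<integral>x. indicator {..<1} (L2_set x {1..n+1}) * g x \<partial>?L)"
  define K' where "K' = (\<integral>x. indicator {..<1} (L2_set x {1..n+1}) * \<bar>g x\<bar> \<partial>?L)"
  have inner: "(\<integral>x. layer d s * (indicator {..<s} (L2_set x {1..n+1}) * g x) \<partial>?L) =
      indicator {0<..} s * (layer d s * s ^ Suc n) * K" for s
  proof (cases "s > 0")
    case True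
    then show ?thesis using ball[OF True, of g] gs[OF True] by (simp add: K_def)
  next
    case False
    then have "indicator {..<s} (L2_set x {1..n+1}) = (0::real)" for x
      using L2_set_nonneg[of x "{1..n+1}"] by (auto simp: indicator_def simp del: L2_set_nonneg)
    then show ?thesis using False by simp
  qed
  \<comment> \<open>For \<open>d > 0\<close> the layer changes sign, so integrability on the product
    space is checked with absolute values; the constant \<open>K'\<close> never has to be
    evaluated.\<close>
  have inner': "(\<integral>x. norm (layer d s * (indicator {..<s} (L2_set x {1..n+1}) * g x)) \<partial>?L) =
      \<bar>indicator {0<..} s * (layer d s * s ^ Suc n)\<bar> * K'" for s
  proof (cases "s > 0")
    case True
    have "(\<integral>x. norm (layer d s * (indicator {..<s} (L2_set x {1..n+1}) * g x)) \<partial>?L) =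
      \<bar>layer d s\<bar> * (\<integral>x. indicator {..<s} (L2_set x {1..n+1}) * \<bar>g x\<bar> \<partial>?L)"
      by (simp add: abs_mult)
    then show ?thesis using True ball[OF True, of "\<lambda>x. \<bar>g x\<bar>"] gs[OF True] by (simp add: K'_def abs_mult)
  next
    case False
    then have "indicator {..<s} (L2_set x {1..n+1}) = (0::real)" for x
      using L2_set_nonneg[of x "{1..n+1}"] by (auto simp: indicator_def simp del: L2_set_nonneg)
    then show ?thesis using False by simp
  qed
  have int: "integrable (lborel \<Otimes>\<^sub>M ?L) (\<lambda>(s, x). layer d s * (indicator {..<s} (L2_set x {1..n+1}) * g x))"
  proof (rule P.Fubini_integrable)
    have "(\<lambda>p. layer d (fst p) * ((if L2_set (snd p) {1..n+1} < fst p then 1 else 0) * g (snd p)))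
        \<in> borel_measurable (lborel \<Otimes>\<^sub>M ?L)"
      by measurable
    then show "(\<lambda>(s, x). layer d s * (indicator {..<s} (L2_set x {1..n+1}) * g x)) \<in> borel_measurable (lborel \<Otimes>\<^sub>M ?L)"
      by (simp add: indicator_def of_bool_def case_prod_beta')
    show "integrable lborel (\<lambda>s. \<integral>x. norm (case (s, x) of (s, x) \<Rightarrow> layer d s * (indicator {..<s} (L2_set x {1..n+1}) * g x)) \<partial>?L)"
      unfolding prod.case inner' by (intro integrable_mult_left integrable_abs layer_integrable)
    show "AE s in lborel. integrable ?L (\<lambda>x. case (s, x) of (s, x) \<Rightarrow> layer d s * (indicator {..<s} (L2_set x {1..n+1}) * g x))"
      unfolding prod.case using gB by (intro AE_I2 integrable_mult_right integrable_on_ball) auto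
  qed
  have "(\<integral>x. f x * exp (- (L2_set x {1..n+1})\<^sup>2) \<partial>?L) =
      (\<integral>x. (\<integral>s. layer d s * (indicator {..<s} (L2_set x {1..n+1}) * g x) \<partial>lborel) \<partial>?L)"
  proof (rule Bochner_Integration.integral_cong[OF refl])
    fix x assume x: "x \<in> space ?L"
    have "(\<integral>s. layer d s * (indicator {..<s} (L2_set x {1..n+1}) * g x) \<partial>lborel) =
        (\<integral>s. g x * (indicator {L2_set x {1..n+1}<..} s * layer d s) \<partial>lborel)"
      by (rule Bochner_Integration.integral_cong) (auto simp: indicator_def)
    also have "\<dots> = g x * ((L2_set x {1..n+1}) ^ d * exp (- (L2_set x {1..n+1})\<^sup>2))"
      by (simp add: integral_layer_tail)
    finally show "f x * exp (- (L2_set x {1..n+1})\<^sup>2) = (\<integral>s. layer d s * (indicator {..<s} (L2_set x {1..n+1}) * g x) \<partial>lborel)"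
      using fg[OF x] by simp
  qed
  also have "\<dots> = (\<integral>s. (\<integral>x. layer d s * (indicator {..<s} (L2_set x {1..n+1}) * g x) \<partial>?L) \<partial>lborel)"
    by (rule P.Fubini_integral[OF int])
  also have "\<dots> = (real n + 1) * half_moment (n + d) * K"
    unfolding inner by (simp add: integral_layer del: power_Suc)
  also have "\<dots> = half_moment (n + d) * (\<integral>x. f x \<partial>surface_measure n)"
    by (simp add: surface_integral K_def g_def)
  finally show ?thesis .
qed

text \<open>The Gaussian weight factors over the coordinates, so the ambient integral is a product
  of one-dimensional moments; a single odd exponent makes it vanish.\<close>

lemma monomial_moment:
  "half_moment (n + (\<Sum>i\<in>{1..n+1}. e i)) * (\<integral>x. (\<Prod>i\<in>{1..n+1}. x i ^ e i) \<partial>surface_measure n) =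
     (\<Prod>i\<in>{1..n+1}. if even (e i) then 2 * half_moment (e i) else 0)"
proof -
  note component_measurable[of _ n, measurable]
  have "(\<integral>x. (\<Prod>i\<in>{1..n+1}. x i ^ e i) * exp (- (L2_set x {1..n+1})\<^sup>2) \<partial>lebesgue_space n) =
      half_moment (n + (\<Sum>i\<in>{1..n+1}. e i)) * (\<integral>x. (\<Prod>i\<in>{1..n+1}. x i ^ e i) \<partial>surface_measure n)"
  proof (rule integral_homogeneous_gauss[where B = 1])
    show "(\<lambda>x. \<Prod>i\<in>{1..n+1}. x i ^ e i) \<in> borel_measurable (lebesgue_space n)"
      by (intro borel_measurable_prod borel_measurable_power component_measurable)
    show "(\<Prod>i\<in>{1..n+1}. (\<lambda>i\<in>{1..n+1}. c * x i) i ^ e i) = c ^ (\<Sum>i\<in>{1..n+1}. e i) * (\<Prod>i\<in>{1..n+1}. x i ^ e i)" for c x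
    proof -
      have "(\<Prod>i\<in>{1..n+1}. (\<lambda>i\<in>{1..n+1}. c * x i) i ^ e i) = (\<Prod>i\<in>{1..n+1}. c ^ e i * x i ^ e i)"
        by (rule prod.cong) (auto simp: power_mult_distrib)
      then show ?thesis by (simp only: prod.distrib power_sum)
    qed
    fix x assume "L2_set x {1..n+1} \<le> 1"
    then have "\<bar>x i\<bar> \<le> 1" if "i \<in> {1..n+1}" for i
      using component_le_L2_set[OF that, of x] by linarith
    then show "\<bar>\<Prod>i\<in>{1..n+1}. x i ^ e i\<bar> \<le> 1"
      unfolding abs_prod by (intro prod_le_1) (auto simp: power_abs power_le_one)
  qed
  moreover have "(\<integral>x. (\<Prod>i\<in>{1..n+1}. x i ^ e i) * exp (- (L2_set x {1..n+1})\<^sup>2) \<partial>lebesgue_space n) =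
      (\<integral>x. (\<Prod>i\<in>{1..n+1}. x i ^ e i * exp (- (x i)\<^sup>2)) \<partial>(\<Pi>\<^sub>M i\<in>{1..n+1}. lborel))"
    by (simp add: lebesgue_space_def prod.distrib L2_set_def sum_nonneg exp_sum[symmetric] sum_negf del: prod.cl_ivl_Suc sum.cl_ivl_Suc)
  moreover have "\<dots> = (\<Prod>i\<in>{1..n+1}. (\<integral>s. s ^ e i * exp (- s\<^sup>2) \<partial>lborel))"
    by (rule lborel_product.product_integral_prod) (auto intro!: integrable.intros gauss_moment)
  moreover have "\<dots> = (\<Prod>i\<in>{1..n+1}. if even (e i) then 2 * half_moment (e i) else 0)"
    by (intro prod.cong refl has_bochner_integral_integral_eq gauss_moment)
  ultimately show ?thesis by simp
qed

end

section \<open>Zonal series\<close>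

definition zonal :: "real \<Rightarrow> (nat \<Rightarrow> real) \<Rightarrow> real \<Rightarrow> real" where
  "zonal a \<alpha> t = (\<Sum>l. \<alpha> l * geg a l t)"

text \<open>For positive \<open>a\<close> the polynomials are largest at 1, so this one condition
  makes the zonal series converge absolutely and uniformly on [-1, 1].\<close>

definition admissible :: "real \<Rightarrow> (nat \<Rightarrow> real) \<Rightarrow> bool" where
  "admissible a \<alpha> \<longleftrightarrow> summable (\<lambda>l. \<bar>\<alpha> l\<bar> * geg a l 1)"

text \<open>Only the distribution of one bounded function \<open>X\<close> matters. The two moment
  assumptions are the moment recurrence of the density proportional to (1 - t^2)^(a - 1/2), so that
  no density of the first coordinate has to be computed.\<close>

locale ultraspherical = finite_measure M for M :: "'a measure" +
  fixes X :: "'a \<Rightarrow> real" and a :: real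
  assumes a_pos: "a > 0"
    and X_measurable [measurable]: "X \<in> borel_measurable M"
    and X_bounded: "\<And>x. x \<in> space M \<Longrightarrow> \<bar>X x\<bar> \<le> 1"
    and moment_1: "(\<integral>x. X x \<partial>M) = 0"
    and moment_step: "\<And>k. (real k + 2 * a + 2) * (\<integral>x. X x ^ (k + 2) \<partial>M) = (real k + 1) * (\<integral>x. X x ^ k \<partial>M)"
begin

lemma integrable_bounded:
  fixes f :: "'a \<Rightarrow> real"
  assumes "f \<in> borel_measurable M" "\<And>x. x \<in> space M \<Longrightarrow> \<bar>f x\<bar> \<le> B"
  shows "integrable M f"
  using assms by (intro integrable_const_bound[where B = B] AE_I2) auto

lemma poly_bound: "x \<in> space M \<Longrightarrow> \<bar>poly p (X x)\<bar> \<le> (\<Sum>i\<le>degree p. \<bar>coeff p i\<bar>)"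
  unfolding poly_altdef
  by (rule order.trans[OF sum_abs]) (auto intro!: sum_mono mult_left_le simp: abs_mult power_abs power_le_one X_bounded)

lemma poly_X_measurable [measurable]: "(\<lambda>x. poly p (X x)) \<in> borel_measurable M"
  unfolding poly_altdef by measurable

lemma integrable_poly: "integrable M (\<lambda>x. poly p (X x))"
  by (rule integrable_bounded[OF poly_X_measurable poly_bound])

text \<open>In terms of the density, the integrand times (1 - t^2)^(a - 1/2) is the derivative of (1
  - t^2)^(a + 1/2) p(t). With moments only: the claim is linear in \<open>p\<close>, and on a
  monomial it is \<open>moment_step\<close>, or \<open>moment_1\<close> for constants.\<close>

lemma adjoint_identity:
  "(\<integral>x. poly ([:1, 0, -1:] * pderiv p - smult (2 * a + 1) ([:0, 1:] * p)) (X x) \<partial>M) = 0"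
proof -
  define \<Phi> where "\<Phi> q = (\<integral>x. poly ([:1, 0, -1:] * pderiv q - smult (2 * a + 1) ([:0, 1:] * q)) (X x) \<partial>M)" for q
  have add: "\<Phi> (q + r) = \<Phi> q + \<Phi> r" for q r
    unfolding \<Phi>_def
    by (subst Bochner_Integration.integral_add[symmetric, OF integrable_poly integrable_poly])
       (simp add: pderiv_add algebra_simps smult_add_right)
  have pw: "integrable M (\<lambda>x. X x ^ k)" for k
    using integrable_poly[of "monom 1 k"] by (simp add: poly_monom)
  have mono: "\<Phi> (monom c k) = 0" for c k
  proof (cases k)
    case 0
    have "\<Phi> (monom c k) = (\<integral>x. - (2 * a + 1) * c * X x \<partial>M)"
      unfolding \<Phi>_def 0
      by (rule Bochner_Integration.integral_cong) (simp_all add: monom_0 algebra_simps)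
    also have "\<dots> = - (2 * a + 1) * c * (\<integral>x. X x \<partial>M)"
      by (rule integral_mult_right_zero)
    finally show ?thesis by (simp add: moment_1)
  next
    case (Suc j)
    have "\<Phi> (monom c k) = (\<integral>x. c * ((real j + 1) * X x ^ j - (real j + 2 * a + 2) * X x ^ (j + 2)) \<partial>M)"
      unfolding \<Phi>_def Suc
      by (rule Bochner_Integration.integral_cong)
         (simp_all add: pderiv_monom poly_monom algebra_simps del: mult_pCons_left)
    also have "\<dots> = c * ((real j + 1) * (\<integral>x. X x ^ j \<partial>M) - (real j + 2 * a + 2) * (\<integral>x. X x ^ (j + 2) \<partial>M))"
      by (subst integral_mult_right_zero, subst Bochner_Integration.integral_diff)
         (auto intro!: integrable_mult_right pw simp del: power_Suc)
    finally show ?thesis by (subst (asm) moment_step) simp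
  qed
  have "\<Phi> (\<Sum>i\<in>A. monom (coeff p i) i) = 0" if "finite A" for A
    using that
  proof (induction A)
    case empty
    show ?case using mono[of 0 0] by simp
  qed (simp add: add mono)
  from this[of "{..degree p}"] show ?thesis
    by (simp add: poly_as_sum_of_monoms \<Phi>_def)
qed

text \<open>Sturm-Liouville argument: the adjoint identity is applied to the Wronskian of the two
  polynomials, and the differential equation turns the integrand into the difference of the
  eigenvalues times their product.\<close>

lemma gegenbauer_orthogonal:
  assumes "j \<noteq> k"
  shows "(\<integral>x. geg a j (X x) * geg a k (X x) \<partial>M) = 0"
proof -
  let ?J = "gegenbauer a j" and ?K = "gegenbauer a k"
  let ?p = "pderiv ?J * ?K - ?J * pderiv ?K"
  define c where "c = real k * (real k + 2 * a) - real j * (real j + 2 * a)"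
  have "poly ([:1, 0, -1:] * pderiv ?p - smult (2 * a + 1) ([:0, 1:] * ?p)) t = c * (geg a j t * geg a k t)" for t
  proof -
    have "poly ([:1, 0, -1:] * pderiv ?p - smult (2 * a + 1) ([:0, 1:] * ?p)) t =
       ((1 - t\<^sup>2) * geg'' a j t - (2 * a + 1) * t * geg' a j t) * geg a k t -
       ((1 - t\<^sup>2) * geg'' a k t - (2 * a + 1) * t * geg' a k t) * geg a j t"
      by (simp only: pderiv_diff pderiv_mult poly_diff poly_mult poly_add poly_smult)
         (simp add: power2_eq_square algebra_simps)
    then show ?thesis
      unfolding gegenbauer_ode by (simp add: c_def algebra_simps)
  qed
  then have "c * (\<integral>x. geg a j (X x) * geg a k (X x) \<partial>M) = 0"
    using adjoint_identity[of ?p] by simp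
  moreover have "c = (real k - real j) * (real k + real j + 2 * a)"
    by (simp add: c_def algebra_simps)
  then have "c \<noteq> 0"
    using assms a_pos by (auto simp: add_nonneg_eq_0_iff)
  ultimately show ?thesis by simp
qed

definition "mass = measure M (space M)"

definition "sqnorm l = (\<integral>x. (geg a l (X x))\<^sup>2 \<partial>M)"

lemma integrable_geg_mult: "integrable M (\<lambda>x. geg a j (X x) * geg a k (X x))"
  using integrable_poly[of "gegenbauer a j * gegenbauer a k"] by simp

lemma integrable_X_geg_mult: "integrable M (\<lambda>x. X x * geg a j (X x) * geg a k (X x))"
  using integrable_poly[of "[:0, 1:] * gegenbauer a j * gegenbauer a k"] by (simp add: mult.assoc)

lemma recurrence_integrated:
  "(real l + 2) * (\<integral>x. geg a (Suc (Suc l)) (X x) * geg a k (X x) \<partial>M) =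
     2 * (real l + 1 + a) * (\<integral>x. X x * geg a (Suc l) (X x) * geg a k (X x) \<partial>M) -
     (real l + 2 * a) * (\<integral>x. geg a l (X x) * geg a k (X x) \<partial>M)"
proof -
  have "(real l + 2) * (\<integral>x. geg a (Suc (Suc l)) (X x) * geg a k (X x) \<partial>M) =
     (\<integral>x. ((real l + 2) * geg a (Suc (Suc l)) (X x)) * geg a k (X x) \<partial>M)"
    by (simp add: mult.assoc)
  also have "\<dots> = (\<integral>x. 2 * (real l + 1 + a) * (X x * geg a (Suc l) (X x) * geg a k (X x)) -
     (real l + 2 * a) * (geg a l (X x) * geg a k (X x)) \<partial>M)"
    unfolding gegenbauer_recurrence by (simp add: algebra_simps)
  also have "\<dots> = 2 * (real l + 1 + a) * (\<integral>x. X x * geg a (Suc l) (X x) * geg a k (X x) \<partial>M) -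
     (real l + 2 * a) * (\<integral>x. geg a l (X x) * geg a k (X x) \<partial>M)"
    by (subst Bochner_Integration.integral_diff)
       (auto intro!: integrable_mult_right integrable_geg_mult integrable_X_geg_mult)
  finally show ?thesis .
qed

text \<open>The mixed integral \<open>I\<close> is evaluated by the recurrence in two ways, paired
  with the polynomial of index \<open>l\<close> and with that of index \<open>l + 1\<close>.
  Orthogonality removes one term each time, and eliminating \<open>I\<close> gives the quotient of
  consecutive square norms.\<close>

lemma sqnorm_eq: "sqnorm l = mass * a / (real l + a) * geg a l 1"
proof (induction l)
  case 0
  show ?case using a_pos by (simp add: sqnorm_def mass_def)
next
  case (Suc l)
  define I where "I = (\<integral>x. X x * geg a (Suc l) (X x) * geg a l (X x) \<partial>M)"
  have 1: "2 * (real l + 1 + a) * I = (real l + 2 * a) * sqnorm l"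
    using recurrence_integrated[of l l] gegenbauer_orthogonal[of "Suc (Suc l)" l]
    by (simp add: I_def sqnorm_def power2_eq_square)
  have 2: "(real l + 1) * sqnorm (Suc l) = 2 * (real l + a) * I"
  proof (cases l)
    case 0
    \<comment> \<open>The three-term recurrence produces indices from 2 on only, so the explicit
      linear polynomial \<open>2 a t\<close> is used here.\<close>
    have "sqnorm 1 = (\<integral>x. 2 * a * (X x * geg a (Suc 0) (X x) * geg a 0 (X x)) \<partial>M)"
      unfolding sqnorm_def by (rule Bochner_Integration.integral_cong) (simp_all add: power2_eq_square)
    also have "\<dots> = 2 * a * (\<integral>x. X x * geg a (Suc 0) (X x) * geg a 0 (X x) \<partial>M)"
      by (rule integral_mult_right_zero)
    finally show ?thesis
      unfolding 0 I_def by simp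
  next
    case (Suc j)
    then show ?thesis
      using recurrence_integrated[of j "Suc l"] gegenbauer_orthogonal[of j "Suc l"]
      by (simp add: I_def sqnorm_def power2_eq_square mult_ac add_ac)
  qed
  have "(real l + 1) * (real l + 1 + a) * sqnorm (Suc l) = (real l + a) * (2 * (real l + 1 + a) * I)"
    using arg_cong[OF 2, of "\<lambda>u. (real l + 1 + a) * u"] by (simp only: mult_ac)
  also have "\<dots> = (real l + a) * (real l + 2 * a) * (mass * a / (real l + a) * geg a l 1)"
    unfolding 1 Suc.IH by simp
  also have "\<dots> = mass * a * ((real l + 2 * a) * geg a l 1)"
    using a_pos by simp
  also have "(real l + 2 * a) * geg a l 1 = (real l + 1) * geg a (Suc l) 1"
    using gegenbauer_first_order[of 1 a l] by simp
  finally have E: "(real l + 1) * ((real l + 1 + a) * sqnorm (Suc l)) = (real l + 1) * (mass * a * geg a (Suc l) 1)"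
    by (simp add: mult_ac)
  have "real l + 1 \<noteq> 0" by linarith
  then have "(real l + 1 + a) * sqnorm (Suc l) = mass * a * geg a (Suc l) 1"
    using E by (rule mult_left_cancel[THEN iffD1])
  then show ?case using a_pos by (simp add: field_simps)
qed

lemma geg_1_nonneg: "geg a l 1 \<ge> 0"
  using gegenbauer_abs_le[OF a_pos, of 1 l] by simp

lemma zonal_term_le:
  assumes "\<bar>t\<bar> \<le> 1"
  shows "norm (\<alpha> l * geg a l t) \<le> \<bar>\<alpha> l\<bar> * geg a l 1"
  using gegenbauer_abs_le[OF a_pos assms] by (simp add: abs_mult mult_left_mono)

lemma zonal_summable:
  assumes "admissible a \<alpha>" "\<bar>t\<bar> \<le> 1"
  shows "summable (\<lambda>l. norm (\<alpha> l * geg a l t))"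
proof (rule summable_comparison_test'[of _ 0])
  show "summable (\<lambda>l. \<bar>\<alpha> l\<bar> * geg a l 1)" using assms(1) by (simp only: admissible_def)
  show "norm (norm (\<alpha> l * geg a l t)) \<le> \<bar>\<alpha> l\<bar> * geg a l 1" for l
    using zonal_term_le[OF assms(2), of \<alpha> l] by (simp only: real_norm_def abs_abs)
qed

lemma zonal_abs_le:
  assumes "admissible a \<alpha>" "\<bar>t\<bar> \<le> 1"
  shows "\<bar>zonal a \<alpha> t\<bar> \<le> (\<Sum>l. \<bar>\<alpha> l\<bar> * geg a l 1)"
proof -
  have "norm (zonal a \<alpha> t) \<le> (\<Sum>l. norm (\<alpha> l * geg a l t))"
    unfolding zonal_def by (rule summable_norm[OF zonal_summable[OF assms]])
  also have "\<dots> \<le> (\<Sum>l. \<bar>\<alpha> l\<bar> * geg a l 1)"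
    using zonal_term_le[OF assms(2)] zonal_summable[OF assms] assms(1) unfolding admissible_def
    by (intro suminf_le)
  finally show ?thesis by simp
qed

lemma zonal_X_measurable [measurable]: "(\<lambda>x. zonal a \<alpha> (X x)) \<in> borel_measurable M"
  unfolding zonal_def by measurable

text \<open>Termwise integration on a finite measure space: the terms are dominated by the end-point
  series times the bound of \<psi>.\<close>

lemma zonal_integral_sums:
  assumes \<alpha>: "admissible a \<alpha>" and \<psi> [measurable]: "\<psi> \<in> borel_measurable M"
    and B: "\<And>x. x \<in> space M \<Longrightarrow> \<bar>\<psi> x\<bar> \<le> B"
  shows "(\<lambda>l. \<alpha> l * (\<integral>x. geg a l (X x) * \<psi> x \<partial>M)) sums (\<integral>x. zonal a \<alpha> (X x) * \<psi> x \<partial>M)"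
proof -
  let ?f = "\<lambda>l x. \<alpha> l * geg a l (X x) * \<psi> x"
  have bnd: "norm (?f l x) \<le> \<bar>\<alpha> l\<bar> * geg a l 1 * B" if "x \<in> space M" for l x
    using mult_mono[OF zonal_term_le[OF X_bounded[OF that], of \<alpha> l] B[OF that]] geg_1_nonneg
    by (simp add: abs_mult)
  have "(\<lambda>l. \<integral>x. ?f l x \<partial>M) sums (\<integral>x. (\<Sum>l. ?f l x) \<partial>M)"
  proof (rule sums_integral)
    show int: "integrable M (?f l)" for l
      by (rule integrable_bounded[where B = "\<bar>\<alpha> l\<bar> * geg a l 1 * B"]) (measurable, use bnd in auto)
    show "AE x in M. summable (\<lambda>l. norm (?f l x))"
    proof (rule AE_I2)
      fix x assume "x \<in> space M"
      then have "summable (\<lambda>l. norm (\<alpha> l * geg a l (X x)) * norm (\<psi> x))"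
        by (intro summable_mult2 zonal_summable[OF \<alpha>] X_bounded)
      then show "summable (\<lambda>l. norm (?f l x))" by (simp only: norm_mult)
    qed
    have le: "norm (\<integral>x. norm (?f l x) \<partial>M) \<le> mass * B * (\<bar>\<alpha> l\<bar> * geg a l 1)" for l
    proof -
      have "(\<integral>x. norm (?f l x) \<partial>M) \<le> (\<integral>x. \<bar>\<alpha> l\<bar> * geg a l 1 * B \<partial>M)"
        by (rule integral_mono[OF integrable_norm[OF int]]) (use bnd in auto)
      also have "\<dots> = mass * B * (\<bar>\<alpha> l\<bar> * geg a l 1)"
        by (simp add: mass_def)
      finally show ?thesis by simp
    qed
    have "summable (\<lambda>l. mass * B * (\<bar>\<alpha> l\<bar> * geg a l 1))"
      by (intro summable_mult) (use \<alpha> admissible_def in auto)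
    then show "summable (\<lambda>l. \<integral>x. norm (?f l x) \<partial>M)"
      by (rule summable_comparison_test'[of _ 0]) (rule le)
  qed
  moreover have "(\<integral>x. (\<Sum>l. ?f l x) \<partial>M) = (\<integral>x. zonal a \<alpha> (X x) * \<psi> x \<partial>M)"
    unfolding zonal_def
    by (intro Bochner_Integration.integral_cong refl suminf_mult2[symmetric] summable_norm_cancel[OF zonal_summable[OF \<alpha>]] X_bounded)
  ultimately show ?thesis by (simp add: mult.assoc)
qed

lemma integral_geg_zonal:
  assumes \<alpha>: "admissible a \<alpha>"
  shows "(\<integral>x. geg a k (X x) * zonal a \<alpha> (X x) \<partial>M) = \<alpha> k * sqnorm k"
proof -
  have "(\<lambda>l. \<alpha> l * (\<integral>x. geg a l (X x) * geg a k (X x) \<partial>M)) sums (\<integral>x. zonal a \<alpha> (X x) * geg a k (X x) \<partial>M)"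
    by (rule zonal_integral_sums[OF \<alpha> _ poly_bound]) auto
  moreover have "(\<lambda>l. \<alpha> l * (\<integral>x. geg a l (X x) * geg a k (X x) \<partial>M)) = (\<lambda>l. if l = k then \<alpha> k * sqnorm k else 0)"
    using gegenbauer_orthogonal by (auto simp: sqnorm_def power2_eq_square)
  ultimately show ?thesis
    using sums_unique2[OF _ sums_single[of k "\<lambda>_. \<alpha> k * sqnorm k"]] by (simp add: mult.commute)
qed

lemma integral_zonal_mult:
  assumes \<alpha>: "admissible a \<alpha>" and \<beta>: "admissible a \<beta>"
  shows "(\<lambda>l. \<alpha> l * \<beta> l * sqnorm l) sums (\<integral>x. zonal a \<alpha> (X x) * zonal a \<beta> (X x) \<partial>M)"
  using zonal_integral_sums[OF \<alpha> zonal_X_measurable zonal_abs_le[OF \<beta> X_bounded]]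
  by (simp add: integral_geg_zonal[OF \<beta>] mult.assoc)

text \<open>The recurrence turns multiplication by \<open>X\<close> into a move to the two
  neighbouring indices. Index 0 has no left neighbour, whence the conditional guarding
  \<open>l - 1\<close>.\<close>

lemma integral_X_geg_zonal:
  assumes \<alpha>: "admissible a \<alpha>"
  shows "2 * (real l + a) * (\<integral>x. X x * geg a l (X x) * zonal a \<alpha> (X x) \<partial>M) =
     (real l + 1) * \<alpha> (Suc l) * sqnorm (Suc l) + (real l + 2 * a - 1) * (if l = 0 then 0 else \<alpha> (l - 1) * sqnorm (l - 1))"
proof -
  have int: "integrable M (\<lambda>x. geg a k (X x) * zonal a \<alpha> (X x))" for k
    by (rule integrable_bounded[where B = "(\<Sum>i\<le>degree (gegenbauer a k). \<bar>coeff (gegenbauer a k) i\<bar>) * (\<Sum>l. \<bar>\<alpha> l\<bar> * geg a l 1)"])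
       (auto simp: abs_mult intro!: mult_mono poly_bound zonal_abs_le[OF \<alpha>] X_bounded sum_nonneg)
  show ?thesis
  proof (cases l)
    case 0
    have "\<alpha> 1 * sqnorm 1 = (\<integral>x. 2 * a * (X x * geg a 0 (X x) * zonal a \<alpha> (X x)) \<partial>M)"
      unfolding integral_geg_zonal[OF \<alpha>, symmetric]
      by (rule Bochner_Integration.integral_cong) simp_all
    also have "\<dots> = 2 * a * (\<integral>x. X x * geg a 0 (X x) * zonal a \<alpha> (X x) \<partial>M)"
      by (rule integral_mult_right_zero)
    finally show ?thesis
      unfolding 0 by simp
  next
    case (Suc j)
    have "2 * (real l + a) * (\<integral>x. X x * geg a l (X x) * zonal a \<alpha> (X x) \<partial>M) =
        (\<integral>x. (2 * (real j + 1 + a) * X x * geg a (Suc j) (X x)) * zonal a \<alpha> (X x) \<partial>M)"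
      by (simp add: Suc mult.assoc add_ac)
    also have "\<dots> = (\<integral>x. (real j + 2) * (geg a (Suc (Suc j)) (X x) * zonal a \<alpha> (X x)) +
         (real j + 2 * a) * (geg a j (X x) * zonal a \<alpha> (X x)) \<partial>M)"
    proof (rule Bochner_Integration.integral_cong[OF refl])
      fix x
      have "2 * (real j + 1 + a) * X x * geg a (Suc j) (X x) =
          (real j + 2) * geg a (Suc (Suc j)) (X x) + (real j + 2 * a) * geg a j (X x)"
        unfolding gegenbauer_recurrence by simp
      then show "(2 * (real j + 1 + a) * X x * geg a (Suc j) (X x)) * zonal a \<alpha> (X x) =
          (real j + 2) * (geg a (Suc (Suc j)) (X x) * zonal a \<alpha> (X x)) +
         (real j + 2 * a) * (geg a j (X x) * zonal a \<alpha> (X x))"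
        by (simp only: distrib_right mult.assoc)
    qed
    also have "\<dots> = (real j + 2) * (\<alpha> (Suc (Suc j)) * sqnorm (Suc (Suc j))) + (real j + 2 * a) * (\<alpha> j * sqnorm j)"
      by (subst Bochner_Integration.integral_add) (auto intro!: integrable_mult_right int simp: integral_geg_zonal[OF \<alpha>])
    finally show ?thesis by (simp add: Suc mult_ac add_ac)
  qed
qed

text \<open>Only one of the two zonal factors is expanded; \<open>X\<close> times the other one
  stays a bounded function, so that a single series arises instead of a double one.\<close>

lemma integral_X_zonal_square:
  assumes \<alpha>: "admissible a \<alpha>"
  shows "(\<lambda>l. \<alpha> l * ((real l + 1) * \<alpha> (Suc l) * sqnorm (Suc l) + (real l + 2 * a - 1) * (if l = 0 then 0 else \<alpha> (l - 1) * sqnorm (l - 1)))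
      / (2 * (real l + a))) sums (\<integral>x. X x * (zonal a \<alpha> (X x))\<^sup>2 \<partial>M)"
proof -
  have "(\<lambda>l. \<alpha> l * (\<integral>x. geg a l (X x) * (X x * zonal a \<alpha> (X x)) \<partial>M)) sums (\<integral>x. zonal a \<alpha> (X x) * (X x * zonal a \<alpha> (X x)) \<partial>M)"
  proof (rule zonal_integral_sums[OF \<alpha>])
    show "\<bar>X x * zonal a \<alpha> (X x)\<bar> \<le> 1 * (\<Sum>l. \<bar>\<alpha> l\<bar> * geg a l 1)" if "x \<in> space M" for x
      unfolding abs_mult using that by (intro mult_mono X_bounded zonal_abs_le[OF \<alpha>]) auto
  qed measurable
  moreover have "(\<integral>x. geg a l (X x) * (X x * zonal a \<alpha> (X x)) \<partial>M) =
      ((real l + 1) * \<alpha> (Suc l) * sqnorm (Suc l) + (real l + 2 * a - 1) * (if l = 0 then 0 else \<alpha> (l - 1) * sqnorm (l - 1)))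
      / (2 * (real l + a))" for l
    using integral_X_geg_zonal[OF \<alpha>, of l] a_pos by (simp add: field_simps)
  ultimately show ?thesis
    by (simp add: power2_eq_square mult_ac)
qed

end

section \<open>The first coordinate under the surface measure\<close>

lemma space_surface_measure: "space (surface_measure n) = unit_sphere n"
  by (auto simp: surface_measure_def space_scale_measure space_restrict_space unit_sphere_def space_lebesgue_space)

lemma measurable_surface_measure:
  "f \<in> borel_measurable (lebesgue_space n) \<Longrightarrow> f \<in> borel_measurable (surface_measure n)"
  unfolding surface_measure_def
  by (subst measurable_cong_sets[OF sets_scale_measure refl], subst measurable_cong_sets[OF sets_distr refl])
     (rule measurable_restrict_space1)

lemma finite_measure_surface: "finite_measure (surface_measure n)"
proof
  let ?L = "lebesgue_space n" and ?PB = "punctured_ball n"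
  let ?D = "distr (restrict_space ?L ?PB) (restrict_space ?L (unit_sphere n)) (radial_proj n)"
  have "emeasure ?D (space ?D) = emeasure (restrict_space ?L ?PB) (space (restrict_space ?L ?PB))"
    using measurable_space[OF radial_proj_measurable_sphere] by (simp add: emeasure_distr[OF radial_proj_measurable_sphere] Int_absorb1 subset_eq)
  also have "\<dots> = emeasure ?L ?PB"
    using punctured_ball_measurable sets.sets_into_space[OF punctured_ball_measurable]
    by (simp add: space_restrict_space emeasure_restrict_space Int_absorb2)
  also have "\<dots> \<le> emeasure ?L {x \<in> space ?L. L2_set x {1..n+1} < 1}"
    unfolding punctured_ball_eq by (rule emeasure_mono[OF _ ball_set]) auto
  also have "\<dots> < \<infinity>" by (rule ball_finite)
  finally have "emeasure ?D (space ?D) < \<infinity>" .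
  then show "emeasure (surface_measure n) (space (surface_measure n)) \<noteq> \<infinity>"
    by (simp add: surface_measure_def space_scale_measure ennreal_mult_eq_top_iff)
qed

lemma sphere_area_eq: "sphere_area n = measure (surface_measure n) (space (surface_measure n))"
  by (simp add: sphere_area_def space_surface_measure)

lemma prod_single_power:
  fixes x :: "nat \<Rightarrow> real"
  assumes "finite I" "i \<in> I" 
  shows "(\<Prod>j\<in>I. x j ^ (if j = i then k else 0)) = x i ^ k"
  using assms by (subst prod.remove[of I i]) auto

lemma prod_two_powers:
  fixes x :: "nat \<Rightarrow> real"
  assumes "finite I" "i \<in> I" "j \<in> I" "i \<noteq> j"
  shows "(\<Prod>p\<in>I. x p ^ (if p = i then k else if p = j then 1 else 0)) = x i ^ k * x j"
  using assms by (subst prod.remove[of I i], simp, simp, subst prod.remove[of "I - {i}" j]) auto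

lemma surface_moment:
  "half_moment (n + k) * (\<integral>x. x 1 ^ k \<partial>surface_measure n) =
     (if even k then 2 * half_moment k else 0) * (2 * half_moment 0) ^ n"
proof -
  let ?e = "\<lambda>j::nat. if j = 1 then k else 0"
  have 1: "(\<Sum>i\<in>{1..n+1}. ?e i) = k"
    by (subst sum.delta) auto
  have "(\<Prod>i\<in>{1..n+1}. if even (?e i) then 2 * half_moment (?e i) else 0) =
      (if even k then 2 * half_moment k else 0) * (\<Prod>i\<in>{1..n+1} - {1}. 2 * half_moment 0)"
    by (subst prod.remove[of _ 1]) (auto intro!: prod.cong)
  moreover have "(\<Prod>i\<in>{1..n+1} - {1::nat}. 2 * half_moment 0) = (2 * half_moment 0) ^ n"
    by (simp only: prod_constant) simp
  moreover have "(\<lambda>x::nat \<Rightarrow> real. \<Prod>i\<in>{1..n+1}. x i ^ ?e i) = (\<lambda>x. x 1 ^ k)"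
    by (intro ext prod_single_power) auto
  ultimately show ?thesis
    using monomial_moment[of n ?e] unfolding 1 by (simp only:)
qed

lemma surface_moment_odd_component:
  assumes "i \<in> {2..n+1}"
  shows "(\<integral>x. x 1 ^ k * x i \<partial>surface_measure n) = 0"
proof -
  let ?e = "\<lambda>j::nat. if j = 1 then k else if j = i then 1 else 0"
  have "(\<Prod>j\<in>{1..n+1}. if even (?e j) then 2 * half_moment (?e j) else 0) = 0"
    using assms by (intro prod_zero bexI[of _ i]) auto
  moreover have "(\<lambda>x::nat \<Rightarrow> real. \<Prod>p\<in>{1..n+1}. x p ^ ?e p) = (\<lambda>x. x 1 ^ k * x i)"
    using assms by (intro ext prod_two_powers) auto
  ultimately show ?thesis
    using monomial_moment[of n ?e] half_moment_pos[of "n + sum ?e {1..n+1}"]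
    by (simp only: mult_eq_0_iff) auto
qed

lemma component_abs_le_1: "x \<in> unit_sphere n \<Longrightarrow> i \<in> {1..n+1} \<Longrightarrow> \<bar>x i\<bar> \<le> 1"
  using component_le_L2_set[of i n x] by (auto simp: unit_sphere_def)

lemma surface_mass_pos: "measure (surface_measure n) (space (surface_measure n)) > 0"
proof -
  have "half_moment n * measure (surface_measure n) (space (surface_measure n)) = 2 * half_moment 0 * (2 * half_moment 0) ^ n"
    using surface_moment[of n 0] by simp
  moreover have "\<dots> > 0" using half_moment_pos[of 0] by simp
  ultimately show ?thesis using half_moment_pos[of n] by (metis zero_less_mult_pos)
qed

text \<open>The functional equation, applied in numerator and denominator of the Gaussian moment
  formula, gives consecutive even moments the quotient (k + 1) / (n + k + 1); this is the required
  recurrence with 2 a + 1 = n.\<close>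

lemma ultraspherical_surface:
  assumes "n \<ge> 2"
  shows "ultraspherical (surface_measure n) (\<lambda>x. x 1) ((real n - 1) / 2)"
proof -
  interpret finite_measure "surface_measure n" by (rule finite_measure_surface)
  show ?thesis
  proof
    show "(real n - 1) / 2 > 0" using assms by simp
    show "(\<lambda>x. x 1) \<in> borel_measurable (surface_measure n)"
      by (intro measurable_surface_measure component_measurable) simp
    show "\<bar>x 1\<bar> \<le> 1" if "x \<in> space (surface_measure n)" for x
      using that by (intro component_abs_le_1) (auto simp: space_surface_measure)
    show "(\<integral>x. x 1 \<partial>surface_measure n) = 0"
      using surface_moment[of n 1] half_moment_pos[of "n + 1"] by simp
    fix k
    define m where "m j = (\<integral>x. x 1 ^ j \<partial>surface_measure n)" for j
    have m: "half_moment (n + j) * m j = (if even j then 2 * half_moment j else 0) * (2 * half_moment 0) ^ n" for j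
      unfolding m_def by (rule surface_moment)
    have "half_moment (n + k) * ((real n + real k + 1) / 2 * m (k + 2)) = half_moment (n + (k + 2)) * m (k + 2)"
      using half_moment_add_2[of "n + k"] by (simp add: mult_ac add_ac)
    also have "\<dots> = (real k + 1) / 2 * (half_moment (n + k) * m k)"
      unfolding m half_moment_add_2 by simp
    finally have "half_moment (n + k) * ((real n + real k + 1) / 2 * m (k + 2)) = half_moment (n + k) * ((real k + 1) / 2 * m k)"
      by (simp add: mult_ac)
    then have "(real n + real k + 1) / 2 * m (k + 2) = (real k + 1) / 2 * m k"
      using half_moment_pos[of "n + k"] by (metis mult_left_cancel less_irrefl)
    then have "(real k + 2 * ((real n - 1) / 2) + 2) * m (k + 2) = (real k + 1) * m k"
      by (simp add: field_simps)
    then show "(real k + 2 * ((real n - 1) / 2) + 2) * (\<integral>x. x 1 ^ (k + 2) \<partial>surface_measure n) =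
        (real k + 1) * (\<integral>x. x 1 ^ k \<partial>surface_measure n)"
      by (simp only: m_def)
  qed
qed

lemma surface_hyperplane_null:
  assumes i: "i \<in> {1..n+1}"
  shows "AE x in surface_measure n. x i \<noteq> 0"
proof -
  interpret finite_measure "surface_measure n" by (rule finite_measure_surface)
  note component_measurable[OF i, measurable] radial_proj_measurable[of n, measurable] L2_set_measurable[of n, measurable]
  define f :: "(nat \<Rightarrow> real) \<Rightarrow> real" where "f = (\<lambda>x. if x i = 0 then 1 else 0)"
  have f [measurable]: "f \<in> borel_measurable (lebesgue_space n)" unfolding f_def by measurable
  have [measurable]: "(\<lambda>x. x i) \<in> borel_measurable (surface_measure n)"
    by (rule measurable_surface_measure) measurable
  let ?Z = "{x \<in> space (surface_measure n). x i = 0}"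
  have Z: "?Z \<in> sets (surface_measure n)" by measurable
  have "(\<integral>x. indicator {..<1} (L2_set x {1..n+1}) * f (radial_proj n x) \<partial>lebesgue_space n) = (\<integral>x. 0 \<partial>lebesgue_space n)"
  proof (rule integral_cong_AE)
    have "AE x in lebesgue_space n. x i \<noteq> 0" by (rule hyperplane_null[OF i])
    then show "AE x in lebesgue_space n. indicator {..<1} (L2_set x {1..n+1}) * f (radial_proj n x) = 0"
    proof eventually_elim
      case (elim x)
      then have "L2_set x {1..n+1} > 0" using component_le_L2_set[OF i, of x] by auto
      then have "radial_proj n x i \<noteq> 0" using i elim by (simp add: radial_proj_def)
      then show ?case by (simp add: f_def)
    qed
  qed measurable
  then have "(\<integral>x. f x \<partial>surface_measure n) = 0"
    using surface_integral[OF f] by simp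
  also have "(\<integral>x. f x \<partial>surface_measure n) = (\<integral>x. indicator ?Z x \<partial>surface_measure n)"
    by (rule Bochner_Integration.integral_cong) (auto simp: f_def indicator_def)
  also have "\<dots> = measure (surface_measure n) ?Z"
    using Z by (simp add: Int_absorb2 subset_eq)
  finally have "?Z \<in> null_sets (surface_measure n)"
    using Z by (intro null_setsI) (simp_all add: emeasure_eq_measure)
  then show ?thesis by (rule AE_I') auto
qed

text \<open>On the sphere |x_1| = 1 forces x_2 = 0, and the points with x_2 = 0 are a null
  set.\<close>

lemma AE_not_pole:
  assumes "n \<ge> 1"
  shows "AE x in surface_measure n. \<bar>x 1\<bar> < 1"
proof -
  have "AE x in surface_measure n. x 2 \<noteq> 0"
    using assms by (intro surface_hyperplane_null) auto
  then show ?thesis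
    using AE_space
  proof eventually_elim
    case (elim x)
    then have x: "x \<in> unit_sphere n" by (simp add: space_surface_measure)
    have "(\<Sum>i\<in>{1, 2}. (x i)\<^sup>2) \<le> (\<Sum>i\<in>{1..n+1}. (x i)\<^sup>2)"
      using assms by (intro sum_mono2) auto
    also have "\<dots> = 1"
      using x by (simp add: unit_sphere_def L2_set_def del: sum.cl_ivl_Suc)
    finally have "(x 1)\<^sup>2 + (x 2)\<^sup>2 \<le> 1" by simp
    moreover have "(x 2)\<^sup>2 > 0" using elim by simp
    ultimately have "(x 1)\<^sup>2 < 1" by linarith
    then show ?case by (simp only: abs_square_less_1)
  qed
qed

text \<open>The centre of mass lies on the axis, since x_1^k x_i has an odd exponent and integrates
  to zero. From polynomials one passes to the square of the series by expanding its two factors one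
  after the other.\<close>

lemma integral_component_zonal_square:
  assumes n: "n \<ge> 2" and i: "i \<in> {2..n+1}"
    and \<alpha>: "admissible ((real n - 1) / 2) \<alpha>"
  shows "(\<integral>x. x i * (zonal ((real n - 1) / 2) \<alpha> (x 1))\<^sup>2 \<partial>surface_measure n) = 0"
proof -
  interpret ultraspherical "surface_measure n" "\<lambda>x. x 1" "(real n - 1) / 2"
    by (rule ultraspherical_surface[OF n])
  let ?a = "(real n - 1) / 2"
  have [measurable]: "(\<lambda>x. x i) \<in> borel_measurable (surface_measure n)"
    using i by (intro measurable_surface_measure component_measurable) auto
  have le: "\<bar>x i\<bar> \<le> 1" if "x \<in> space (surface_measure n)" for x
    using that i by (intro component_abs_le_1) (auto simp: space_surface_measure)
  have int: "integrable (surface_measure n) (\<lambda>x. c * (x 1 ^ k * x i))" for c k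
  proof (intro integrable_mult_right integrable_bounded)
    show "(\<lambda>x. x 1 ^ k * x i) \<in> borel_measurable (surface_measure n)"
      by measurable
    show "\<bar>x 1 ^ k * x i\<bar> \<le> 1" if "x \<in> space (surface_measure n)" for x
      unfolding abs_mult power_abs using X_bounded[OF that] le[OF that]
      by (intro mult_le_one power_le_one) auto
  qed
  have poly0: "(\<integral>x. poly p (x 1) * x i \<partial>surface_measure n) = 0" for p
  proof -
    have "(\<integral>x. poly p (x 1) * x i \<partial>surface_measure n) = (\<integral>x. (\<Sum>k\<le>degree p. coeff p k * (x 1 ^ k * x i)) \<partial>surface_measure n)"
      by (simp add: poly_altdef sum_distrib_right mult.assoc)
    also have "\<dots> = (\<Sum>k\<le>degree p. (\<integral>x. coeff p k * (x 1 ^ k * x i) \<partial>surface_measure n))"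
      by (rule Bochner_Integration.integral_sum) (rule int)
    also have "\<dots> = 0"
      using surface_moment_odd_component[OF i] by simp
    finally show ?thesis .
  qed
  have "(\<integral>x. zonal ?a \<alpha> (x 1) * (poly p (x 1) * x i) \<partial>surface_measure n) = 0" for p
  proof -
    have "(\<lambda>l. \<alpha> l * (\<integral>x. geg ?a l (x 1) * (poly p (x 1) * x i) \<partial>surface_measure n))
        sums (\<integral>x. zonal ?a \<alpha> (x 1) * (poly p (x 1) * x i) \<partial>surface_measure n)"
      by (rule zonal_integral_sums[OF \<alpha>, where B = "(\<Sum>i\<le>degree p. \<bar>coeff p i\<bar>) * 1"])
         (measurable, unfold abs_mult, intro mult_mono le poly_bound, auto simp: sum_nonneg)
    moreover have "(\<integral>x. geg ?a l (x 1) * (poly p (x 1) * x i) \<partial>surface_measure n) = 0" for l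
      using poly0[of "gegenbauer ?a l * p"] by (simp add: mult.assoc)
    ultimately show ?thesis
      using sums_unique2[OF _ sums_zero] by simp
  qed
  note zero = this
  have "(\<lambda>l. \<alpha> l * (\<integral>x. geg ?a l (x 1) * (zonal ?a \<alpha> (x 1) * x i) \<partial>surface_measure n))
      sums (\<integral>x. zonal ?a \<alpha> (x 1) * (zonal ?a \<alpha> (x 1) * x i) \<partial>surface_measure n)"
  proof (rule zonal_integral_sums[OF \<alpha>])
    show "\<bar>zonal ?a \<alpha> (x 1) * x i\<bar> \<le> (\<Sum>l. \<bar>\<alpha> l\<bar> * geg ?a l 1) * 1" if "x \<in> space (surface_measure n)" for x
      unfolding abs_mult using that zonal_abs_le[OF \<alpha> X_bounded[OF that]]
      by (intro mult_mono le) (auto intro: order.trans[OF abs_ge_zero])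
  qed measurable
  moreover have "(\<integral>x. geg ?a l (x 1) * (zonal ?a \<alpha> (x 1) * x i) \<partial>surface_measure n) = 0" for l
    using zero[of "gegenbauer ?a l"] by (simp add: mult_ac)
  ultimately have "(\<integral>x. zonal ?a \<alpha> (x 1) * (zonal ?a \<alpha> (x 1) * x i) \<partial>surface_measure n) = 0"
    using sums_unique2[OF _ sums_zero] by simp
  then show ?thesis by (simp add: power2_eq_square mult_ac)
qed

section \<open>Poisson kernels and wavelets\<close>

lemma sums_shift_zero:
  fixes f :: "nat \<Rightarrow> real"
  assumes "f 0 = 0" "(\<lambda>l. f (Suc l)) sums s"
  shows "f sums s"
  using assms sums_Suc_iff[of f s] by simp

text \<open>By \<open>gegenbauer_at_1\<close> this is Newton's binomial series. It majorises the
  series in r below and, when 2 a is a natural number, supplies closed forms of power sums.\<close>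

lemma gegenbauer_1_sums:
  assumes "\<bar>x\<bar> < 1"
  shows "(\<lambda>l. geg a l 1 * x ^ l) sums (1 - x) powr (- 2 * a)"
proof -
  have "(\<lambda>l. ((- 2 * a) gchoose l) * (- x) ^ l) sums (1 + - x) powr (- 2 * a)"
    using assms by (intro gen_binomial_real) simp
  moreover have "((- 2 * a) gchoose l) * (- x) ^ l = geg a l 1 * x ^ l" for l
  proof -
    have eq: "((- 2 * a) gchoose l) = (- 1) ^ l * (pochhammer (2 * a) l / fact l)"
      by (simp add: gbinomial_pochhammer)
    have "(- 1) ^ l * ((- 1) ^ l :: real) = 1"
      by (simp add: power_mult_distrib[symmetric])
    then have "(- 1) ^ l * c * (- x) ^ l = c * x ^ l" for c
      using arg_cong[of "(- 1) ^ l * ((- 1) ^ l)" 1 "\<lambda>u. u * (c * x ^ l)"]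
      unfolding power_minus[of x] by (simp only: mult_ac mult_1_left mult_1_right)
    then show ?thesis
      unfolding eq gegenbauer_at_1 .
  qed
  ultimately show ?thesis by simp
qed

lemma gegenbauer_summable:
  assumes a: "a > 0" and t: "\<bar>t\<bar> \<le> 1" and r: "norm r < 1"
  shows "summable (\<lambda>l. geg a l t * r ^ l)"
proof (rule summable_comparison_test'[of _ 0])
  show "summable (\<lambda>l. geg a l 1 * \<bar>r\<bar> ^ l)"
    using gegenbauer_1_sums[of "\<bar>r\<bar>" a] r by (auto simp: sums_iff)
  show "norm (geg a l t * r ^ l) \<le> geg a l 1 * \<bar>r\<bar> ^ l" for l
    using gegenbauer_abs_le[OF a t] by (auto simp: abs_mult power_abs intro!: mult_right_mono)
qed

lemma generating_denominator_pos:
  fixes r t :: real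
  assumes "\<bar>t\<bar> \<le> 1" "\<bar>r\<bar> < 1"
  shows "1 - 2 * r * t + r\<^sup>2 > 0"
proof -
  have "\<bar>r * t\<bar> \<le> \<bar>r\<bar>"
    using assms by (simp add: abs_mult mult_left_le)
  then have "r * t \<le> \<bar>r\<bar>" by linarith
  moreover have "(1 - \<bar>r\<bar>)\<^sup>2 > 0" using assms by simp
  then have "1 - 2 * \<bar>r\<bar> + r\<^sup>2 > 0" by (simp add: power2_eq_square algebra_simps)
  ultimately show ?thesis by (simp add: mult.assoc)
qed

section \<open>Generating function and expansion of the Poisson kernel\<close>

context
  fixes a t :: real
  assumes a: "a > 0" and t: "\<bar>t\<bar> \<le> 1"
begin

definition "gen r = (\<Sum>l. geg a l t * r ^ l)"
definition "gen' r = (\<Sum>l. diffs (\<lambda>l. geg a l t) l * r ^ l)"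

lemma gen_sums: "\<bar>r\<bar> < 1 \<Longrightarrow> (\<lambda>l. geg a l t * r ^ l) sums gen r"
  unfolding gen_def using gegenbauer_summable[OF a t, of r] by (intro summable_sums) simp

lemma gen'_sums: "\<bar>r\<bar> < 1 \<Longrightarrow> (\<lambda>l. diffs (\<lambda>l. geg a l t) l * r ^ l) sums gen' r"
  unfolding gen'_def using gegenbauer_summable[OF a t]
  by (intro summable_sums termdiff_converges[where K = 1]) auto

lemma gen_deriv: "\<bar>r\<bar> < 1 \<Longrightarrow> (gen has_field_derivative gen' r) (at r)"
  unfolding gen_def[abs_def] gen'_def using gegenbauer_summable[OF a t]
  by (intro termdiffs_strong'[where K = 1]) auto

lemma gen_euler_sums:
  assumes "\<bar>r\<bar> < 1"
  shows "(\<lambda>l. real l * geg a l t * r ^ l) sums (r * gen' r)"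
proof -
  have "(\<lambda>l. r * (diffs (\<lambda>l. geg a l t) l * r ^ l)) sums (r * gen' r)"
    by (intro sums_mult gen'_sums assms)
  then have "(\<lambda>l. real (Suc l) * geg a (Suc l) t * r ^ Suc l) sums (r * gen' r)"
    by (simp add: diffs_def mult_ac)
  then show ?thesis
    by (rule sums_shift_zero[of "\<lambda>l. real l * geg a l t * r ^ l", rotated]) simp
qed

text \<open>Coefficientwise this is the three-term recurrence. As that begins with index 2, the
  series for \<open>gen'\<close> and \<open>gen\<close> enter shifted by one place, which costs them
  the terms \<open>2 * a * t\<close> and \<open>1\<close>.\<close>

lemma gen_ode:
  assumes r: "\<bar>r\<bar> < 1"
  shows "(1 - 2 * r * t + r\<^sup>2) * gen' r = 2 * a * (t - r) * gen r"
proof -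
  let ?C = "\<lambda>l. geg a l t"
  have s1: "(\<lambda>l. diffs ?C (Suc l) * r ^ Suc l) sums (gen' r - 2 * a * t)"
    using gen'_sums[OF r] by (subst sums_Suc_iff) (simp add: diffs_def mult.commute)
  have s2: "(\<lambda>l. 2 * t * r * (diffs ?C l * r ^ l)) sums (2 * t * r * gen' r)"
    by (intro sums_mult gen'_sums r)
  have s3: "(\<lambda>l. r * (real l * ?C l * r ^ l)) sums (r * (r * gen' r))"
    by (intro sums_mult gen_euler_sums r)
  have s4: "(\<lambda>l. 2 * a * t * (?C (Suc l) * r ^ Suc l)) sums (2 * a * t * (gen r - 1))"
    using gen_sums[OF r] by (intro sums_mult, subst sums_Suc_iff) simp
  have s5: "(\<lambda>l. 2 * a * r * (?C l * r ^ l)) sums (2 * a * r * gen r)"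
    by (intro sums_mult gen_sums r)
  have "(\<lambda>l. diffs ?C (Suc l) * r ^ Suc l - 2 * t * r * (diffs ?C l * r ^ l) + r * (real l * ?C l * r ^ l))
      = (\<lambda>l. 2 * a * t * (?C (Suc l) * r ^ Suc l) - 2 * a * r * (?C l * r ^ l))"
  proof
    fix l
    have "diffs ?C (Suc l) * r ^ Suc l - 2 * t * r * (diffs ?C l * r ^ l) + r * (real l * ?C l * r ^ l)
       = r ^ Suc l * ((real l + 2) * ?C (Suc (Suc l)) - 2 * t * (real l + 1) * ?C (Suc l) + real l * ?C l)"
      by (simp add: diffs_def algebra_simps)
    also have "\<dots> = 2 * a * t * (?C (Suc l) * r ^ Suc l) - 2 * a * r * (?C l * r ^ l)"
      unfolding gegenbauer_recurrence by (simp add: algebra_simps)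
    finally show "diffs ?C (Suc l) * r ^ Suc l - 2 * t * r * (diffs ?C l * r ^ l) + r * (real l * ?C l * r ^ l)
       = 2 * a * t * (?C (Suc l) * r ^ Suc l) - 2 * a * r * (?C l * r ^ l)" .
  qed
  then have "gen' r - 2 * a * t - 2 * t * r * gen' r + r * (r * gen' r) = 2 * a * t * (gen r - 1) - 2 * a * r * gen r"
    using sums_unique2[OF sums_add[OF sums_diff[OF s1 s2] s3]] sums_diff[OF s4 s5] by simp
  then show ?thesis by (simp add: power2_eq_square algebra_simps)
qed

text \<open>By the differential equation, \<open>gen\<close> times the a-th power of the quadratic
  has derivative zero on (-1, 1), and its value at 0 is 1.\<close>

lemma gen_eq:
  assumes r: "\<bar>r\<bar> < 1"
  shows "gen r = (1 - 2 * r * t + r\<^sup>2) powr (- a)"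
proof -
  let ?q = "\<lambda>r::real. 1 - 2 * r * t + r\<^sup>2"
  have "\<exists>c. \<forall>r\<in>{-1<..<1}. gen r * ?q r powr a = c"
  proof (rule has_field_derivative_zero_constant)
    fix r :: real assume "r \<in> {-1<..<1}"
    then have r: "\<bar>r\<bar> < 1" by auto
    note q = generating_denominator_pos[OF t r]
    have "((\<lambda>r. gen r * ?q r powr a) has_field_derivative
        gen' r * ?q r powr a + gen r * (a * ?q r powr (a - 1) * (2 * r - 2 * t))) (at r)"
      using q by (auto intro!: derivative_eq_intros gen_deriv r simp: powr_diff)
    moreover have "gen' r * ?q r powr a = (?q r * gen' r) * ?q r powr (a - 1)"
      using q by (simp add: powr_diff)
    then have "gen' r * ?q r powr a + gen r * (a * ?q r powr (a - 1) * (2 * r - 2 * t)) = 0"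
      unfolding gen_ode[OF r] by (simp add: algebra_simps)
    ultimately show "((\<lambda>r. gen r * ?q r powr a) has_field_derivative 0) (at r within {-1<..<1})"
      by (simp add: has_field_derivative_at_within)
  qed simp
  then obtain c where c: "\<And>r. \<bar>r\<bar> < 1 \<Longrightarrow> gen r * ?q r powr a = c" by (auto simp: abs_less_iff)
  have "gen 0 = 1" unfolding gen_def by simp
  then have "c = 1" using c[of 0] by simp
  then have "gen r * ?q r powr a = 1" using c[OF r] by simp
  moreover have "?q r powr a * ?q r powr (- a) = 1"
    using generating_denominator_pos[OF t r] by (simp add: powr_add[symmetric])
  ultimately show ?thesis
    by (metis mult.assoc mult.right_neutral mult_1)
qed

text \<open>The series is \<open>gen r + r * gen' r / a\<close>. Multiplied by the quadratic it
  collapses to \<open>(1 - r^2) * gen r\<close> by the differential equation.\<close>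

lemma poisson_kernel_sums:
  assumes r: "\<bar>r\<bar> < 1"
  shows "(\<lambda>l. (real l + a) / a * geg a l t * r ^ l) sums
     ((1 - r\<^sup>2) * (1 - 2 * r * t + r\<^sup>2) powr (- a - 1))"
proof -
  let ?q = "1 - 2 * r * t + r\<^sup>2"
  have q: "?q > 0" by (rule generating_denominator_pos[OF t r])
  have "(\<lambda>l. 1 / a * (real l * geg a l t * r ^ l) + geg a l t * r ^ l) sums (1 / a * (r * gen' r) + gen r)"
    by (intro sums_add sums_mult gen_euler_sums gen_sums r)
  moreover have "1 / a * (real l * geg a l t * r ^ l) + geg a l t * r ^ l = (real l + a) / a * geg a l t * r ^ l" for l
    using a by (simp add: field_simps)
  moreover have "1 / a * (r * gen' r) + gen r = (1 - r\<^sup>2) * ?q powr (- a - 1)"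
  proof -
    have "?q * (1 / a * (r * gen' r) + gen r) = 1 / a * r * (?q * gen' r) + ?q * gen r"
      by (simp only: distrib_left mult_ac)
    also have "\<dots> = (1 - r\<^sup>2) * gen r"
      unfolding gen_ode[OF r] using a by (simp add: power2_eq_square algebra_simps)
    also have "\<dots> = ?q * ((1 - r\<^sup>2) * ?q powr (- a - 1))"
      unfolding gen_eq[OF r] using q by (simp add: powr_diff)
    finally show ?thesis using q by (subst (asm) mult_left_cancel) auto
  qed
  ultimately show ?thesis by simp
qed

end

lemma euler_power_series_summable:
  fixes c :: "nat \<Rightarrow> real"
  assumes "\<And>x. norm x < 1 \<Longrightarrow> summable (\<lambda>l. c l * x ^ l)" "norm x < 1"
  shows "summable (\<lambda>l. real l ^ m * c l * x ^ l)"
  using assms(2)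
proof (induction m arbitrary: x)
  case 0
  then show ?case using assms(1) by simp
next
  case (Suc m)
  have "summable (\<lambda>l. diffs (\<lambda>l. real l ^ m * c l) l * x ^ l)"
    by (rule termdiff_converges[where K = 1]) (use Suc in auto)
  then have "summable (\<lambda>l. x * (diffs (\<lambda>l. real l ^ m * c l) l * x ^ l))"
    by (rule summable_mult)
  then show ?case
    by (subst summable_Suc_iff[symmetric]) (simp add: diffs_def mult_ac)
qed

text \<open>The operator r d/dr multiplies the l-th coefficient by l. As \<open>deriv\<close>
  depends on the values near the point only, the induction works with equality on the open interval
  (0, 1).\<close>

lemma radial_deriv_power_series:
  fixes c :: "nat \<Rightarrow> real"
  assumes c: "\<And>x. norm x < 1 \<Longrightarrow> summable (\<lambda>l. c l * x ^ l)"
    and h: "\<And>r. 0 < r \<Longrightarrow> r < 1 \<Longrightarrow> h r = (\<Sum>l. c l * r ^ l)"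
    and r: "0 < r" "r < 1"
  shows "(radial_deriv ^^ m) h r = (\<Sum>l. real l ^ m * c l * r ^ l)"
  using r
proof (induction m arbitrary: r)
  case 0
  then show ?case using h by simp
next
  case (Suc m)
  have sm: "summable (\<lambda>l. real l ^ m * c l * x ^ l)" if "norm x < 1" for x :: real
    by (rule euler_power_series_summable[OF c that])
  have ev: "eventually (\<lambda>s. (radial_deriv ^^ m) h s = (\<Sum>l. real l ^ m * c l * s ^ l)) (nhds r)"
    using Suc.IH Suc.prems by (intro eventually_nhds_in_open[of "{0<..<1}", THEN eventually_mono]) auto
  have "((\<lambda>s. \<Sum>l. real l ^ m * c l * s ^ l) has_field_derivative
      (\<Sum>l. diffs (\<lambda>l. real l ^ m * c l) l * r ^ l)) (at r)"
    by (rule termdiffs_strong'[where K = 1]) (use sm Suc.prems in auto)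
  then have "deriv ((radial_deriv ^^ m) h) r = (\<Sum>l. diffs (\<lambda>l. real l ^ m * c l) l * r ^ l)"
    using deriv_cong_ev[OF ev refl] by (simp add: DERIV_imp_deriv)
  moreover have "(\<lambda>l. diffs (\<lambda>l. real l ^ m * c l) l * r ^ l) sums (\<Sum>l. diffs (\<lambda>l. real l ^ m * c l) l * r ^ l)"
    by (rule summable_sums, rule termdiff_converges[where K = 1]) (use sm Suc.prems in auto)
  then have "(\<lambda>l. r * (diffs (\<lambda>l. real l ^ m * c l) l * r ^ l)) sums (r * (\<Sum>l. diffs (\<lambda>l. real l ^ m * c l) l * r ^ l))"
    by (rule sums_mult)
  then have "(\<lambda>l. real l ^ Suc m * c l * r ^ l) sums (r * (\<Sum>l. diffs (\<lambda>l. real l ^ m * c l) l * r ^ l))"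
    by (intro sums_shift_zero[of "\<lambda>l. real l ^ Suc m * c l * r ^ l"]) (simp_all add: diffs_def mult_ac)
  then have "(\<Sum>l. real l ^ Suc m * c l * r ^ l) = r * (\<Sum>l. diffs (\<lambda>l. real l ^ m * c l) l * r ^ l)"
    by (rule sums_unique[symmetric])
  moreover have "(radial_deriv ^^ Suc m) h r = r * deriv ((radial_deriv ^^ m) h) r"
    by (simp only: funpow.simps o_apply radial_deriv_def[of _ r])
  ultimately show ?case by (simp only:)
qed

lemma sum_split_first:
  fixes f :: "nat \<Rightarrow> real"
  shows "(\<Sum>i\<in>{1..n+1}. f i) = f 1 + (\<Sum>i\<in>{2..n+1}. f i)"
  by (subst sum.atLeast_Suc_atMost) (auto simp: numeral_2_eq_2)

text \<open>For a = (n - 1) / 2 the exponent -a - 1 is -(n + 1) / 2: the (n + 1)-st power of the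
  distance becomes a real power of its square, the form in which the generating function delivers
  it.\<close>

lemma poisson_kernel_on_sphere:
  assumes x: "x \<in> unit_sphere n" and r: "\<bar>r\<bar> < 1"
  shows "poisson_kernel n r x = 1 / sphere_area n *
     ((1 - r\<^sup>2) * (1 - 2 * r * x 1 + r\<^sup>2) powr (- ((real n - 1) / 2) - 1))"
proof -
  have axis: "(L2_set (axis_point n r) {1..n+1})\<^sup>2 = r\<^sup>2"
    unfolding L2_set_def by (subst real_sqrt_pow2[OF sum_nonneg], simp, subst sum_split_first) (auto simp: axis_point_def)
  have x1: "(\<Sum>i\<in>{1..n+1}. (x i)\<^sup>2) = 1"
    using x by (simp add: unit_sphere_def L2_set_def del: sum.cl_ivl_Suc)
  have "(\<Sum>i\<in>{1..n+1}. (axis_point n r i - x i)\<^sup>2) = (r - x 1)\<^sup>2 + (\<Sum>i\<in>{2..n+1}. (x i)\<^sup>2)"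
    by (subst sum_split_first) (auto simp: axis_point_def intro!: sum.cong)
  also have "\<dots> = 1 - 2 * r * x 1 + r\<^sup>2"
    using x1 unfolding sum_split_first by (simp add: power2_eq_square algebra_simps)
  finally have dist: "L2_set (\<lambda>i. axis_point n r i - x i) {1..n+1} = sqrt (1 - 2 * r * x 1 + r\<^sup>2)"
    by (simp add: L2_set_def)
  have q: "1 - 2 * r * x 1 + r\<^sup>2 > 0"
    using x r by (intro generating_denominator_pos component_abs_le_1) auto
  have pow: "sqrt (1 - 2 * r * x 1 + r\<^sup>2) ^ (n + 1) = (1 - 2 * r * x 1 + r\<^sup>2) powr ((real n + 1) / 2)"
  proof -
    have "sqrt (1 - 2 * r * x 1 + r\<^sup>2) ^ (n + 1) = ((1 - 2 * r * x 1 + r\<^sup>2) powr (1 / 2)) powr real (n + 1)"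
    proof -
      have eq: "(1 - 2 * r * x 1 + r\<^sup>2) powr (1 / 2) = sqrt (1 - 2 * r * x 1 + r\<^sup>2)"
        using q by (intro powr_half_sqrt) simp
      have "sqrt (1 - 2 * r * x 1 + r\<^sup>2) > 0" using q by (rule real_sqrt_gt_zero)
      then show ?thesis unfolding eq by (rule powr_realpow[symmetric])
    qed
    also have "\<dots> = (1 - 2 * r * x 1 + r\<^sup>2) powr (1 / 2 * real (n + 1))"
      by (rule powr_powr)
    also have "1 / 2 * real (n + 1) = (real n + 1) / 2"
      by simp
    finally show ?thesis .
  qed
  have e: "- ((real n - 1) / 2) - 1 = - ((real n + 1) / 2)" by (simp add: field_simps)
  show ?thesis
    unfolding e unfolding poisson_kernel_def axis dist pow powr_minus
    by (simp only: divide_inverse[of "1 - r\<^sup>2"])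
qed

text \<open>The factor \<open>1 / sphere_area n\<close> is kept outside, because both variances are
  invariant under scaling of the function.\<close>

definition wavelet_coeff :: "nat \<Rightarrow> nat \<Rightarrow> real \<Rightarrow> nat \<Rightarrow> real" where
  "wavelet_coeff n m \<rho> l = (real l + (real n - 1) / 2) / ((real n - 1) / 2) * ((\<rho> * real l) ^ m * exp (- \<rho> * real l))"

lemma kernel_coeff_summable:
  assumes "a > 0" "\<bar>t\<bar> \<le> 1" "norm x < (1::real)"
  shows "summable (\<lambda>l. real l ^ m * ((real l + a) / a * geg a l t) * x ^ l)"
  using poisson_kernel_sums[OF assms(1,2)] assms(3)
  by (intro euler_power_series_summable) (auto simp: sums_iff)

lemma wavelet_admissible:
  assumes n: "n \<ge> 2" and \<rho>: "\<rho> > 0"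
  shows "admissible ((real n - 1) / 2) (wavelet_coeff n m \<rho>)"
proof -
  let ?a = "(real n - 1) / 2"
  have "summable (\<lambda>l. \<rho> ^ m * (real l ^ m * ((real l + ?a) / ?a * geg ?a l 1) * exp (- \<rho>) ^ l))"
    by (intro summable_mult kernel_coeff_summable) (use n \<rho> in auto)
  moreover have "(\<lambda>l. \<bar>wavelet_coeff n m \<rho> l\<bar> * geg ?a l 1) =
      (\<lambda>l. \<rho> ^ m * (real l ^ m * ((real l + ?a) / ?a * geg ?a l 1) * exp (- \<rho>) ^ l))"
    using n \<rho> by (auto simp: wavelet_coeff_def fun_eq_iff abs_mult power_mult_distrib exp_of_nat_mult[symmetric] mult_ac)
  ultimately show ?thesis unfolding admissible_def by simp
qed

lemma poisson_wavelet_eq_zonal: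
  assumes n: "n \<ge> 2" and \<rho>: "\<rho> > 0" and x: "x \<in> unit_sphere n"
  shows "poisson_wavelet n m \<rho> x = 1 / sphere_area n * zonal ((real n - 1) / 2) (wavelet_coeff n m \<rho>) (x 1)"
proof -
  let ?a = "(real n - 1) / 2" and ?S = "sphere_area n"
  let ?c = "\<lambda>l. 1 / ?S * ((real l + ?a) / ?a * geg ?a l (x 1))"
  have a: "?a > 0" using n by simp
  have t: "\<bar>x 1\<bar> \<le> 1" using x by (intro component_abs_le_1) auto
  have sums: "(\<lambda>l. ?c l * r ^ l) sums poisson_kernel n r x" if "norm r < 1" for r
    using sums_mult[OF poisson_kernel_sums[OF a t, of r], of "1 / ?S"] poisson_kernel_on_sphere[OF x, of r] that
    by (simp add: mult.assoc)
  have "(radial_deriv ^^ m) (\<lambda>r. poisson_kernel n r x) (exp (- \<rho>)) = (\<Sum>l. real l ^ m * ?c l * exp (- \<rho>) ^ l)"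
  proof (rule radial_deriv_power_series)
    show "summable (\<lambda>l. ?c l * r ^ l)" if "norm r < 1" for r
      by (rule sums_summable[OF sums[OF that]])
    show "poisson_kernel n r x = (\<Sum>l. ?c l * r ^ l)" if "0 < r" "r < 1" for r
      by (rule sums_unique[OF sums]) (use that in auto)
  qed (use \<rho> in auto)
  then have "poisson_wavelet n m \<rho> x = \<rho> ^ m * (\<Sum>l. 1 / ?S * (real l ^ m * ((real l + ?a) / ?a * geg ?a l (x 1)) * exp (- \<rho>) ^ l))"
    by (simp add: poisson_wavelet_def mult_ac)
  also have "\<dots> = 1 / ?S * (\<Sum>l. \<rho> ^ m * (real l ^ m * ((real l + ?a) / ?a * geg ?a l (x 1)) * exp (- \<rho>) ^ l))"
    using kernel_coeff_summable[OF a t, of "exp (- \<rho>)" m] \<rho>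
    by (subst suminf_mult, simp, subst suminf_mult, simp) simp
  also have "(\<lambda>l. \<rho> ^ m * (real l ^ m * ((real l + ?a) / ?a * geg ?a l (x 1)) * exp (- \<rho>) ^ l)) =
      (\<lambda>l. wavelet_coeff n m \<rho> l * geg ?a l (x 1))"
    by (auto simp: wavelet_coeff_def fun_eq_iff power_mult_distrib exp_of_nat_mult[symmetric] mult_ac)
  finally show ?thesis by (simp add: zonal_def)
qed

section \<open>Asymptotics of power sums\<close>

text \<open>The product (X + 1) ... (X + d), at natural numbers d! times a binomial coefficient:
  monic polynomials whose power sums are exactly d! / (1 - x)^(d + 1).\<close>

definition rising :: "nat \<Rightarrow> real poly" where
  "rising d = (\<Prod>i<d. [:real i + 1, 1:])"

lemma rising_Suc: "rising (Suc d) = [:real d + 1, 1:] * rising d"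
  by (simp add: rising_def mult.commute)

lemma rising_degree: "degree (rising d) = d \<and> coeff (rising d) d = 1"
proof (induction d)
  case (Suc d)
  have "rising d \<noteq> 0" using Suc by auto
  then have deg: "degree (rising (Suc d)) = Suc d"
    unfolding rising_Suc using Suc by (subst degree_mult_eq) auto
  have "lead_coeff (rising (Suc d)) = 1"
    unfolding rising_Suc lead_coeff_mult using Suc by simp
  then show ?case using deg by simp
qed (simp add: rising_def)

lemma poly_rising: "poly (rising d) (real l) = fact (l + d) / fact l"
proof (induction d)
  case (Suc d)
  show ?case
    unfolding rising_Suc by (simp add: Suc field_simps)
qed (simp add: rising_def)

lemma pochhammer_eq_fact: "pochhammer (real d + 1) l = fact (l + d) / fact d"
proof (induction l)
  case (Suc l)
  show ?case
    unfolding pochhammer_Suc Suc.IH by (simp add: algebra_simps)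
qed simp

lemma gegenbauer_1_eq_rising: "fact d * geg ((real d + 1) / 2) l 1 = poly (rising d) (real l)"
proof -
  have "2 * ((real d + 1) / 2) = real d + 1" by simp
  then show ?thesis
    unfolding gegenbauer_at_1 by (simp only: pochhammer_eq_fact poly_rising) simp
qed

lemma rising_sums:
  assumes "\<bar>x\<bar> < 1"
  shows "(\<lambda>l. poly (rising d) (real l) * x ^ l) sums (fact d / (1 - x) ^ (d + 1))"
proof -
  let ?a = "(real d + 1) / 2"
  have "(\<lambda>l. fact d * (geg ?a l 1 * x ^ l)) sums (fact d * (1 - x) powr (- 2 * ?a))"
    by (intro sums_mult gegenbauer_1_sums assms)
  moreover have "fact d * (geg ?a l 1 * x ^ l) = poly (rising d) (real l) * x ^ l" for l
    unfolding gegenbauer_1_eq_rising[symmetric] by (rule mult.assoc[symmetric])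
  moreover have "(1 - x) powr (- 2 * ?a) = 1 / (1 - x) ^ (d + 1)"
  proof -
    have e: "- 2 * ?a = - real (d + 1)" by simp
    have "(1 - x) powr real (d + 1) = (1 - x) ^ (d + 1)"
      using assms by (intro powr_realpow) auto
    then show ?thesis
      unfolding e powr_minus_divide by (rule arg_cong)
  qed
  ultimately show ?thesis by simp
qed

text \<open>Subtracting the right multiple of \<open>rising d\<close> lowers the degree. The case
  \<open>d = 0\<close> is stated separately, since there \<open>d - 1\<close> is again 0 while the
  remainder must vanish.\<close>

lemma poly_split_rising:
  assumes "degree p \<le> d"
  obtains q where "p = smult (coeff p d) (rising d) + q" "d = 0 \<Longrightarrow> q = 0" "d > 0 \<Longrightarrow> degree q \<le> d - 1"
proof
  define q where "q = p - smult (coeff p d) (rising d)"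
  show "p = smult (coeff p d) (rising d) + q" by (simp add: q_def)
  have c: "coeff q i = 0" if "i \<ge> d" for i
    using that assms rising_degree[of d]
    by (cases "i = d") (auto simp: q_def coeff_eq_0)
  then show "degree q \<le> d - 1" if "d > 0"
    using that by (intro degree_le) auto
  show "q = 0" if "d = 0"
    using that c by (intro poly_eqI) auto
qed

definition power_sum :: "real poly \<Rightarrow> real \<Rightarrow> real" where
  "power_sum p x = (\<Sum>l. poly p (real l) * x ^ l)"

lemma power_sum_summable:
  assumes x: "\<bar>x\<bar> < 1"
  shows "summable (\<lambda>l. poly p (real l) * x ^ l)"
proof -
  have "summable (\<lambda>l. poly p (real l) * x ^ l)" if "degree p \<le> d" for d p
    using that
  proof (induction d arbitrary: p rule: less_induct)
    case (less d)
    obtain q where q: "p = smult (coeff p d) (rising d) + q" "d = 0 \<Longrightarrow> q = 0" "d > 0 \<Longrightarrow> degree q \<le> d - 1"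
      using poly_split_rising[OF less.prems] by blast
    have "summable (\<lambda>l. poly q (real l) * x ^ l)"
      using q less.IH[of "d - 1" q] by (cases "d = 0") auto
    then have "summable (\<lambda>l. coeff p d * (poly (rising d) (real l) * x ^ l) + poly q (real l) * x ^ l)"
      by (intro summable_add summable_mult sums_summable[OF rising_sums[OF x]])
    then show ?case by (subst q(1)) (simp add: algebra_simps)
  qed
  then show ?thesis by blast
qed

lemma power_sum_sums: "\<bar>x\<bar> < 1 \<Longrightarrow> (\<lambda>l. poly p (real l) * x ^ l) sums power_sum p x"
  unfolding power_sum_def by (intro summable_sums power_sum_summable)

lemma power_sum_add: "\<bar>x\<bar> < 1 \<Longrightarrow> power_sum (p + q) x = power_sum p x + power_sum q x"
  unfolding power_sum_def by (subst suminf_add) (auto intro!: power_sum_summable simp: distrib_right)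

lemma power_sum_smult: "\<bar>x\<bar> < 1 \<Longrightarrow> power_sum (smult c p) x = c * power_sum p x"
  unfolding power_sum_def by (subst suminf_mult[symmetric]) (auto intro!: power_sum_summable simp: mult.assoc)

lemma power_sum_rising: "\<bar>x\<bar> < 1 \<Longrightarrow> power_sum (rising d) x = fact d / (1 - x) ^ (d + 1)"
  unfolding power_sum_def using rising_sums by (simp add: sums_iff)

text \<open>The rising part is known exactly and \<rho> / (1 - exp (-2 \<rho>)) tends to 1/2; the
  remainder has smaller degree and by induction gains a factor \<rho>. Only a bound on the degree is
  assumed, so the coefficient may be zero.\<close>

lemma power_sum_asymptotics:
  assumes "degree p \<le> d"
  shows "((\<lambda>\<rho>. \<rho> ^ (d + 1) * power_sum p (exp (- 2 * \<rho>))) \<longlongrightarrow> coeff p d * fact d / 2 ^ (d + 1)) (at_right 0)"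
  using assms
proof (induction d arbitrary: p rule: less_induct)
  case (less d)
  obtain q where q: "p = smult (coeff p d) (rising d) + q" "d = 0 \<Longrightarrow> q = 0" "d > 0 \<Longrightarrow> degree q \<le> d - 1"
    using poly_split_rising[OF less.prems] by blast
  have "((\<lambda>\<rho>::real. \<rho> / (1 - exp (- 2 * \<rho>))) \<longlongrightarrow> 1 / 2) (at_right 0)"
    by real_asymp
  then have lim1: "((\<lambda>\<rho>::real. coeff p d * fact d * (\<rho> / (1 - exp (- 2 * \<rho>))) ^ (d + 1)) \<longlongrightarrow> coeff p d * fact d * (1 / 2) ^ (d + 1)) (at_right 0)"
    by (intro tendsto_mult tendsto_power tendsto_const)
  have lim2: "((\<lambda>\<rho>. \<rho> ^ (d + 1) * power_sum q (exp (- 2 * \<rho>))) \<longlongrightarrow> 0) (at_right 0)"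
  proof (cases "d = 0")
    case True
    then show ?thesis using q(2) by (simp add: power_sum_def)
  next
    case False
    then have "((\<lambda>\<rho>. \<rho> ^ (d - 1 + 1) * power_sum q (exp (- 2 * \<rho>))) \<longlongrightarrow> coeff q (d - 1) * fact (d - 1) / 2 ^ (d - 1 + 1)) (at_right 0)"
      using less.IH[of "d - 1" q] q(3) by auto
    then have "((\<lambda>\<rho>. \<rho> * (\<rho> ^ (d - 1 + 1) * power_sum q (exp (- 2 * \<rho>)))) \<longlongrightarrow> 0 * (coeff q (d - 1) * fact (d - 1) / 2 ^ (d - 1 + 1))) (at_right 0)"
      by (intro tendsto_mult tendsto_ident_at)
    then show ?thesis using False by (simp add: mult.assoc)
  qed
  have "((\<lambda>\<rho>. coeff p d * fact d * (\<rho> / (1 - exp (- 2 * \<rho>))) ^ (d + 1) + \<rho> ^ (d + 1) * power_sum q (exp (- 2 * \<rho>)))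
      \<longlongrightarrow> coeff p d * fact d * (1 / 2) ^ (d + 1) + 0) (at_right 0)"
    by (intro tendsto_add lim1 lim2)
  moreover have "eventually (\<lambda>\<rho>. coeff p d * fact d * (\<rho> / (1 - exp (- 2 * \<rho>))) ^ (d + 1) + \<rho> ^ (d + 1) * power_sum q (exp (- 2 * \<rho>))
      = \<rho> ^ (d + 1) * power_sum p (exp (- 2 * \<rho>))) (at_right (0::real))"
    using eventually_at_right_less[of 0]
  proof eventually_elim
    case (elim \<rho>)
    then have x: "\<bar>exp (- 2 * \<rho>)\<bar> < 1" by simp
    have "power_sum p (exp (- 2 * \<rho>)) = coeff p d * (fact d / (1 - exp (- 2 * \<rho>)) ^ (d + 1)) + power_sum q (exp (- 2 * \<rho>))"
      by (subst q(1)) (simp only: power_sum_add[OF x] power_sum_smult[OF x] power_sum_rising[OF x])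
    then show ?case
      by (simp add: power_divide algebra_simps del: power_Suc)
  qed
  ultimately show ?case
    by (subst (asm) tendsto_cong) (simp_all add: power_divide)
qed

section \<open>Leading coefficients of products and of shifted powers\<close>

lemma coeff_mult_degree_bounds:
  fixes p q :: "real poly"
  assumes "degree p \<le> i" "degree q \<le> j"
  shows "coeff (p * q) (i + j) = coeff p i * coeff q j"
proof (cases "degree p = i \<and> degree q = j")
  case True
  then show ?thesis using coeff_mult_degree_sum[of p q] by auto
next
  case False
  then have "degree p + degree q < i + j" using assms by auto
  then have "coeff (p * q) (i + j) = 0"
    by (intro coeff_eq_0 le_less_trans[OF degree_mult_le])
  moreover have "coeff p i = 0 \<or> coeff q j = 0"
    using False assms by (auto intro!: coeff_eq_0)
  ultimately show ?thesis by auto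
qed

lemma degree_mult_bounds:
  fixes p q :: "real poly"
  shows "degree p \<le> i \<Longrightarrow> degree q \<le> j \<Longrightarrow> degree (p * q) \<le> i + j"
  using degree_mult_le[of p q] by linarith

definition shift_power :: "nat \<Rightarrow> real poly" where
  "shift_power m = [:1, 1:] ^ m"

lemma poly_shift_power [simp]: "poly (shift_power m) t = (t + 1) ^ m"
  by (simp add: shift_power_def add.commute)

lemma degree_shift_power: "degree (shift_power m) = m"
  by (simp add: shift_power_def degree_linear_power)

lemma coeff_shift_power_top: "coeff (shift_power m) m = 1"
  by (simp add: shift_power_def coeff_linear_power)

lemma coeff_shift_power_Suc: "coeff (shift_power (Suc m)) m = real (Suc m)"
proof (induction m)
  case (Suc m)
  have "shift_power (Suc (Suc m)) = shift_power (Suc m) + pCons 0 (shift_power (Suc m))"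
    by (simp add: shift_power_def)
  then show ?case
    using Suc coeff_shift_power_top[of "Suc m"] by simp
qed (simp add: shift_power_def)

definition diff_power :: "nat \<Rightarrow> real poly" where
  "diff_power m = shift_power m - monom 1 m"

lemma degree_diff_power: "degree (diff_power (Suc m)) \<le> m"
proof (rule degree_le, intro allI impI)
  fix i assume "m < i"
  then show "coeff (diff_power (Suc m)) i = 0"
    using coeff_shift_power_top[of "Suc m"] degree_shift_power[of "Suc m"]
    by (cases "i = Suc m") (auto simp: diff_power_def coeff_eq_0)
qed

lemma coeff_diff_power: "coeff (diff_power (Suc m)) m = real (Suc m)"
  by (simp add: diff_power_def coeff_shift_power_Suc)

section \<open>Norm and centre of a wavelet\<close>

context ultraspherical
begin

lemma weighted_sqnorm: "(real l + a) / a * sqnorm l = mass * geg a l 1"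
proof -
  have "real l + a > 0" using a_pos by (simp add: add_nonneg_pos)
  then show ?thesis using a_pos by (simp add: sqnorm_eq)
qed

lemma geg_1_step: "(real l + 1) * geg a (Suc l) 1 = (real l + 2 * a) * geg a l 1"
  using gegenbauer_first_order[of 1 a l] by simp

context
  fixes w :: "nat \<Rightarrow> real" and \<alpha> :: "nat \<Rightarrow> real"
  defines "\<alpha> \<equiv> \<lambda>l. (real l + a) / a * w l"
  assumes adm: "admissible a \<alpha>"
begin

lemma coeff_sqnorm: "\<alpha> l * sqnorm l = mass * geg a l 1 * w l"
proof -
  have "\<alpha> l * sqnorm l = ((real l + a) / a * sqnorm l) * w l"
    by (simp only: \<alpha>_def mult_ac)
  then show ?thesis unfolding weighted_sqnorm .
qed

lemma zonal_square_sums: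
  "(\<lambda>l. mass * ((real l + a) / a * geg a l 1 * (w l)\<^sup>2)) sums (\<integral>x. (zonal a \<alpha> (X x))\<^sup>2 \<partial>M)"
proof -
  have "(\<lambda>l. \<alpha> l * \<alpha> l * sqnorm l) sums (\<integral>x. zonal a \<alpha> (X x) * zonal a \<alpha> (X x) \<partial>M)"
    by (rule integral_zonal_mult[OF adm adm])
  moreover have "\<alpha> l * \<alpha> l * sqnorm l = mass * ((real l + a) / a * geg a l 1 * (w l)\<^sup>2)" for l
    unfolding mult.assoc coeff_sqnorm by (simp add: \<alpha>_def power2_eq_square)
  ultimately show ?thesis by (simp add: power2_eq_square)
qed

text \<open>
  With \<open>b\<^sub>l = (l + 2 a) C\<^sub>l(1) / (2 a)\<close> the square norm is \<open>\<Sum> b\<^sub>l (w\<^sub>l\<^sup>2 + w\<^sub>l\<^sub>+\<^sub>1\<^sup>2)\<close> and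
  the first moment is \<open>2 \<Sum> b\<^sub>l w\<^sub>l w\<^sub>l\<^sub>+\<^sub>1\<close>, so the difference is a sum of squares.
\<close>

lemma zonal_defect_sums:
  assumes sm: "summable (\<lambda>l. (real l + 2 * a) / (2 * a) * geg a l 1 * (w (Suc l) * (w (Suc l) - w l)))"
  shows "(\<lambda>l. mass * ((real l + 2 * a) / (2 * a) * geg a l 1 * (w (Suc l) - w l)\<^sup>2)) sums
     ((\<integral>x. (zonal a \<alpha> (X x))\<^sup>2 \<partial>M) - (\<integral>x. X x * (zonal a \<alpha> (X x))\<^sup>2 \<partial>M))"
proof -
  define b where "b l = (real l + 2 * a) / (2 * a) * geg a l 1" for l
  \<comment> \<open>\<open>d\<close> is \<open>b\<close> shifted by one place, with
    \<open>d 0 = 0\<close>. Splitting the weight into \<open>b l + d l\<close> separates the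
    contributions of the pairs (l, l + 1) and (l - 1, l).\<close>
  define d where "d l = real l / (2 * a) * geg a l 1" for l
  have d_Suc: "d (Suc l) = b l" for l
    using geg_1_step[of l] by (simp add: d_def b_def add.commute)
  have split: "(real l + a) / a * geg a l 1 = b l + d l" for l
    using a_pos by (simp add: b_def d_def field_simps)
  have X_term: "\<alpha> l * ((real l + 1) * \<alpha> (Suc l) * sqnorm (Suc l) + (real l + 2 * a - 1) * (if l = 0 then 0 else \<alpha> (l - 1) * sqnorm (l - 1)))
      / (2 * (real l + a)) = mass * (w l * (b l * w (Suc l) + d l * w (l - 1)))" for l
  proof -
    have pos: "real l + a > 0" using a_pos by (simp add: add_nonneg_pos)
    have 1: "(real l + 1) * \<alpha> (Suc l) * sqnorm (Suc l) = 2 * a * (mass * (b l * w (Suc l)))"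
      unfolding mult.assoc coeff_sqnorm
      using geg_1_step[of l] a_pos by (simp add: b_def)
    have 2: "(real l + 2 * a - 1) * (if l = 0 then 0 else \<alpha> (l - 1) * sqnorm (l - 1)) = 2 * a * (mass * (d l * w (l - 1)))"
    proof (cases l)
      case 0
      then show ?thesis by (simp add: d_def)
    next
      case (Suc j)
      have "(real l + 2 * a - 1) * (if l = 0 then 0 else \<alpha> (l - 1) * sqnorm (l - 1)) =
          ((real j + 2 * a) * geg a j 1) * (mass * w j)"
        using coeff_sqnorm[of j] by (simp add: Suc mult_ac)
      also have "\<dots> = 2 * a * (mass * (d l * w (l - 1)))"
        using a_pos by (simp add: Suc d_Suc b_def mult_ac)
      finally show ?thesis .
    qed
    have "\<alpha> l / (2 * (real l + a)) = w l / (2 * a)"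
    proof -
      have "u / a * w l / (2 * u) = w l / (2 * a)" if "u > 0" for u
        using that by simp
      from this[OF pos] show ?thesis by (simp only: \<alpha>_def)
    qed
    moreover have "\<alpha> l * (2 * a * Z) / (2 * (real l + a)) = \<alpha> l / (2 * (real l + a)) * (2 * a * Z)" for Z
      by simp
    ultimately have Z: "\<alpha> l * (2 * a * Z) / (2 * (real l + a)) = w l * Z" for Z
      using a_pos by simp
    show ?thesis
      unfolding 1 2 distrib_left[symmetric] Z by (rule mult.left_commute)
  qed
  have B: "(\<lambda>l. mass * (w l * (b l * w (Suc l) + d l * w (l - 1)))) sums (\<integral>x. X x * (zonal a \<alpha> (X x))\<^sup>2 \<partial>M)"
    using integral_X_zonal_square[OF adm] unfolding X_term .
  let ?D = "(\<integral>x. (zonal a \<alpha> (X x))\<^sup>2 \<partial>M) - (\<integral>x. X x * (zonal a \<alpha> (X x))\<^sup>2 \<partial>M)"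
  \<comment> \<open>Because \<open>v 0 = 0\<close>, the sequence and its shift have the same sum.
    Subtracting one and adding the other changes nothing in total but completes each term to a
    square.\<close>
  define v where "v l = d l * (w l * (w l - w (l - 1)))" for l
  have "summable (\<lambda>l. v (Suc l))"
    using sm by (simp add: v_def d_Suc b_def)
  then obtain V where V: "(\<lambda>l. v (Suc l)) sums V" by (auto simp: summable_def)
  have v: "v sums V"
    by (rule sums_shift_zero[OF _ V]) (simp add: v_def d_def)
  have "(\<lambda>l. mass * ((b l + d l) * (w l)\<^sup>2) - mass * (w l * (b l * w (Suc l) + d l * w (l - 1)))
      - mass * v l + mass * v (Suc l)) sums (?D - mass * V + mass * V)"
    using zonal_square_sums unfolding split
    by (intro sums_add sums_diff sums_mult B v V)
  moreover have "mass * ((b l + d l) * (w l)\<^sup>2) - mass * (w l * (b l * w (Suc l) + d l * w (l - 1)))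
      - mass * v l + mass * v (Suc l) = mass * (b l * (w (Suc l) - w l)\<^sup>2)" for l
    by (simp add: v_def d_Suc power2_eq_square algebra_simps)
  ultimately show ?thesis by (simp add: b_def)
qed

end

end

section \<open>The wavelet integrals as power sums\<close>

context
  fixes n m :: nat
  assumes n: "n \<ge> 2"
begin

text \<open>Its value at l is the dimension of the space of spherical harmonics of degree l in n + 1
  variables.\<close>

definition dim_poly :: "real poly" where
  "dim_poly = smult (2 / (real n - 1) / fact (n - 2)) ([:(real n - 1) / 2, 1:] * rising (n - 2))"

text \<open>Its value at l is the binomial coefficient of l + n - 1 over n - 1, the weight of the
  squared difference between the indices l and l + 1.\<close>

definition step_poly :: "real poly" where
  "step_poly = smult (1 / (real n - 1) / fact (n - 2)) ([:real n - 1, 1:] * rising (n - 2))"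

lemma geg_1_poly: "geg ((real n - 1) / 2) l 1 = poly (rising (n - 2)) (real l) / fact (n - 2)"
proof -
  have "(real n - 1) / 2 = (real (n - 2) + 1) / 2" using n by simp
  then show ?thesis using gegenbauer_1_eq_rising[of "n - 2" l] by (simp add: field_simps)
qed

lemma poly_dim_poly:
  "poly dim_poly (real l) = (real l + (real n - 1) / 2) / ((real n - 1) / 2) * geg ((real n - 1) / 2) l 1"
  unfolding geg_1_poly dim_poly_def using n by (simp add: field_simps)

lemma poly_step_poly:
  "poly step_poly (real l) = (real l + 2 * ((real n - 1) / 2)) / (2 * ((real n - 1) / 2)) * geg ((real n - 1) / 2) l 1"
  unfolding geg_1_poly step_poly_def using n by (simp add: field_simps)

lemma fact_n_2: "(real n - 1) * fact (n - 2) = fact (n - 1)"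
proof -
  obtain k where "n = Suc (Suc k)" using n by (metis Suc_le_D numeral_2_eq_2 Suc_le_mono)
  then show ?thesis by simp
qed

lemma degree_linear_rising: "degree ([:c, 1:] * rising (n - 2)) \<le> n - 1" "coeff ([:c, 1:] * rising (n - 2)) (n - 1) = 1"
proof -
  have e: "n - 1 = 1 + (n - 2)" using n by simp
  show "degree ([:c, 1:] * rising (n - 2)) \<le> n - 1"
    unfolding e by (rule degree_mult_bounds) (auto simp: rising_degree)
  show "coeff ([:c, 1:] * rising (n - 2)) (n - 1) = 1"
    unfolding e by (subst coeff_mult_degree_bounds) (auto simp: rising_degree)
qed

lemma degree_dim_poly: "degree dim_poly \<le> n - 1"
  unfolding dim_poly_def by (rule order.trans[OF degree_smult_le degree_linear_rising(1)])

lemma coeff_dim_poly: "coeff dim_poly (n - 1) = 2 / fact (n - 1)"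
  unfolding dim_poly_def coeff_smult degree_linear_rising fact_n_2[symmetric] by simp

lemma degree_step_poly: "degree step_poly \<le> n - 1"
  unfolding step_poly_def by (rule order.trans[OF degree_smult_le degree_linear_rising(1)])

lemma coeff_step_poly: "coeff step_poly (n - 1) = 1 / fact (n - 1)"
  unfolding step_poly_def coeff_smult degree_linear_rising fact_n_2[symmetric] by simp

definition wavelet_fun :: "real \<Rightarrow> real \<Rightarrow> real" where
  "wavelet_fun \<rho> = zonal ((real n - 1) / 2) (wavelet_coeff n m \<rho>)"

definition norm_poly :: "real poly" where
  "norm_poly = dim_poly * monom 1 (2 * m)"

lemma wavelet_norm:
  assumes \<rho>: "\<rho> > 0"
  shows "(\<integral>x. (wavelet_fun \<rho> (x 1))\<^sup>2 \<partial>surface_measure n) =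
     sphere_area n * (\<rho> ^ (2 * m) * power_sum norm_poly (exp (- 2 * \<rho>)))"
proof -
  interpret ultraspherical "surface_measure n" "\<lambda>x. x 1" "(real n - 1) / 2"
    by (rule ultraspherical_surface[OF n])
  let ?a = "(real n - 1) / 2" and ?x = "exp (- 2 * \<rho>)"
  let ?w = "\<lambda>l. (\<rho> * real l) ^ m * exp (- \<rho> * real l)"
  have mass: "mass = sphere_area n" by (simp add: mass_def sphere_area_eq)
  have ex: "(exp (- \<rho> * real l))\<^sup>2 = ?x ^ l" for l
    by (simp add: exp_of_nat_mult[symmetric] power2_eq_square exp_add[symmetric] mult_ac)
  have adm: "admissible ?a (\<lambda>l. (real l + ?a) / ?a * ?w l)"
    using wavelet_admissible[OF n \<rho>, of m] by (simp only: wavelet_coeff_def[abs_def])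
  have "(\<lambda>l. mass * ((real l + ?a) / ?a * geg ?a l 1 * (?w l)\<^sup>2)) sums (\<integral>x. (wavelet_fun \<rho> (x 1))\<^sup>2 \<partial>surface_measure n)"
    using zonal_square_sums[OF adm] by (simp only: wavelet_fun_def wavelet_coeff_def[abs_def])
  moreover have "mass * ((real l + ?a) / ?a * geg ?a l 1 * (?w l)\<^sup>2) =
      mass * \<rho> ^ (2 * m) * (poly norm_poly (real l) * ?x ^ l)" for l
    unfolding norm_poly_def poly_mult poly_dim_poly poly_monom power_mult_distrib[of _ "exp _"] ex
    by (simp only: power_mult_distrib power_mult[symmetric] mult_ac mult_1_left)
  ultimately have "(\<lambda>l. mass * \<rho> ^ (2 * m) * (poly norm_poly (real l) * ?x ^ l)) sums (\<integral>x. (wavelet_fun \<rho> (x 1))\<^sup>2 \<partial>surface_measure n)"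
    by simp
  moreover have "(\<lambda>l. mass * \<rho> ^ (2 * m) * (poly norm_poly (real l) * ?x ^ l)) sums (mass * \<rho> ^ (2 * m) * power_sum norm_poly ?x)"
    by (intro sums_mult power_sum_sums) (use \<rho> in simp)
  ultimately show ?thesis
    unfolding mass[symmetric] mult.assoc[symmetric] by (rule sums_unique2)
qed

text \<open>Up to a common factor, consecutive weights differ by P(l) - (1 - exp (-\<rho>)) Q(l)
  with P = (t + 1)^m - t^m and Q = (t + 1)^m; these are the three terms of its square. For m \<ge> 1
  the degree of P is one less than that of Q, and 1 - exp (-\<rho>) is about \<rho>, so all three
  have the same order.\<close>

definition defect :: "real \<Rightarrow> real" where
  "defect \<rho> = power_sum (step_poly * (diff_power m * diff_power m)) (exp (- 2 * \<rho>))
     - 2 * (1 - exp (- \<rho>)) * power_sum (step_poly * (diff_power m * shift_power m)) (exp (- 2 * \<rho>))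
     + (1 - exp (- \<rho>))\<^sup>2 * power_sum (step_poly * (shift_power m * shift_power m)) (exp (- 2 * \<rho>))"

lemma wavelet_defect:
  assumes \<rho>: "\<rho> > 0"
  shows "(\<integral>x. (wavelet_fun \<rho> (x 1))\<^sup>2 \<partial>surface_measure n) - (\<integral>x. x 1 * (wavelet_fun \<rho> (x 1))\<^sup>2 \<partial>surface_measure n) =
     sphere_area n * (\<rho> ^ (2 * m) * defect \<rho>)"
proof -
  interpret ultraspherical "surface_measure n" "\<lambda>x. x 1" "(real n - 1) / 2"
    by (rule ultraspherical_surface[OF n])
  let ?a = "(real n - 1) / 2" and ?x = "exp (- 2 * \<rho>)" and ?y = "exp (- \<rho>)"
  let ?P = "diff_power m" and ?Q = "shift_power m"
  define w where "w l = (\<rho> * real l) ^ m * exp (- \<rho> * real l)" for l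
  have mass: "mass = sphere_area n" by (simp add: mass_def sphere_area_eq)
  have x1: "\<bar>?x\<bar> < 1" using \<rho> by simp
  have xy: "?y ^ l * ?y ^ l = ?x ^ l" for l
    by (simp add: exp_of_nat_mult[symmetric] exp_add[symmetric])
  have w: "w l = \<rho> ^ m * real l ^ m * ?y ^ l" for l
    by (simp add: w_def power_mult_distrib exp_of_nat_mult[symmetric] mult.commute)
  have w_Suc: "w (Suc l) = \<rho> ^ m * ?y * poly ?Q (real l) * ?y ^ l" for l
    unfolding w by (simp add: mult_ac add.commute)
  have w_diff: "w (Suc l) - w l = \<rho> ^ m * (poly ?P (real l) - (1 - ?y) * poly ?Q (real l)) * ?y ^ l" for l
    unfolding w_Suc w by (simp add: diff_power_def poly_monom algebra_simps)
  have sm: "summable (\<lambda>l. (real l + 2 * ?a) / (2 * ?a) * geg ?a l 1 * (w (Suc l) * (w (Suc l) - w l)))"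
  proof -
    have "summable (\<lambda>l. \<rho> ^ (2 * m) * ?y * (poly (step_poly * (?Q * ?P)) (real l) * ?x ^ l
        - (1 - ?y) * (poly (step_poly * (?Q * ?Q)) (real l) * ?x ^ l)))"
      by (intro summable_mult summable_diff power_sum_summable x1)
    moreover have "\<rho> ^ (2 * m) * ?y * (poly (step_poly * (?Q * ?P)) (real l) * ?x ^ l
        - (1 - ?y) * (poly (step_poly * (?Q * ?Q)) (real l) * ?x ^ l)) =
        poly step_poly (real l) * (w (Suc l) * (w (Suc l) - w l))" for l
      unfolding w_diff unfolding w_Suc xy[symmetric] poly_mult mult_2 power_add by (simp only: left_diff_distrib right_diff_distrib mult_ac)
    ultimately show ?thesis by (simp only: poly_step_poly)
  qed
  have adm: "admissible ?a (\<lambda>l. (real l + ?a) / ?a * w l)"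
    using wavelet_admissible[OF n \<rho>, of m] by (simp only: wavelet_coeff_def[abs_def] w_def)
  have "(\<lambda>l. mass * (poly step_poly (real l) * (w (Suc l) - w l)\<^sup>2)) sums
     ((\<integral>x. (wavelet_fun \<rho> (x 1))\<^sup>2 \<partial>surface_measure n) - (\<integral>x. x 1 * (wavelet_fun \<rho> (x 1))\<^sup>2 \<partial>surface_measure n))"
    using zonal_defect_sums[OF adm sm]
    by (simp only: wavelet_fun_def wavelet_coeff_def[abs_def] w_def poly_step_poly)
  moreover have "mass * (poly step_poly (real l) * (w (Suc l) - w l)\<^sup>2) =
      mass * \<rho> ^ (2 * m) * (poly (step_poly * (?P * ?P)) (real l) * ?x ^ l
        - 2 * (1 - ?y) * (poly (step_poly * (?P * ?Q)) (real l) * ?x ^ l)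
        + (1 - ?y)\<^sup>2 * (poly (step_poly * (?Q * ?Q)) (real l) * ?x ^ l))" for l
    unfolding w_diff xy[symmetric] poly_mult mult_2[of m] power_add power2_eq_square
    by (simp only: left_diff_distrib right_diff_distrib distrib_left distrib_right mult_ac)
  ultimately have "(\<lambda>l. mass * \<rho> ^ (2 * m) * (poly (step_poly * (?P * ?P)) (real l) * ?x ^ l
        - 2 * (1 - ?y) * (poly (step_poly * (?P * ?Q)) (real l) * ?x ^ l)
        + (1 - ?y)\<^sup>2 * (poly (step_poly * (?Q * ?Q)) (real l) * ?x ^ l))) sums
     ((\<integral>x. (wavelet_fun \<rho> (x 1))\<^sup>2 \<partial>surface_measure n) - (\<integral>x. x 1 * (wavelet_fun \<rho> (x 1))\<^sup>2 \<partial>surface_measure n))"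
    by (simp only:)
  moreover have "(\<lambda>l. mass * \<rho> ^ (2 * m) * (poly (step_poly * (?P * ?P)) (real l) * ?x ^ l
        - 2 * (1 - ?y) * (poly (step_poly * (?P * ?Q)) (real l) * ?x ^ l)
        + (1 - ?y)\<^sup>2 * (poly (step_poly * (?Q * ?Q)) (real l) * ?x ^ l))) sums
      (mass * \<rho> ^ (2 * m) * defect \<rho>)"
    unfolding defect_def by (intro sums_mult sums_add sums_diff power_sum_sums x1)
  ultimately show ?thesis
    unfolding mass[symmetric] mult.assoc[symmetric] by (rule sums_unique2)
qed

end

section \<open>The Laplace--Beltrami operator\<close>

text \<open>The first derivative must be known on a neighbourhood of \<open>s\<close> before it can
  be differentiated again, hence the open set \<open>U\<close>; the outer function need be
  differentiable only along the image of \<open>U\<close>.\<close>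

lemma second_deriv_chain:
  fixes F F' F'' u u' u'' :: "real \<Rightarrow> real"
  assumes U: "open U" "s \<in> U"
    and \<phi>: "\<And>t. t \<in> U \<Longrightarrow> \<phi> t = F (u t)"
    and u: "\<And>t. t \<in> U \<Longrightarrow> (u has_field_derivative u' t) (at t)"
    and u': "(u' has_field_derivative v) (at s)"
    and F: "\<And>t. t \<in> U \<Longrightarrow> (F has_field_derivative F' (u t)) (at (u t))"
    and F': "(F' has_field_derivative w) (at (u s))"
  shows "(deriv ^^ 2) \<phi> s = w * (u' s)\<^sup>2 + F' (u s) * v"
proof -
  have d1: "deriv \<phi> t = F' (u t) * u' t" if t: "t \<in> U" for t
  proof -
    have "((\<lambda>t. F (u t)) has_field_derivative F' (u t) * u' t) (at t)"
      by (rule DERIV_chain2[OF F[OF t] u[OF t]])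
    moreover have "eventually (\<lambda>t. \<phi> t = F (u t)) (nhds t)"
      using \<phi> by (intro eventually_nhds_in_open[OF U(1) t, THEN eventually_mono])
    ultimately show ?thesis
      by (metis DERIV_imp_deriv deriv_cong_ev)
  qed
  have "((\<lambda>t. F' (u t) * u' t) has_field_derivative (w * u' s * u' s + v * F' (u s))) (at s)"
    by (rule DERIV_mult[OF DERIV_chain2[OF F' u[OF U(2)]] u'])
  moreover have "eventually (\<lambda>t. deriv \<phi> t = F' (u t) * u' t) (nhds s)"
    using d1 by (intro eventually_nhds_in_open[OF U, THEN eventually_mono])
  ultimately have "deriv (deriv \<phi>) s = w * u' s * u' s + v * F' (u s)"
    using deriv_cong_ev[of "deriv \<phi>" "\<lambda>t. F' (u t) * u' t" s s] by (simp add: DERIV_imp_deriv)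
  then show ?thesis
    by (simp add: numeral_2_eq_2 power2_eq_square mult.commute mult.assoc)
qed

context
  fixes S :: real
begin

text \<open>The norm of a point as a function of one coordinate \<open>t\<close>, where the squares
  of the other coordinates add up to \<open>S\<close>.\<close>

definition "rad t = sqrt (S + t\<^sup>2)"

lemma rad_deriv:
  assumes "S + t\<^sup>2 > 0"
  shows "(rad has_field_derivative t / rad t) (at t)"
  unfolding rad_def[abs_def] using assms
  by (auto intro!: derivative_eq_intros simp: field_simps)

lemma rad_pos: "S + t\<^sup>2 > 0 \<Longrightarrow> rad t > 0"
  by (simp add: rad_def)

lemma rad_sq: "S + t\<^sup>2 > 0 \<Longrightarrow> (rad t)\<^sup>2 = S + t\<^sup>2"
  by (simp add: rad_def)

text \<open>These concern the first coordinate of the projected point while another coordinate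
  \<open>t\<close> moves; \<open>c\<close> is the fixed first coordinate before projection.\<close>

lemma transversal_derivs:
  assumes "S + t\<^sup>2 > 0"
  shows "((\<lambda>t. c / rad t) has_field_derivative - (c * t) / rad t ^ 3) (at t)"
    "((\<lambda>t. - (c * t) / rad t ^ 3) has_field_derivative - c / rad t ^ 3 + 3 * c * t\<^sup>2 / rad t ^ 5) (at t)"
proof -
  have p: "rad t > 0" by (rule rad_pos[OF assms])
  show "((\<lambda>t. c / rad t) has_field_derivative - (c * t) / rad t ^ 3) (at t)"
    using p by (auto intro!: derivative_eq_intros rad_deriv assms simp: field_simps eval_nat_numeral)
  show "((\<lambda>t. - (c * t) / rad t ^ 3) has_field_derivative - c / rad t ^ 3 + 3 * c * t\<^sup>2 / rad t ^ 5) (at t)"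
    using p by (auto intro!: derivative_eq_intros rad_deriv assms simp: divide_simps) (simp add: algebra_simps eval_nat_numeral)
qed

text \<open>The counterpart of \<open>transversal_derivs\<close> for the case that the first
  coordinate itself moves.\<close>

lemma axial_derivs:
  assumes "S + t\<^sup>2 > 0"
  shows "((\<lambda>t. t / rad t) has_field_derivative S / rad t ^ 3) (at t)"
    "((\<lambda>t. S / rad t ^ 3) has_field_derivative - 3 * S * t / rad t ^ 5) (at t)"
proof -
  have p: "rad t > 0" by (rule rad_pos[OF assms])
  have "(1 * rad t - t * (t / rad t)) / (rad t * rad t) = S / rad t ^ 3"
  proof -
    have "(1 * rad t - t * (t / rad t)) / (rad t * rad t) = ((rad t)\<^sup>2 - t\<^sup>2) / rad t ^ 3"
      using p by (simp add: field_simps eval_nat_numeral)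
    then show ?thesis by (simp add: rad_sq[OF assms])
  qed
  then show "((\<lambda>t. t / rad t) has_field_derivative S / rad t ^ 3) (at t)"
    using DERIV_divide[OF DERIV_ident rad_deriv[OF assms]] p by simp
  show "((\<lambda>t. S / rad t ^ 3) has_field_derivative - 3 * S * t / rad t ^ 5) (at t)"
    using p by (auto intro!: derivative_eq_intros rad_deriv assms simp: divide_simps) (simp add: algebra_simps eval_nat_numeral)
qed

end

text \<open>Since x_2^2 + ... + x_(n+1)^2 = 1 - x_1^2, the coefficients of F'' add up to (1 -
  x_1^2)^2 + x_1^2 (1 - x_1^2) = 1 - x_1^2. In those of F' the cubic contributions of the axial and
  the transversal directions cancel, leaving -n x_1.\<close>

lemma laplace_beltrami_zonal:
  fixes F F' F'' :: "real \<Rightarrow> real"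
  assumes f: "\<And>y. y \<in> unit_sphere n \<Longrightarrow> f y = F (y 1)"
    and F: "\<And>t. \<bar>t\<bar> < 1 \<Longrightarrow> (F has_field_derivative F' t) (at t)"
    and F': "\<And>t. \<bar>t\<bar> < 1 \<Longrightarrow> (F' has_field_derivative F'' t) (at t)"
    and x: "x \<in> unit_sphere n" and x1: "\<bar>x 1\<bar> < 1"
  shows "laplace_beltrami n f x = (1 - (x 1)\<^sup>2) * F'' (x 1) - real n * x 1 * F' (x 1)"
proof -
  have sq: "(\<Sum>i\<in>{1..n+1}. (x i)\<^sup>2) = 1"
    using x by (simp add: unit_sphere_def L2_set_def del: sum.cl_ivl_Suc)
  have proj: "f (radial_proj n (x(i := t))) = F ((x(i := t)) 1 / rad (1 - (x i)\<^sup>2) t)"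
    if i: "i \<in> {1..n+1}" and t: "1 - (x i)\<^sup>2 + t\<^sup>2 > 0" for i t
  proof -
    have "(\<Sum>j\<in>{1..n+1}. ((x(i := t)) j)\<^sup>2) = t\<^sup>2 + (\<Sum>j\<in>{1..n+1} - {i}. (x j)\<^sup>2)"
      using i by (subst sum.remove[of _ i]) (auto intro!: sum.cong)
    also have "(\<Sum>j\<in>{1..n+1} - {i}. (x j)\<^sup>2) = 1 - (x i)\<^sup>2"
      using i sq by (subst (asm) sum.remove[of _ i]) (auto simp del: sum.cl_ivl_Suc)
    finally have L: "L2_set (x(i := t)) {1..n+1} = rad (1 - (x i)\<^sup>2) t"
      by (simp only: L2_set_def rad_def add.commute)
    have "rad (1 - (x i)\<^sup>2) t > 0" by (rule rad_pos[OF t])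
    then have "radial_proj n (x(i := t)) \<in> unit_sphere n"
      using L2_set_radial_proj[of n "x(i := t)"] radial_proj_in_space[of n "x(i := t)"]
      unfolding L by (simp add: unit_sphere_def space_lebesgue_space)
    then show ?thesis
      using f L by (simp add: radial_proj_def)
  qed
  have transversal: "(deriv ^^ 2) (\<lambda>t. f (radial_proj n (x(i := t)))) (x i) =
      F'' (x 1) * (x 1 * x i)\<^sup>2 + F' (x 1) * (- x 1 + 3 * x 1 * (x i)\<^sup>2)" if i: "i \<in> {2..n+1}" for i
  proof -
    let ?S = "1 - (x i)\<^sup>2"
    \<comment> \<open>The second condition keeps the first coordinate of the projected point inside
      (-1, 1), where \<open>F\<close> is differentiable.\<close>
    let ?U = "{t. ?S + t\<^sup>2 > 0} \<inter> {t. \<bar>x 1\<bar> < rad ?S t}"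
    have R: "rad ?S (x i) = 1" by (simp add: rad_def)
    have "(deriv ^^ 2) (\<lambda>t. f (radial_proj n (x(i := t)))) (x i) =
        F'' (x 1) * (- (x 1 * x i) / rad ?S (x i) ^ 3)\<^sup>2 + F' (x 1 / rad ?S (x i)) *
          (- x 1 / rad ?S (x i) ^ 3 + 3 * x 1 * (x i)\<^sup>2 / rad ?S (x i) ^ 5)"
    proof (rule second_deriv_chain[where F = F and U = ?U and F' = F' and u = "\<lambda>t. x 1 / rad ?S t"
          and u' = "\<lambda>t. - (x 1 * t) / rad ?S t ^ 3"])
      show "open ?U"
        unfolding rad_def by (intro open_Int open_Collect_less continuous_intros)
      show "x i \<in> ?U" using x1 R by simp
      show "f (radial_proj n (x(i := t))) = F (x 1 / rad ?S t)" if "t \<in> ?U" for t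
        using proj[of i t] that i by auto
      show "((\<lambda>t. x 1 / rad ?S t) has_field_derivative - (x 1 * t) / rad ?S t ^ 3) (at t)" if "t \<in> ?U" for t
        using that by (intro transversal_derivs) auto
      show "((\<lambda>t. - (x 1 * t) / rad ?S t ^ 3) has_field_derivative
          - x 1 / rad ?S (x i) ^ 3 + 3 * x 1 * (x i)\<^sup>2 / rad ?S (x i) ^ 5) (at (x i))"
        by (intro transversal_derivs) simp
      show "(F has_field_derivative F' (x 1 / rad ?S t)) (at (x 1 / rad ?S t))" if "t \<in> ?U" for t
        using that rad_pos[of ?S t] by (intro F) (auto simp: abs_divide)
      show "(F' has_field_derivative F'' (x 1)) (at (x 1 / rad ?S (x i)))"
        using F'[OF x1] R by simp
    qed
    then show ?thesis unfolding R by simp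
  qed
  have axial: "(deriv ^^ 2) (\<lambda>t. f (radial_proj n (x(1 := t)))) (x 1) =
      F'' (x 1) * (1 - (x 1)\<^sup>2)\<^sup>2 + F' (x 1) * (- 3 * (1 - (x 1)\<^sup>2) * x 1)"
  proof -
    let ?S = "1 - (x 1)\<^sup>2"
    let ?U = "{t. ?S + t\<^sup>2 > 0} \<inter> {t. \<bar>t\<bar> < rad ?S t}"
    have R: "rad ?S (x 1) = 1" by (simp add: rad_def)
    have "(deriv ^^ 2) (\<lambda>t. f (radial_proj n (x(1 := t)))) (x 1) =
        F'' (x 1) * (?S / rad ?S (x 1) ^ 3)\<^sup>2 + F' (x 1 / rad ?S (x 1)) *
          (- 3 * ?S * x 1 / rad ?S (x 1) ^ 5)"
    proof (rule second_deriv_chain[where F = F and U = ?U and F' = F' and u = "\<lambda>t. t / rad ?S t"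
          and u' = "\<lambda>t. ?S / rad ?S t ^ 3"])
      show "open ?U"
        unfolding rad_def by (intro open_Int open_Collect_less continuous_intros)
      show "x 1 \<in> ?U" using x1 R by simp
      show "f (radial_proj n (x(1 := t))) = F (t / rad ?S t)" if "t \<in> ?U" for t
        using proj[of 1 t] that by auto
      show "((\<lambda>t. t / rad ?S t) has_field_derivative ?S / rad ?S t ^ 3) (at t)" if "t \<in> ?U" for t
        using that by (intro axial_derivs) auto
      show "((\<lambda>t. ?S / rad ?S t ^ 3) has_field_derivative - 3 * ?S * x 1 / rad ?S (x 1) ^ 5) (at (x 1))"
        by (intro axial_derivs) simp
      show "(F has_field_derivative F' (t / rad ?S t)) (at (t / rad ?S t))" if "t \<in> ?U" for t
        using that rad_pos[of ?S t] by (intro F) (auto simp: abs_divide)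
      show "(F' has_field_derivative F'' (x 1)) (at (x 1 / rad ?S (x 1)))"
        using F'[OF x1] R by simp
    qed
    then show ?thesis unfolding R by simp
  qed
  have rest: "(\<Sum>i\<in>{2..n+1}. (x i)\<^sup>2) = 1 - (x 1)\<^sup>2"
    using sq unfolding sum_split_first by simp
  have "laplace_beltrami n f x = F'' (x 1) * (1 - (x 1)\<^sup>2)\<^sup>2 + F' (x 1) * (- 3 * (1 - (x 1)\<^sup>2) * x 1) +
      (\<Sum>i\<in>{2..n+1}. F'' (x 1) * (x 1)\<^sup>2 * (x i)\<^sup>2 + F' (x 1) * (- x 1) + 3 * F' (x 1) * x 1 * (x i)\<^sup>2)"
    unfolding laplace_beltrami_def sum_split_first axial
    by (intro arg_cong2[where f = "(+)"] refl sum.cong, subst transversal) (auto simp: power_mult_distrib algebra_simps)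
  also have "\<dots> = F'' (x 1) * (1 - (x 1)\<^sup>2)\<^sup>2 + F' (x 1) * (- 3 * (1 - (x 1)\<^sup>2) * x 1) +
      (F'' (x 1) * (x 1)\<^sup>2 * (1 - (x 1)\<^sup>2) + real n * (F' (x 1) * (- x 1)) + 3 * F' (x 1) * x 1 * (1 - (x 1)\<^sup>2))"
    unfolding sum.distrib sum_distrib_left[symmetric] rest by simp
  also have "\<dots> = (1 - (x 1)\<^sup>2) * F'' (x 1) - real n * x 1 * F' (x 1)"
    by (simp add: power2_eq_square algebra_simps)
  finally show ?thesis .
qed

section \<open>Termwise differentiation of zonal series\<close>

text \<open>The step of index two expresses derivatives with positive coefficients, so the bound by
  the value at 1 is inherited by induction, once for each derivative.\<close>

lemma gegenbauer_deriv_bounds: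
  assumes a: "a > 0" and t: "\<bar>t\<bar> \<le> 1"
  shows "\<bar>geg' a l t\<bar> \<le> geg' a l 1" "\<bar>geg'' a l t\<bar> \<le> geg'' a l 1"
proof -
  have step': "geg' a (Suc (Suc l)) t = geg' a l t + 2 * (real l + 1 + a) * geg a (Suc l) t" for l t
    by (simp add: gegenbauer_deriv_step)
  have step'': "geg'' a (Suc (Suc l)) t = geg'' a l t + 2 * (real l + 1 + a) * geg' a (Suc l) t" for l t
    by (simp add: gegenbauer_deriv_step pderiv_add pderiv_smult)
  have 1: "\<bar>geg' a l t\<bar> \<le> geg' a l 1" for l
  proof (induction l rule: induct_nat_012)
    case (ge2 l)
    have "\<bar>2 * (real l + 1 + a) * geg a (Suc l) t\<bar> \<le> 2 * (real l + 1 + a) * geg a (Suc l) 1"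
      using a gegenbauer_abs_le[OF a t] unfolding abs_mult by (intro mult_mono) auto
    then show ?case unfolding step' using ge2(1) by linarith
  qed (use a in \<open>auto simp: pderiv_pCons\<close>)
  then show "\<bar>geg' a l t\<bar> \<le> geg' a l 1" .
  show "\<bar>geg'' a l t\<bar> \<le> geg'' a l 1"
  proof (induction l rule: induct_nat_012)
    case (ge2 l)
    have "\<bar>2 * (real l + 1 + a) * geg' a (Suc l) t\<bar> \<le> 2 * (real l + 1 + a) * geg' a (Suc l) 1"
      using a 1[of "Suc l"] unfolding abs_mult by (intro mult_mono) auto
    then show ?case unfolding step'' using ge2(1) by linarith
  qed (use a in \<open>auto simp: pderiv_pCons\<close>)
qed

lemma gegenbauer_deriv_at_1: "(2 * a + 1) * geg' a l 1 = real l * (real l + 2 * a) * geg a l 1"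
  using gegenbauer_ode[of 1 a l] by simp

lemma gegenbauer_deriv2_at_1:
  "(2 * a + 3) * geg'' a l 1 = (real l * (real l + 2 * a) - (2 * a + 1)) * geg' a l 1"
proof -
  let ?C = "gegenbauer a l"
  have "[:1, 0, -1:] * pderiv (pderiv ?C) - smult (2 * a + 1) ([:0, 1:] * pderiv ?C) = smult (- (real l * (real l + 2 * a))) ?C"
    using gegenbauer_ode[of _ a l]
    by (simp add: poly_eq_poly_eq_iff[symmetric] fun_eq_iff power2_eq_square algebra_simps)
  from arg_cong[OF this, of "\<lambda>p. poly (pderiv p) 1"]
  have "- 2 * geg'' a l 1 - (2 * a + 1) * (geg' a l 1 + geg'' a l 1) = - (real l * (real l + 2 * a)) * geg' a l 1"
    by (simp only: pderiv_diff pderiv_mult pderiv_smult poly_diff poly_add poly_mult poly_smult)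
       (simp add: pderiv_pCons add.commute mult.commute)
  then show ?thesis by (simp add: algebra_simps)
qed

text \<open>The differential equation and its derivative, taken at 1, where the top-order term
  disappears: each derivative costs at most a factor of order l^2.\<close>

lemma gegenbauer_deriv_le:
  assumes a: "a > 0"
  shows "geg' a l 1 \<le> (1 + 2 * a) * (real l ^ 2 * geg a l 1)" "geg'' a l 1 \<le> (1 + 2 * a)\<^sup>2 * (real l ^ 4 * geg a l 1)"
proof -
  have c: "geg a l 1 \<ge> 0" and c': "geg' a l 1 \<ge> 0" and c'': "geg'' a l 1 \<ge> 0"
    using gegenbauer_abs_le[OF a, of 1 l] gegenbauer_deriv_bounds[OF a, of 1 l] by auto
  have l: "real l * (real l + 2 * a) \<le> (1 + 2 * a) * real l ^ 2"
    using a by (cases l) (auto simp: power2_eq_square algebra_simps)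
  have "geg' a l 1 \<le> (2 * a + 1) * geg' a l 1"
    using a c' by (simp add: algebra_simps)
  also have "\<dots> \<le> (1 + 2 * a) * real l ^ 2 * geg a l 1"
    unfolding gegenbauer_deriv_at_1 by (rule mult_right_mono[OF l c])
  finally show 1: "geg' a l 1 \<le> (1 + 2 * a) * (real l ^ 2 * geg a l 1)" by (simp add: mult_ac)
  have "geg'' a l 1 \<le> (2 * a + 3) * geg'' a l 1"
    using a c'' by (simp add: algebra_simps)
  also have "\<dots> \<le> (1 + 2 * a) * real l ^ 2 * geg' a l 1"
    unfolding gegenbauer_deriv2_at_1 using l a by (intro mult_right_mono c') linarith
  also have "\<dots> \<le> (1 + 2 * a) * real l ^ 2 * ((1 + 2 * a) * (real l ^ 2 * geg a l 1))"
    using a by (intro mult_left_mono 1) auto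
  finally show "geg'' a l 1 \<le> (1 + 2 * a)\<^sup>2 * (real l ^ 4 * geg a l 1)"
    by (simp add: power2_eq_square power4_eq_xxxx mult_ac)
qed

lemma termwise_deriv:
  fixes f f' :: "nat \<Rightarrow> real \<Rightarrow> real"
  assumes "\<And>l t. (f l has_field_derivative f' l t) (at t)"
    and "\<And>l t. \<bar>t\<bar> < 1 \<Longrightarrow> \<bar>f' l t\<bar> \<le> B l" "summable B"
    and "summable (\<lambda>l. f l 0)" "\<bar>t\<bar> < 1"
  shows "((\<lambda>t. \<Sum>l. f l t) has_field_derivative (\<Sum>l. f' l t)) (at t)"
proof (rule has_field_derivative_series'(2)[where S = "{-1<..<1}" and ?x0.0 = 0])
  show "uniformly_convergent_on {-1<..<1} (\<lambda>n x. \<Sum>i<n. f' i x)"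
    by (rule Weierstrass_m_test'[where M = B]) (use assms in auto)
  show "(f l has_field_derivative f' l t) (at t within {-1<..<1})" for l t
    using assms(1) by (rule has_field_derivative_at_within)
qed (use assms in \<open>auto simp: interior_open\<close>)

text \<open>The summability with weight l^4 majorises the series of second derivatives, and that of
  first derivatives because l^2 \<le> l^4. The third part is the Gegenbauer equation summed over
  l.\<close>

lemma zonal_derivs:
  assumes a: "a > 0" and sm: "summable (\<lambda>l. \<bar>\<alpha> l\<bar> * (real l ^ 4 * geg a l 1))" and adm: "admissible a \<alpha>"
    and t: "\<bar>t\<bar> < 1"
  shows "(zonal a \<alpha> has_field_derivative (\<Sum>l. \<alpha> l * geg' a l t)) (at t)"
    "((\<lambda>t. \<Sum>l. \<alpha> l * geg' a l t) has_field_derivative (\<Sum>l. \<alpha> l * geg'' a l t)) (at t)"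
    "(1 - t\<^sup>2) * (\<Sum>l. \<alpha> l * geg'' a l t) - (2 * a + 1) * t * (\<Sum>l. \<alpha> l * geg' a l t) =
      - zonal a (\<lambda>l. real l * (real l + 2 * a) * \<alpha> l) t"
proof -
  have c: "geg a l 1 \<ge> 0" for l
    using gegenbauer_abs_le[OF a, of 1 l] by simp
  have p24: "real l ^ 2 \<le> real l ^ 4" for l
    by (cases l) (auto intro: power_increasing)
  have B': "\<bar>\<alpha> l * geg' a l t\<bar> \<le> (1 + 2 * a) * (\<bar>\<alpha> l\<bar> * (real l ^ 4 * geg a l 1))" if "\<bar>t\<bar> \<le> 1" for l t
  proof -
    have "\<bar>geg' a l t\<bar> \<le> (1 + 2 * a) * (real l ^ 2 * geg a l 1)"
      using gegenbauer_deriv_bounds(1)[OF a that, of l] gegenbauer_deriv_le(1)[OF a, of l] by linarith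
    also have "\<dots> \<le> (1 + 2 * a) * (real l ^ 4 * geg a l 1)"
      using a by (intro mult_left_mono mult_right_mono p24 c) auto
    finally have "\<bar>\<alpha> l\<bar> * \<bar>geg' a l t\<bar> \<le> \<bar>\<alpha> l\<bar> * ((1 + 2 * a) * (real l ^ 4 * geg a l 1))"
      by (rule mult_left_mono) simp
    then show ?thesis by (simp add: abs_mult mult_ac)
  qed
  have B'': "\<bar>\<alpha> l * geg'' a l t\<bar> \<le> (1 + 2 * a)\<^sup>2 * (\<bar>\<alpha> l\<bar> * (real l ^ 4 * geg a l 1))" if "\<bar>t\<bar> \<le> 1" for l t
  proof -
    have "\<bar>geg'' a l t\<bar> \<le> (1 + 2 * a)\<^sup>2 * (real l ^ 4 * geg a l 1)"
      using gegenbauer_deriv_bounds(2)[OF a that, of l] gegenbauer_deriv_le(2)[OF a, of l] by linarith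
    then have "\<bar>\<alpha> l\<bar> * \<bar>geg'' a l t\<bar> \<le> \<bar>\<alpha> l\<bar> * ((1 + 2 * a)\<^sup>2 * (real l ^ 4 * geg a l 1))"
      by (rule mult_left_mono) simp
    then show ?thesis by (simp add: abs_mult mult_ac)
  qed
  have sm': "summable (\<lambda>l. \<alpha> l * geg' a l t)" if "\<bar>t\<bar> \<le> 1" for t
    by (rule summable_comparison_test'[OF summable_mult[OF sm]]) (use B'[OF that] in auto)
  have sm'': "summable (\<lambda>l. \<alpha> l * geg'' a l t)" if "\<bar>t\<bar> \<le> 1" for t
    by (rule summable_comparison_test'[OF summable_mult[OF sm]]) (use B''[OF that] in auto)
  have sm0: "summable (\<lambda>l. \<alpha> l * geg a l t)" if "\<bar>t\<bar> \<le> 1" for t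
    using adm unfolding admissible_def
    by (rule summable_comparison_test'[of _ 0]) (use gegenbauer_abs_le[OF a that] in \<open>auto simp: abs_mult intro!: mult_left_mono\<close>)
  show "(zonal a \<alpha> has_field_derivative (\<Sum>l. \<alpha> l * geg' a l t)) (at t)"
    unfolding zonal_def[abs_def]
    by (rule termwise_deriv[where B = "\<lambda>l. (1 + 2 * a) * (\<bar>\<alpha> l\<bar> * (real l ^ 4 * geg a l 1))"])
       (use B' sm0 t sm in \<open>auto intro!: summable_mult derivative_eq_intros\<close>)
  show "((\<lambda>t. \<Sum>l. \<alpha> l * geg' a l t) has_field_derivative (\<Sum>l. \<alpha> l * geg'' a l t)) (at t)"
    by (rule termwise_deriv[where B = "\<lambda>l. (1 + 2 * a)\<^sup>2 * (\<bar>\<alpha> l\<bar> * (real l ^ 4 * geg a l 1))"])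
       (use B'' sm' t sm in \<open>auto intro!: summable_mult derivative_eq_intros\<close>)
  have t1: "\<bar>t\<bar> \<le> 1" using t by simp
  have "(\<lambda>l. (1 - t\<^sup>2) * (\<alpha> l * geg'' a l t) - (2 * a + 1) * t * (\<alpha> l * geg' a l t)) sums
      ((1 - t\<^sup>2) * (\<Sum>l. \<alpha> l * geg'' a l t) - (2 * a + 1) * t * (\<Sum>l. \<alpha> l * geg' a l t))"
    by (intro sums_diff sums_mult summable_sums sm' sm'' t1)
  moreover have "(1 - t\<^sup>2) * (\<alpha> l * geg'' a l t) - (2 * a + 1) * t * (\<alpha> l * geg' a l t) =
      - (real l * (real l + 2 * a) * \<alpha> l * geg a l t)" for l
  proof -
    have "(1 - t\<^sup>2) * (\<alpha> l * geg'' a l t) - (2 * a + 1) * t * (\<alpha> l * geg' a l t) =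
        \<alpha> l * ((1 - t\<^sup>2) * geg'' a l t - (2 * a + 1) * t * geg' a l t)"
      by (simp only: right_diff_distrib mult_ac)
    then show ?thesis unfolding gegenbauer_ode by simp
  qed
  ultimately have "(\<lambda>l. - (real l * (real l + 2 * a) * \<alpha> l * geg a l t)) sums
      ((1 - t\<^sup>2) * (\<Sum>l. \<alpha> l * geg'' a l t) - (2 * a + 1) * t * (\<Sum>l. \<alpha> l * geg' a l t))"
    by simp
  from sums_minus[OF this] show "(1 - t\<^sup>2) * (\<Sum>l. \<alpha> l * geg'' a l t) - (2 * a + 1) * t * (\<Sum>l. \<alpha> l * geg' a l t) =
      - zonal a (\<lambda>l. real l * (real l + 2 * a) * \<alpha> l) t"
    unfolding zonal_def by (simp add: sums_iff)
qed

text \<open>Identifies the exceptional points, so that a function described away from the poles is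
  described on the whole sphere up to two constants.\<close>

lemma unit_sphere_pole:
  assumes x: "x \<in> unit_sphere n" and s: "\<bar>x 1\<bar> = 1"
  shows "x = axis_point n (x 1)"
proof (rule extensionalityI[of _ "{1..n+1}"])
  show "x \<in> extensional {1..n+1}" "axis_point n (x 1) \<in> extensional {1..n+1}"
    using x by (auto simp: unit_sphere_def axis_point_def PiE_iff)
  fix i assume i: "i \<in> {1..n+1}"
  have "(\<Sum>i\<in>{1..n+1}. (x i)\<^sup>2) = 1"
    using x by (simp add: unit_sphere_def L2_set_def del: sum.cl_ivl_Suc)
  moreover have "(x 1)\<^sup>2 = 1" using s by (metis one_power2 power2_abs)
  ultimately have "(\<Sum>i\<in>{2..n+1}. (x i)\<^sup>2) = 0"
    unfolding sum_split_first by simp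
  then have "\<forall>i\<in>{2..n+1}. (x i)\<^sup>2 = 0"
    by (subst (asm) sum_nonneg_eq_0_iff) auto
  then show "x i = axis_point n (x 1) i"
    using i by (cases "i = 1") (auto simp: axis_point_def)
qed

section \<open>The energy of a wavelet\<close>

context
  fixes n m :: nat
  assumes n: "n \<ge> 2"
begin

definition energy_poly :: "real poly" where
  "energy_poly = [:0, real n - 1, 1:] * norm_poly n m"

definition eigen_coeff :: "real \<Rightarrow> nat \<Rightarrow> real" where
  "eigen_coeff \<rho> l = real l * (real l + 2 * ((real n - 1) / 2)) * wavelet_coeff n m \<rho> l"

lemma wavelet_coeff_power_summable:
  assumes \<rho>: "\<rho> > 0"
  shows "summable (\<lambda>l. \<bar>wavelet_coeff n m \<rho> l\<bar> * (real l ^ k * geg ((real n - 1) / 2) l 1))"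
proof -
  let ?a = "(real n - 1) / 2"
  have "summable (\<lambda>l. \<rho> ^ m * (real l ^ (m + k) * ((real l + ?a) / ?a * geg ?a l 1) * exp (- \<rho>) ^ l))"
    by (intro summable_mult kernel_coeff_summable) (use n \<rho> in auto)
  moreover have "(\<lambda>l. \<bar>wavelet_coeff n m \<rho> l\<bar> * (real l ^ k * geg ?a l 1)) =
      (\<lambda>l. \<rho> ^ m * (real l ^ (m + k) * ((real l + ?a) / ?a * geg ?a l 1) * exp (- \<rho>) ^ l))"
    using n \<rho> by (auto simp: wavelet_coeff_def fun_eq_iff abs_mult power_mult_distrib power_add exp_of_nat_mult[symmetric] mult_ac)
  ultimately show ?thesis by simp
qed

lemma eigen_admissible:
  assumes \<rho>: "\<rho> > 0"
  shows "admissible ((real n - 1) / 2) (eigen_coeff \<rho>)"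
proof -
  let ?a = "(real n - 1) / 2" and ?w = "wavelet_coeff n m \<rho>"
  have "summable (\<lambda>l. \<bar>?w l\<bar> * (real l ^ 2 * geg ?a l 1) + 2 * ?a * (\<bar>?w l\<bar> * (real l ^ 1 * geg ?a l 1)))"
    by (intro summable_add summable_mult wavelet_coeff_power_summable \<rho>)
  moreover have "\<bar>?w l\<bar> * (real l ^ 2 * geg ?a l 1) + 2 * ?a * (\<bar>?w l\<bar> * (real l ^ 1 * geg ?a l 1)) =
      \<bar>eigen_coeff \<rho> l\<bar> * geg ?a l 1" for l
  proof -
    have "\<bar>eigen_coeff \<rho> l\<bar> = real l * (real l + 2 * ?a) * \<bar>?w l\<bar>"
      using n by (simp add: eigen_coeff_def abs_mult)
    then show ?thesis by (simp only:) (simp add: power2_eq_square algebra_simps)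
  qed
  ultimately show ?thesis unfolding admissible_def by simp
qed

lemma laplace_beltrami_wavelet:
  assumes \<rho>: "\<rho> > 0" and x: "x \<in> unit_sphere n" "\<bar>x 1\<bar> < 1"
  shows "laplace_beltrami n (poisson_wavelet n m \<rho>) x = - (1 / sphere_area n * zonal ((real n - 1) / 2) (eigen_coeff \<rho>) (x 1))"
proof -
  let ?a = "(real n - 1) / 2" and ?w = "wavelet_coeff n m \<rho>" and ?S = "sphere_area n"
  have a: "?a > 0" using n by simp
  note derivs = zonal_derivs[OF a wavelet_coeff_power_summable[OF \<rho>] wavelet_admissible[OF n \<rho>]]
  have "laplace_beltrami n (poisson_wavelet n m \<rho>) x =
      (1 - (x 1)\<^sup>2) * (1 / ?S * (\<Sum>l. ?w l * geg'' ?a l (x 1))) - real n * x 1 * (1 / ?S * (\<Sum>l. ?w l * geg' ?a l (x 1)))"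
  proof (rule laplace_beltrami_zonal[where F = "\<lambda>t. 1 / ?S * zonal ?a ?w t"])
    show "((\<lambda>t. 1 / ?S * zonal ?a ?w t) has_field_derivative 1 / ?S * (\<Sum>l. ?w l * geg' ?a l t)) (at t)" if "\<bar>t\<bar> < 1" for t
      by (intro DERIV_cmult derivs that)
    show "((\<lambda>t. 1 / ?S * (\<Sum>l. ?w l * geg' ?a l t)) has_field_derivative 1 / ?S * (\<Sum>l. ?w l * geg'' ?a l t)) (at t)" if "\<bar>t\<bar> < 1" for t
      by (intro DERIV_cmult derivs that)
  qed (use poisson_wavelet_eq_zonal[OF n \<rho>] x in auto)
  also have "\<dots> = 1 / ?S * ((1 - (x 1)\<^sup>2) * (\<Sum>l. ?w l * geg'' ?a l (x 1)) - (2 * ?a + 1) * x 1 * (\<Sum>l. ?w l * geg' ?a l (x 1)))"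
  proof -
    have e: "2 * ?a + 1 = real n" by (simp add: field_simps)
    show ?thesis unfolding e by (simp only: right_diff_distrib mult_ac)
  qed
  also have "\<dots> = - (1 / ?S * zonal ?a (eigen_coeff \<rho>) (x 1))"
    unfolding derivs(3)[OF x(2)] eigen_coeff_def[abs_def] by simp
  finally show ?thesis .
qed

lemma wavelet_energy:
  assumes \<rho>: "\<rho> > 0"
  shows "(\<integral>x. laplace_beltrami n (poisson_wavelet n m \<rho>) x * poisson_wavelet n m \<rho> x \<partial>surface_measure n) =
     - (1 / sphere_area n * (\<rho> ^ (2 * m) * power_sum energy_poly (exp (- 2 * \<rho>))))"
proof -
  interpret ultraspherical "surface_measure n" "\<lambda>x. x 1" "(real n - 1) / 2"
    by (rule ultraspherical_surface[OF n])
  let ?a = "(real n - 1) / 2" and ?S = "sphere_area n" and ?x = "exp (- 2 * \<rho>)"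
  let ?w = "wavelet_coeff n m \<rho>" and ?L = "laplace_beltrami n (poisson_wavelet n m \<rho>)"
  let ?h = "\<lambda>x. - (1 / ?S * zonal ?a (eigen_coeff \<rho>) (x 1))" and ?g = "\<lambda>x. 1 / ?S * zonal ?a ?w (x 1)"
  have mass: "mass = ?S" by (simp add: mass_def sphere_area_eq)
  have S: "?S > 0" using surface_mass_pos by (simp add: sphere_area_eq)
  have adm: "admissible ?a ?w" by (rule wavelet_admissible[OF n \<rho>])
  have "(\<lambda>l. eigen_coeff \<rho> l * ?w l * sqnorm l) sums (\<integral>x. zonal ?a (eigen_coeff \<rho>) (x 1) * zonal ?a ?w (x 1) \<partial>surface_measure n)"
    by (rule integral_zonal_mult[OF eigen_admissible[OF \<rho>] adm])
  moreover have "eigen_coeff \<rho> l * ?w l * sqnorm l = mass * \<rho> ^ (2 * m) * (poly energy_poly (real l) * ?x ^ l)" for l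
  proof -
    let ?v = "(\<rho> * real l) ^ m * exp (- \<rho> * real l)"
    have v: "?v * ?v = \<rho> ^ (2 * m) * real l ^ (2 * m) * ?x ^ l"
    proof -
      have ex: "?x ^ l = exp (- \<rho> * real l) * exp (- \<rho> * real l)"
        by (simp add: exp_of_nat_mult[symmetric] exp_add[symmetric] mult_ac)
      show ?thesis
        unfolding ex mult_2[of m] power_add power_mult_distrib by (simp only: mult_ac)
    qed
    have "eigen_coeff \<rho> l * ?w l * sqnorm l =
        real l * (real l + 2 * ?a) * ((real l + ?a) / ?a * ?v) * (((real l + ?a) / ?a * sqnorm l) * ?v)"
      by (simp only: eigen_coeff_def wavelet_coeff_def mult_ac)
    also have "\<dots> = mass * (real l * (real l + 2 * ?a)) * ((real l + ?a) / ?a * geg ?a l 1) * (?v * ?v)"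
      unfolding weighted_sqnorm by (simp only: mult_ac)
    also have "\<dots> = mass * \<rho> ^ (2 * m) * (poly energy_poly (real l) * ?x ^ l)"
      unfolding v energy_poly_def norm_poly_def[OF n] poly_mult poly_dim_poly[OF n] poly_monom
      by (simp add: mult_ac add.commute)
    finally show ?thesis .
  qed
  ultimately have "(\<lambda>l. mass * \<rho> ^ (2 * m) * (poly energy_poly (real l) * ?x ^ l)) sums
      (\<integral>x. zonal ?a (eigen_coeff \<rho>) (x 1) * zonal ?a ?w (x 1) \<partial>surface_measure n)"
    by simp
  moreover have "(\<lambda>l. mass * \<rho> ^ (2 * m) * (poly energy_poly (real l) * ?x ^ l)) sums (mass * \<rho> ^ (2 * m) * power_sum energy_poly ?x)"
    by (intro sums_mult power_sum_sums) (use \<rho> in simp)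
  ultimately have E: "(\<integral>x. zonal ?a (eigen_coeff \<rho>) (x 1) * zonal ?a ?w (x 1) \<partial>surface_measure n) =
      mass * \<rho> ^ (2 * m) * power_sum energy_poly ?x"
    by (rule sums_unique2)
  have wav: "poisson_wavelet n m \<rho> x = ?g x" if "x \<in> space (surface_measure n)" for x
    using that by (intro poisson_wavelet_eq_zonal[OF n \<rho>]) (simp add: space_surface_measure)
  \<comment> \<open>Changing the integrand almost everywhere requires measurability of
    \<open>?L\<close> itself. Its values at the two poles enter as constants that need not be
    computed.\<close>
  have Lm: "?L \<in> borel_measurable (surface_measure n)"
  proof (rule measurable_cong[THEN iffD2])
    show "(\<lambda>x. if x 1 = 1 then ?L (axis_point n 1) else if x 1 = -1 then ?L (axis_point n (-1)) else ?h x)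
        \<in> borel_measurable (surface_measure n)"
      by measurable
    fix x assume "x \<in> space (surface_measure n)"
    then have x: "x \<in> unit_sphere n" by (simp add: space_surface_measure)
    then have "\<bar>x 1\<bar> \<le> 1" by (intro component_abs_le_1) auto
    then consider "x 1 = 1" | "x 1 = -1" | "\<bar>x 1\<bar> < 1" by linarith
    then show "?L x = (if x 1 = 1 then ?L (axis_point n 1) else if x 1 = -1 then ?L (axis_point n (-1)) else ?h x)"
    proof cases
      case 1
      then have "x = axis_point n 1" using unit_sphere_pole[OF x] by simp
      then show ?thesis using 1 by simp
    next
      case 2
      then have "x = axis_point n (-1)" using unit_sphere_pole[OF x] by simp
      then show ?thesis using 2 by simp
    next
      case 3
      then have "x 1 \<noteq> 1" "x 1 \<noteq> -1" by auto
      then show ?thesis using laplace_beltrami_wavelet[OF \<rho> x 3] by simp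
    qed
  qed
  have gm: "poisson_wavelet n m \<rho> \<in> borel_measurable (surface_measure n)"
    by (rule measurable_cong[THEN iffD2, OF wav]) measurable
  have "(\<integral>x. ?L x * poisson_wavelet n m \<rho> x \<partial>surface_measure n) = (\<integral>x. ?h x * ?g x \<partial>surface_measure n)"
  proof (rule integral_cong_AE)
    have "AE x in surface_measure n. \<bar>x 1\<bar> < 1" using n by (intro AE_not_pole) auto
    then show "AE x in surface_measure n. ?L x * poisson_wavelet n m \<rho> x = ?h x * ?g x"
      using AE_space
    proof eventually_elim
      case (elim x)
      then show ?case
        using wav[of x] laplace_beltrami_wavelet[OF \<rho>, of x] elim(1) by (simp only: space_surface_measure)
    qed
  qed (use Lm gm in measurable)
  also have "\<dots> = (\<integral>x. - (1 / ?S\<^sup>2) * (zonal ?a (eigen_coeff \<rho>) (x 1) * zonal ?a ?w (x 1)) \<partial>surface_measure n)"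
    by (rule Bochner_Integration.integral_cong) (simp_all add: power2_eq_square)
  also have "\<dots> = - (1 / ?S\<^sup>2) * (mass * \<rho> ^ (2 * m) * power_sum energy_poly ?x)"
    unfolding E[symmetric] by (rule integral_mult_right_zero)
  finally show ?thesis
    using S by (simp add: mass power2_eq_square)
qed

end

section \<open>The limit of the uncertainty product\<close>

text \<open>The product of the limits of \<rho>^2 var_M, namely (2 m + n + 1) (2 m + n) / 4, and of
  var_S / \<rho>^2, which is the remaining quotient.\<close>

definition limit_sq :: "nat \<Rightarrow> nat \<Rightarrow> real" where
  "limit_sq n m = (2 * real m + real n + 1) * (2 * real m + real n) * (2 * real m + (real n - 1) * (real n - 2)) /
     (4 * (2 * real m + real n - 1) * (2 * real m + real n - 2))"

context
  fixes n m :: nat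
  assumes n: "n \<ge> 2" and m: "m \<ge> 1"
begin

text \<open>The centre has only its first component, so its norm is an absolute value, which the
  square in \<open>var_S\<close> absorbs; the common factor \<open>K\<close> cancels in both
  quotients.\<close>

lemma variances:
  assumes \<rho>: "\<rho> > 0"
  shows "var_S n (poisson_wavelet n m \<rho>) =
      (power_sum (norm_poly n m) (exp (- 2 * \<rho>)) / (power_sum (norm_poly n m) (exp (- 2 * \<rho>)) - defect n m \<rho>))\<^sup>2 - 1"
    "var_M n (poisson_wavelet n m \<rho>) =
      power_sum (energy_poly n m) (exp (- 2 * \<rho>)) / power_sum (norm_poly n m) (exp (- 2 * \<rho>))"
proof -
  let ?g = "poisson_wavelet n m \<rho>" and ?S = "sphere_area n"
  let ?N = "power_sum (norm_poly n m) (exp (- 2 * \<rho>))"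
  define K where "K = 1 / ?S * \<rho> ^ (2 * m)"
  have S: "?S > 0" using surface_mass_pos by (simp add: sphere_area_eq)
  have K: "K > 0" using S \<rho> by (simp add: K_def)
  have sq: "\<bar>?g x\<bar>\<^sup>2 = 1 / ?S\<^sup>2 * (wavelet_fun n m \<rho> (x 1))\<^sup>2" if "x \<in> space (surface_measure n)" for x
    using that poisson_wavelet_eq_zonal[OF n \<rho>, of x m]
    by (simp add: space_surface_measure wavelet_fun_def[OF n] power_divide)
  have A: "(\<integral>x. \<bar>?g x\<bar>\<^sup>2 \<partial>surface_measure n) = K * ?N"
  proof -
    have "(\<integral>x. \<bar>?g x\<bar>\<^sup>2 \<partial>surface_measure n) = (\<integral>x. 1 / ?S\<^sup>2 * (wavelet_fun n m \<rho> (x 1))\<^sup>2 \<partial>surface_measure n)"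
      by (rule Bochner_Integration.integral_cong[OF refl sq])
    also have "\<dots> = 1 / ?S\<^sup>2 * (\<integral>x. (wavelet_fun n m \<rho> (x 1))\<^sup>2 \<partial>surface_measure n)"
      by (rule integral_mult_right_zero)
    also have "\<dots> = K * ?N"
      unfolding wavelet_norm[OF n \<rho>] K_def using S by (simp add: power2_eq_square)
    finally show ?thesis .
  qed
  have comp: "(\<integral>x. x i * \<bar>?g x\<bar>\<^sup>2 \<partial>surface_measure n) = 1 / ?S\<^sup>2 * (\<integral>x. x i * (wavelet_fun n m \<rho> (x 1))\<^sup>2 \<partial>surface_measure n)" for i
  proof -
    have "(\<integral>x. x i * \<bar>?g x\<bar>\<^sup>2 \<partial>surface_measure n) = (\<integral>x. 1 / ?S\<^sup>2 * (x i * (wavelet_fun n m \<rho> (x 1))\<^sup>2) \<partial>surface_measure n)"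
      by (rule Bochner_Integration.integral_cong[OF refl]) (simp only: sq mult.left_commute)
    also have "\<dots> = 1 / ?S\<^sup>2 * (\<integral>x. x i * (wavelet_fun n m \<rho> (x 1))\<^sup>2 \<partial>surface_measure n)"
      by (rule integral_mult_right_zero)
    finally show ?thesis .
  qed
  have B1: "(\<integral>x. x 1 * \<bar>?g x\<bar>\<^sup>2 \<partial>surface_measure n) = K * (?N - defect n m \<rho>)"
  proof -
    have "(\<integral>x. x 1 * (wavelet_fun n m \<rho> (x 1))\<^sup>2 \<partial>surface_measure n) = ?S * (\<rho> ^ (2 * m) * (?N - defect n m \<rho>))"
      using wavelet_defect[OF n \<rho>, of m] unfolding wavelet_norm[OF n \<rho>] by (simp add: algebra_simps)
    then show ?thesis
      unfolding comp K_def using S by (simp add: power2_eq_square)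
  qed
  have Bi: "(\<integral>x. x i * \<bar>?g x\<bar>\<^sup>2 \<partial>surface_measure n) = 0" if "i \<in> {2..n+1}" for i
    using integral_component_zonal_square[OF n that wavelet_admissible[OF n \<rho>, of m]]
    unfolding comp wavelet_fun_def[OF n] by simp
  have B: "L2_set (\<lambda>i. \<integral>x. x i * \<bar>?g x\<bar>\<^sup>2 \<partial>surface_measure n) {1..n+1} = \<bar>K * (?N - defect n m \<rho>)\<bar>"
    unfolding L2_set_def sum_split_first B1 using Bi by simp
  show "var_S n ?g = (?N / (?N - defect n m \<rho>))\<^sup>2 - 1"
    unfolding var_S_def A B using K by (simp add: power_divide power_mult_distrib)
  show "var_M n ?g = power_sum (energy_poly n m) (exp (- 2 * \<rho>)) / ?N"
  proof -
    have "1 / ?S * (\<rho> ^ (2 * m) * power_sum (energy_poly n m) (exp (- 2 * \<rho>))) =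
        K * power_sum (energy_poly n m) (exp (- 2 * \<rho>))"
      by (simp only: K_def mult.assoc)
    then show ?thesis
      unfolding var_M_def A wavelet_energy[OF n \<rho>] using K by simp
  qed
qed

lemma norm_poly_bounds:
  "degree (norm_poly n m) \<le> n - 1 + 2 * m" "coeff (norm_poly n m) (n - 1 + 2 * m) = 2 / fact (n - 1)"
proof -
  have mono: "degree (monom 1 (2 * m) :: real poly) \<le> 2 * m" by (rule degree_monom_le)
  show "degree (norm_poly n m) \<le> n - 1 + 2 * m"
    unfolding norm_poly_def[OF n] by (rule degree_mult_bounds[OF degree_dim_poly[OF n] mono])
  show "coeff (norm_poly n m) (n - 1 + 2 * m) = 2 / fact (n - 1)"
    unfolding norm_poly_def[OF n] coeff_mult_degree_bounds[OF degree_dim_poly[OF n] mono] coeff_dim_poly[OF n]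
    by simp
qed

lemma norm_poly_asymptotics:
  "((\<lambda>\<rho>. \<rho> ^ (n + 2 * m) * power_sum (norm_poly n m) (exp (- 2 * \<rho>))) \<longlongrightarrow>
     2 / fact (n - 1) * fact (n - 1 + 2 * m) / 2 ^ (n + 2 * m)) (at_right 0)"
proof -
  have "n - 1 + 2 * m + 1 = n + 2 * m" using n by simp
  then show ?thesis
    using power_sum_asymptotics[OF norm_poly_bounds(1)] norm_poly_bounds(2) by (simp only:)
qed

lemma energy_poly_asymptotics:
  "((\<lambda>\<rho>. \<rho> ^ (n + 2 * m + 2) * power_sum (energy_poly n m) (exp (- 2 * \<rho>))) \<longlongrightarrow>
     2 / fact (n - 1) * fact (n + 1 + 2 * m) / 2 ^ (n + 2 * m + 2)) (at_right 0)"
proof -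
  have e: "n + 1 + 2 * m = 2 + (n - 1 + 2 * m)" using n by simp
  have deg: "degree (energy_poly n m) \<le> n + 1 + 2 * m"
    unfolding energy_poly_def[OF n] e by (rule degree_mult_bounds[OF _ norm_poly_bounds(1)]) simp
  have "coeff (energy_poly n m) (n + 1 + 2 * m) = 2 / fact (n - 1)"
  proof -
    have "degree [:0, real n - 1, 1:] \<le> 2" "coeff [:0, real n - 1, 1:] 2 = 1"
      by (simp_all add: numeral_2_eq_2)
    then show ?thesis
      unfolding energy_poly_def[OF n] e
      by (simp only: coeff_mult_degree_bounds[OF _ norm_poly_bounds(1)] norm_poly_bounds(2) mult_1_left)
  qed
  moreover have "n + 1 + 2 * m + 1 = n + 2 * m + 2" by simp
  ultimately show ?thesis
    using power_sum_asymptotics[OF deg] by (simp only:)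
qed

text \<open>The degrees of the three power sums increase by one from term to term, and each factor 1
  - exp (-\<rho>) makes up for one power of \<rho>; all three therefore contribute to the
  limit.\<close>

lemma defect_asymptotics:
  "((\<lambda>\<rho>. \<rho> ^ (n + 2 * m - 2) * defect n m \<rho>) \<longlongrightarrow>
     1 / fact (n - 1) * (real m ^ 2 * fact (n + 2 * m - 3) / 2 ^ (n + 2 * m - 2)
        - 2 * real m * fact (n + 2 * m - 2) / 2 ^ (n + 2 * m - 1)
        + fact (n + 2 * m - 1) / 2 ^ (n + 2 * m))) (at_right 0)"
proof -
  obtain j where j: "m = Suc j" using m by (cases m) auto
  obtain k where k: "n = Suc (Suc k)" using n by (metis Suc_le_D numeral_2_eq_2 Suc_le_mono)
  let ?P = "diff_power m" and ?Q = "shift_power m" and ?b = "step_poly n"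
  let ?e = "k + 2 * j + 1"
  have dP: "degree ?P \<le> j" and cP: "coeff ?P j = real m"
    unfolding j by (rule degree_diff_power, rule coeff_diff_power)
  have dQ: "degree ?Q \<le> Suc j" and cQ: "coeff ?Q (Suc j) = 1"
    using degree_shift_power[of m] coeff_shift_power_top[of m] by (simp_all add: j)
  have db: "degree ?b \<le> k + 1" and cb: "coeff ?b (k + 1) = 1 / fact (n - 1)"
    using degree_step_poly[OF n] coeff_step_poly[OF n] by (simp_all add: k)
  have e1: "(k + 1) + (j + j) = ?e" and e2: "(k + 1) + (j + Suc j) = ?e + 1" and e3: "(k + 1) + (Suc j + Suc j) = ?e + 2"
    by simp_all
  have 1: "degree (?b * (?P * ?P)) \<le> ?e" "coeff (?b * (?P * ?P)) ?e = 1 / fact (n - 1) * real m ^ 2"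
    using degree_mult_bounds[OF db degree_mult_bounds[OF dP dP]] coeff_mult_degree_bounds[OF db degree_mult_bounds[OF dP dP]]
    unfolding coeff_mult_degree_bounds[OF dP dP] e1 cb cP power2_eq_square by blast+
  have 2: "degree (?b * (?P * ?Q)) \<le> ?e + 1" "coeff (?b * (?P * ?Q)) (?e + 1) = 1 / fact (n - 1) * real m"
    using degree_mult_bounds[OF db degree_mult_bounds[OF dP dQ]] coeff_mult_degree_bounds[OF db degree_mult_bounds[OF dP dQ]]
    unfolding coeff_mult_degree_bounds[OF dP dQ] e2 cb cP cQ mult_1_right by blast+
  have 3: "degree (?b * (?Q * ?Q)) \<le> ?e + 2" "coeff (?b * (?Q * ?Q)) (?e + 2) = 1 / fact (n - 1)"
    using degree_mult_bounds[OF db degree_mult_bounds[OF dQ dQ]] coeff_mult_degree_bounds[OF db degree_mult_bounds[OF dQ dQ]]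
    unfolding coeff_mult_degree_bounds[OF dQ dQ] e3 cb cQ mult_1_right by blast+
  have eps: "((\<lambda>\<rho>::real. (1 - exp (- \<rho>)) / \<rho>) \<longlongrightarrow> 1) (at_right 0)" by real_asymp
  let ?x = "\<lambda>\<rho>::real. exp (- 2 * \<rho>)"
  have lim: "((\<lambda>\<rho>. \<rho> ^ (?e + 1) * power_sum (?b * (?P * ?P)) (?x \<rho>)
      - 2 * ((1 - exp (- \<rho>)) / \<rho>) * (\<rho> ^ (?e + 1 + 1) * power_sum (?b * (?P * ?Q)) (?x \<rho>))
      + ((1 - exp (- \<rho>)) / \<rho>)\<^sup>2 * (\<rho> ^ (?e + 2 + 1) * power_sum (?b * (?Q * ?Q)) (?x \<rho>)))
      \<longlongrightarrow> 1 / fact (n - 1) * real m ^ 2 * fact ?e / 2 ^ (?e + 1)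
        - 2 * 1 * (1 / fact (n - 1) * real m * fact (?e + 1) / 2 ^ (?e + 1 + 1))
        + 1\<^sup>2 * (1 / fact (n - 1) * fact (?e + 2) / 2 ^ (?e + 2 + 1))) (at_right 0)"
    using power_sum_asymptotics[OF 1(1)] power_sum_asymptotics[OF 2(1)] power_sum_asymptotics[OF 3(1)] eps
    unfolding 1(2) 2(2) 3(2) by (intro tendsto_add tendsto_diff tendsto_mult tendsto_power tendsto_const)
  have ev: "eventually (\<lambda>\<rho>::real. \<rho> ^ (?e + 1) * power_sum (?b * (?P * ?P)) (?x \<rho>)
      - 2 * ((1 - exp (- \<rho>)) / \<rho>) * (\<rho> ^ (?e + 1 + 1) * power_sum (?b * (?P * ?Q)) (?x \<rho>))
      + ((1 - exp (- \<rho>)) / \<rho>)\<^sup>2 * (\<rho> ^ (?e + 2 + 1) * power_sum (?b * (?Q * ?Q)) (?x \<rho>))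
      = \<rho> ^ (n + 2 * m - 2) * defect n m \<rho>) (at_right 0)"
    using eventually_at_right_less[of 0]
  proof eventually_elim
    case (elim \<rho>)
    have e: "n + 2 * m - 2 = ?e + 1" by (simp add: j k)
    have "1 - exp (- \<rho>) = (1 - exp (- \<rho>)) / \<rho> * \<rho>" using elim by simp
    \<comment> \<open>With the quotient hidden in \<open>z\<close>, the claim is a polynomial
      identity in \<rho> and \<open>z\<close>.\<close>
    then obtain z where z: "1 - exp (- \<rho>) = z * \<rho>" "(1 - exp (- \<rho>)) / \<rho> = z" by metis
    show ?case
      unfolding defect_def[OF n] e z
      by (simp add: power_add power2_eq_square algebra_simps)
  qed
  have lim': "((\<lambda>\<rho>. \<rho> ^ (n + 2 * m - 2) * defect n m \<rho>) \<longlongrightarrow> 1 / fact (n - 1) * real m ^ 2 * fact ?e / 2 ^ (?e + 1)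
        - 2 * 1 * (1 / fact (n - 1) * real m * fact (?e + 1) / 2 ^ (?e + 1 + 1))
        + 1\<^sup>2 * (1 / fact (n - 1) * fact (?e + 2) / 2 ^ (?e + 2 + 1))) (at_right 0)"
    using lim tendsto_cong[OF ev] by simp
  have e4: "n + 2 * m - 3 = ?e" "n + 2 * m - 2 = ?e + 1" "n + 2 * m - 1 = ?e + 2" "n + 2 * m = ?e + 3"
    by (simp_all add: j k)
  have e5: "?e + 1 + 1 = ?e + 2" "?e + 2 + 1 = ?e + 3" by simp_all
  have eq: "1 / F * (M\<^sup>2 * A / p - 2 * M * B / q + C / s) = 1 / F * M\<^sup>2 * A / p - 2 * 1 * (1 / F * M * B / q) + 1\<^sup>2 * (1 / F * C / s)"
    for F M A B C p q s :: real
    by (simp add: right_diff_distrib distrib_left)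
  show ?thesis
    using lim' unfolding e4(1-3) unfolding e4(4) e5 eq .
qed

lemma limit_constant:
  fixes \<nu> \<delta> :: real
  defines "\<nu> \<equiv> 2 / fact (n - 1) * fact (n - 1 + 2 * m) / 2 ^ (n + 2 * m)"
    and "\<delta> \<equiv> 1 / fact (n - 1) * (real m ^ 2 * fact (n + 2 * m - 3) / 2 ^ (n + 2 * m - 2)
        - 2 * real m * fact (n + 2 * m - 2) / 2 ^ (n + 2 * m - 1)
        + fact (n + 2 * m - 1) / 2 ^ (n + 2 * m))"
  shows "2 * \<delta> / \<nu> = (2 * real m + (real n - 1) * (real n - 2)) / ((2 * real m + real n - 1) * (2 * real m + real n - 2))"
    and "2 / fact (n - 1) * fact (n + 1 + 2 * m) / 2 ^ (n + 2 * m + 2) / \<nu> =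
      (2 * real m + real n + 1) * (2 * real m + real n) / 4"
    and "\<nu> \<noteq> 0"
proof -
  \<comment> \<open>The smallest argument of a factorial in these constants; n \<ge> 2 and m \<ge> 1
    make the natural subtraction exact, and all other factorials and powers of 2 reduce to those at
    \<open>e\<close>.\<close>
  define e where "e = n + 2 * m - 3"
  have e: "n + 2 * m = e + 3" using n m by (simp add: e_def)
  have re: "real e = real n + 2 * real m - 3"
    using e by linarith
  have idx: "n + 2 * m - 3 = e" "n + 2 * m - 2 = e + 1" "n + 2 * m - 1 = e + 2" "n - 1 + 2 * m = e + 2" "n + 1 + 2 * m = e + 4" "n + 2 * m + 2 = e + 5"
    using e n by linarith+
  define f :: real where "f = fact e"
  define g :: real where "g = fact (n - 1)"
  define p :: real where "p = 2 ^ e"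
  have pos: "f > 0" "g > 0" "p > 0" by (simp_all add: f_def g_def p_def)
  have fe: "fact (e + 1) = (real e + 1) * f" "fact (e + 2) = (real e + 2) * ((real e + 1) * f)"
    "fact (e + 4) = (real e + 4) * ((real e + 3) * ((real e + 2) * ((real e + 1) * f)))"
    by (simp_all add: f_def numeral_eq_Suc algebra_simps)
  have pe: "(2::real) ^ (e + 1) = 2 * p" "(2::real) ^ (e + 2) = 4 * p" "(2::real) ^ (e + 3) = 8 * p" "(2::real) ^ (e + 5) = 32 * p"
    by (simp_all add: p_def power_add)
  have \<nu>: "\<nu> = (real e + 2) * (real e + 1) * f / (4 * g * p)"
    unfolding \<nu>_def idx unfolding e unfolding fe pe g_def[symmetric] using pos by (simp add: field_simps)
  show nz: "\<nu> \<noteq> 0" unfolding \<nu> using pos by (simp add: add_nonneg_eq_0_iff)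
  have \<delta>: "\<delta> = f / (8 * g * p) * (4 * (real m)\<^sup>2 - 4 * real m * (real e + 1) + (real e + 2) * (real e + 1))"
    unfolding \<delta>_def idx unfolding e unfolding fe pe g_def[symmetric] f_def[symmetric] using pos by (simp add: field_simps)
  have "2 * \<delta> / \<nu> = (4 * (real m)\<^sup>2 - 4 * real m * (real e + 1) + (real e + 2) * (real e + 1)) / ((real e + 2) * (real e + 1))"
    unfolding \<delta> \<nu> using pos by (simp add: divide_simps)
  \<comment> \<open>The terms with m^2 and m n cancel, so the numerator is only linear in m.\<close>
  also have "4 * (real m)\<^sup>2 - 4 * real m * (real e + 1) + (real e + 2) * (real e + 1) = 2 * real m + (real n - 1) * (real n - 2)"
    unfolding re by (simp add: power2_eq_square algebra_simps)
  also have "(real e + 2) * (real e + 1) = (2 * real m + real n - 1) * (2 * real m + real n - 2)"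
    unfolding re by (simp add: algebra_simps)
  finally show "2 * \<delta> / \<nu> = (2 * real m + (real n - 1) * (real n - 2)) / ((2 * real m + real n - 1) * (2 * real m + real n - 2))" .
  have "2 / fact (n - 1) * fact (n + 1 + 2 * m) / 2 ^ (n + 2 * m + 2) / \<nu> = (real e + 4) * (real e + 3) / 4"
    unfolding \<nu> idx fe pe g_def[symmetric] using pos by (simp add: divide_simps) (simp add: algebra_simps)
  also have "\<dots> = (2 * real m + real n + 1) * (2 * real m + real n) / 4"
    unfolding re by (simp add: algebra_simps)
  finally show "2 / fact (n - 1) * fact (n + 1 + 2 * m) / 2 ^ (n + 2 * m + 2) / \<nu> =
      (2 * real m + real n + 1) * (2 * real m + real n) / 4" .
qed

text \<open>Every sum is rescaled by its own power of \<rho> to have a finite limit. The powers left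
  over are \<rho>^2 in \<open>var_S\<close> and \<rho>^(-2) in \<open>var_M\<close>, and they cancel
  in the product.\<close>

lemma uncertainty_tendsto:
  "((\<lambda>\<rho>. uncertainty_product n (poisson_wavelet n m \<rho>)) \<longlongrightarrow> sqrt (limit_sq n m)) (at_right 0)"
proof -
  define N where "N \<rho> = power_sum (norm_poly n m) (exp (- 2 * \<rho>))" for \<rho>
  define E where "E \<rho> = power_sum (energy_poly n m) (exp (- 2 * \<rho>))" for \<rho>
  define D where "D \<rho> = defect n m \<rho>" for \<rho>
  define k where "k = n + 2 * m"
  define \<nu> where "\<nu> = 2 / fact (n - 1) * fact (n - 1 + 2 * m) / (2::real) ^ (n + 2 * m)"
  define \<epsilon> where "\<epsilon> = 2 / fact (n - 1) * fact (n + 1 + 2 * m) / (2::real) ^ (n + 2 * m + 2)"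
  define \<delta> where "\<delta> = 1 / fact (n - 1) * (real m ^ 2 * fact (n + 2 * m - 3) / 2 ^ (n + 2 * m - 2)
        - 2 * real m * fact (n + 2 * m - 2) / 2 ^ (n + 2 * m - 1)
        + fact (n + 2 * m - 1) / 2 ^ (n + 2 * m))"
  have k2: "k = k - 2 + 2" using n by (simp add: k_def)
  have N: "((\<lambda>\<rho>. \<rho> ^ k * N \<rho>) \<longlongrightarrow> \<nu>) (at_right 0)"
    unfolding N_def k_def \<nu>_def by (rule norm_poly_asymptotics)
  have E: "((\<lambda>\<rho>. \<rho> ^ (k + 2) * E \<rho>) \<longlongrightarrow> \<epsilon>) (at_right 0)"
    unfolding E_def k_def \<epsilon>_def by (rule energy_poly_asymptotics)
  have D: "((\<lambda>\<rho>. \<rho> ^ (k - 2) * D \<rho>) \<longlongrightarrow> \<delta>) (at_right 0)"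
    unfolding D_def k_def \<delta>_def by (rule defect_asymptotics)
  note const_eqs = limit_constant[folded \<nu>_def \<delta>_def \<epsilon>_def]
  \<comment> \<open>On the scale of the square norm the defect disappears, so 2 N - D and N - D may
    be replaced by 2 N and N in the limit.\<close>
  have D2: "((\<lambda>\<rho>. \<rho>\<^sup>2 * (\<rho> ^ (k - 2) * D \<rho>)) \<longlongrightarrow> 0\<^sup>2 * \<delta>) (at_right 0)"
    by (intro tendsto_mult tendsto_power tendsto_ident_at D)
  have ND: "((\<lambda>\<rho>. \<rho> ^ k * N \<rho> - \<rho>\<^sup>2 * (\<rho> ^ (k - 2) * D \<rho>)) \<longlongrightarrow> \<nu>) (at_right 0)"
    using tendsto_diff[OF N D2] by simp
  have limS: "((\<lambda>\<rho>. (\<rho> ^ (k - 2) * D \<rho>) * (2 * (\<rho> ^ k * N \<rho>) - \<rho>\<^sup>2 * (\<rho> ^ (k - 2) * D \<rho>)) /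
      (\<rho> ^ k * N \<rho> - \<rho>\<^sup>2 * (\<rho> ^ (k - 2) * D \<rho>))\<^sup>2) \<longlongrightarrow> \<delta> * (2 * \<nu> - 0\<^sup>2 * \<delta>) / \<nu>\<^sup>2) (at_right 0)"
    using const_eqs(3) by (intro tendsto_intros D N D2 ND) auto
  have limM: "((\<lambda>\<rho>. (\<rho> ^ (k + 2) * E \<rho>) / (\<rho> ^ k * N \<rho>)) \<longlongrightarrow> \<epsilon> / \<nu>) (at_right 0)"
    by (intro tendsto_divide E N const_eqs(3))
  have "((\<lambda>\<rho>. sqrt ((\<rho> ^ (k - 2) * D \<rho>) * (2 * (\<rho> ^ k * N \<rho>) - \<rho>\<^sup>2 * (\<rho> ^ (k - 2) * D \<rho>)) /
      (\<rho> ^ k * N \<rho> - \<rho>\<^sup>2 * (\<rho> ^ (k - 2) * D \<rho>))\<^sup>2) * sqrt ((\<rho> ^ (k + 2) * E \<rho>) / (\<rho> ^ k * N \<rho>)))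
      \<longlongrightarrow> sqrt (\<delta> * (2 * \<nu> - 0\<^sup>2 * \<delta>) / \<nu>\<^sup>2) * sqrt (\<epsilon> / \<nu>)) (at_right 0)"
    by (intro tendsto_mult tendsto_real_sqrt limS limM)
  moreover have "eventually (\<lambda>\<rho>. sqrt ((\<rho> ^ (k - 2) * D \<rho>) * (2 * (\<rho> ^ k * N \<rho>) - \<rho>\<^sup>2 * (\<rho> ^ (k - 2) * D \<rho>)) /
      (\<rho> ^ k * N \<rho> - \<rho>\<^sup>2 * (\<rho> ^ (k - 2) * D \<rho>))\<^sup>2) * sqrt ((\<rho> ^ (k + 2) * E \<rho>) / (\<rho> ^ k * N \<rho>))
      = uncertainty_product n (poisson_wavelet n m \<rho>)) (at_right 0)"
    using eventually_at_right_less[of 0] tendsto_imp_eventually_ne[OF ND const_eqs(3)]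
  proof eventually_elim
    case (elim \<rho>)
    then have \<rho>: "\<rho> > 0" by simp
    define r where "r = \<rho> ^ (k - 2)"
    have rk: "\<rho> ^ k = \<rho>\<^sup>2 * r" "\<rho> ^ (k + 2) = \<rho>\<^sup>2 * (\<rho>\<^sup>2 * r)"
    proof -
      have "\<rho> ^ k = \<rho> ^ (k - 2 + 2)" using k2 by (rule arg_cong)
      also have "\<dots> = \<rho>\<^sup>2 * r" unfolding r_def power_add by (rule mult.commute)
      finally show "\<rho> ^ k = \<rho>\<^sup>2 * r" .
      then show "\<rho> ^ (k + 2) = \<rho>\<^sup>2 * (\<rho>\<^sup>2 * r)"
        unfolding power_add by (simp only: mult.commute)
    qed
    have r: "r > 0" using \<rho> by (simp add: r_def)
    \<comment> \<open>The first moment is nonzero for small \<rho>, because its rescaling tends to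
      \<nu>, which is not 0; otherwise \<open>var_S\<close> would involve a division by
      zero.\<close>
    have ne: "N \<rho> - D \<rho> \<noteq> 0"
    proof
      assume "N \<rho> - D \<rho> = 0"
      then have "\<rho> ^ k * N \<rho> - \<rho>\<^sup>2 * (\<rho> ^ (k - 2) * D \<rho>) = 0"
        unfolding rk r_def[symmetric] by simp
      then show False using elim(2) by simp
    qed
    have vS: "var_S n (poisson_wavelet n m \<rho>) = \<rho>\<^sup>2 * ((r * D \<rho>) * (2 * (\<rho> ^ k * N \<rho>) - \<rho>\<^sup>2 * (r * D \<rho>)) /
      (\<rho> ^ k * N \<rho> - \<rho>\<^sup>2 * (r * D \<rho>))\<^sup>2)"
    proof -
      have 1: "(r * D \<rho>) * (2 * (\<rho> ^ k * N \<rho>) - \<rho>\<^sup>2 * (r * D \<rho>)) = (\<rho>\<^sup>2 * r\<^sup>2) * (D \<rho> * (2 * N \<rho> - D \<rho>))"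
        unfolding rk by (simp add: power2_eq_square algebra_simps)
      have 2: "(\<rho> ^ k * N \<rho> - \<rho>\<^sup>2 * (r * D \<rho>))\<^sup>2 = (\<rho>\<^sup>2 * r\<^sup>2) * (\<rho>\<^sup>2 * (N \<rho> - D \<rho>)\<^sup>2)"
        unfolding rk by (simp add: power2_eq_square algebra_simps)
      have "\<rho>\<^sup>2 * ((r * D \<rho>) * (2 * (\<rho> ^ k * N \<rho>) - \<rho>\<^sup>2 * (r * D \<rho>)) /
        (\<rho> ^ k * N \<rho> - \<rho>\<^sup>2 * (r * D \<rho>))\<^sup>2) = D \<rho> * (2 * N \<rho> - D \<rho>) / (N \<rho> - D \<rho>)\<^sup>2"
        unfolding 1 2 using \<rho> r by simp
      also have "\<dots> = (N \<rho> / (N \<rho> - D \<rho>))\<^sup>2 - 1"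
        using ne by (simp add: power_divide divide_simps) (simp add: power2_eq_square algebra_simps)
      finally show ?thesis
        using variances(1)[OF \<rho>] by (simp only: N_def D_def)
    qed
    have vM: "\<rho>\<^sup>2 * var_M n (poisson_wavelet n m \<rho>) = (\<rho> ^ (k + 2) * E \<rho>) / (\<rho> ^ k * N \<rho>)"
    proof -
      have "(\<rho> ^ (k + 2) * E \<rho>) / (\<rho> ^ k * N \<rho>) = \<rho>\<^sup>2 * (E \<rho> / N \<rho>)"
      proof -
        have "s * c * x / (c * y) = s * (x / y)" if "c \<noteq> 0" for s c x y :: real
          using that by simp
        moreover have "\<rho>\<^sup>2 * r \<noteq> 0" using \<rho> r by simp
        ultimately show ?thesis unfolding rk by blast
      qed
      then show ?thesis
        using variances(2)[OF \<rho>] by (simp only: N_def E_def)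
    qed
    show ?case
      unfolding uncertainty_product_def vM[symmetric] vS r_def[symmetric] real_sqrt_mult[of "\<rho>\<^sup>2"]
      using \<rho> by simp
  qed
  ultimately have "((\<lambda>\<rho>. uncertainty_product n (poisson_wavelet n m \<rho>)) \<longlongrightarrow>
      sqrt (\<delta> * (2 * \<nu> - 0\<^sup>2 * \<delta>) / \<nu>\<^sup>2) * sqrt (\<epsilon> / \<nu>)) (at_right 0)"
    by (rule Lim_transform_eventually)
  also have "sqrt (\<delta> * (2 * \<nu> - 0\<^sup>2 * \<delta>) / \<nu>\<^sup>2) * sqrt (\<epsilon> / \<nu>) = sqrt (limit_sq n m)"
  proof -
    have "\<delta> * (2 * \<nu> - 0\<^sup>2 * \<delta>) / \<nu>\<^sup>2 = 2 * \<delta> / \<nu>"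
      using const_eqs(3) by (simp add: power2_eq_square)
    then have "sqrt (\<delta> * (2 * \<nu> - 0\<^sup>2 * \<delta>) / \<nu>\<^sup>2) * sqrt (\<epsilon> / \<nu>) = sqrt (2 * \<delta> / \<nu> * (\<epsilon> / \<nu>))"
      by (simp only: real_sqrt_mult)
    also have "2 * \<delta> / \<nu> * (\<epsilon> / \<nu>) = limit_sq n m"
      unfolding const_eqs(1) const_eqs(2) limit_sq_def by (simp add: mult_ac)
    finally show ?thesis .
  qed
  finally show ?thesis .
qed

lemma limit_uncertainty_eq: "limit_uncertainty n m = sqrt (limit_sq n m)"
  unfolding limit_uncertainty_def by (intro tendsto_Lim uncertainty_tendsto) simp

end

section \<open>Minimisation over the order\<close>

text \<open>After the positive denominators are cleared, the excess is the product of the two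
  consecutive integers with a further factor (2 n - 3) k - n, which is nonnegative because k \<ge> n
  + 2.\<close>

lemma limit_sq_lower:
  assumes n: "n \<ge> 5" and m: "m \<ge> 1"
  shows "real n * (real n - 1) * (2 * real n - 1) / (4 * (2 * real n - 3)) \<le> limit_sq n m"
proof -
  let ?n = "real n"
  define k where "k = 2 * real m + ?n"
  have int: "(k - 2 * ?n + 1) * (k - 2 * ?n + 2) \<ge> 0"
  proof -
    \<comment> \<open>The product z (z + 1) is negative strictly between -1 and 0; integrality of z
      = k - 2 n + 1 rules this out.\<close>
    define z where "z = 2 * int m - int n + 1"
    have "z * (z + 1) \<ge> 0"
      by (cases "z \<ge> 0") (auto intro: mult_nonneg_nonneg mult_nonpos_nonpos)
    then have "real_of_int (z * (z + 1)) \<ge> 0" by linarith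
    then show ?thesis by (simp add: z_def k_def algebra_simps)
  qed
  have k: "k \<ge> ?n + 2" using m by (simp add: k_def)
  have n5: "?n \<ge> 5" using n by simp
  have "(2 * ?n - 3) * k \<ge> 1 * k" using n5 k by (intro mult_right_mono) auto
  then have lin: "(2 * ?n - 3) * k - ?n \<ge> 0" using k by linarith
  have "(2 * ?n - 3) * ((k + 1) * k * (k + (?n\<^sup>2 - 4 * ?n + 2))) - ?n * (?n - 1) * (2 * ?n - 1) * ((k - 1) * (k - 2)) =
      (k - 2 * ?n + 1) * (k - 2 * ?n + 2) * ((2 * ?n - 3) * k - ?n)"
    by (simp add: power2_eq_square algebra_simps)
  also have "\<dots> \<ge> 0" using int lin by simp
  finally have main: "?n * (?n - 1) * (2 * ?n - 1) * ((k - 1) * (k - 2)) \<le> (2 * ?n - 3) * ((k + 1) * k * (k + (?n\<^sup>2 - 4 * ?n + 2)))"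
    by simp
  have l: "limit_sq n m = (k + 1) * k * (k + (?n\<^sup>2 - 4 * ?n + 2)) / (4 * ((k - 1) * (k - 2)))"
    unfolding limit_sq_def k_def by (simp add: power2_eq_square algebra_simps)
  have pos: "(k - 1) * (k - 2) > 0" "2 * ?n - 3 > 0" using k n5 by auto
  have "u / (4 * q) \<le> w / (4 * p)" if "u * p \<le> q * w" "p > 0" "q > 0" for u w p q :: real
  proof -
    have "u / q \<le> w / p" using that by (simp add: field_simps)
    then have "u / q / 4 \<le> w / p / 4" by simp
    then show ?thesis by (simp add: mult.commute)
  qed
  from this[OF main pos] show ?thesis unfolding l .
qed

text \<open>The parity of n decides which of the two factors vanishes: k = 2 n - 2 for even n and k
  = 2 n - 1 for odd n. Both roots give the same value.\<close>

lemma limit_sq_optimal: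
  assumes n: "n \<ge> 5"
  shows "limit_sq n ((n - 1) div 2) = real n * (real n - 1) * (2 * real n - 1) / (4 * (2 * real n - 3))"
proof (cases "even n")
  case True
  then obtain j where j: "n = 2 * j" by (auto elim: evenE)
  have "(n - 1) div 2 = j - 1" using n j by auto
  then have m: "2 * real ((n - 1) div 2) = real n - 2" using n j by auto
  have n5: "real n \<ge> 5" using n by simp
  have cancel: "u * (2 * v) * (w * c) / (4 * q * (2 * c)) = w * v * u / (4 * q)" if "c \<noteq> 0" for u v w c q :: real
    using that by simp
  have "limit_sq n ((n - 1) div 2) =
      (2 * real n - 1) * (2 * (real n - 1)) * (real n * (real n - 2)) / (4 * (2 * real n - 3) * (2 * (real n - 2)))"
    unfolding limit_sq_def m by (simp add: algebra_simps)
  also have "\<dots> = real n * (real n - 1) * (2 * real n - 1) / (4 * (2 * real n - 3))"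
    by (rule cancel) (use n5 in simp)
  finally show ?thesis .
next
  case False
  then obtain j where j: "n = 2 * j + 1" by (auto elim: oddE)
  have "(n - 1) div 2 = j" using j by auto
  then have m: "2 * real ((n - 1) div 2) = real n - 1" using j by auto
  have n5: "real n \<ge> 5" using n by simp
  have cancel: "2 * w * u * (c * c) / (4 * (2 * c) * q) = w * c * u / (4 * q)" if "c \<noteq> 0" for u w c q :: real
    using that by simp
  have "limit_sq n ((n - 1) div 2) =
      2 * real n * (2 * real n - 1) * ((real n - 1) * (real n - 1)) / (4 * (2 * (real n - 1)) * (2 * real n - 3))"
    unfolding limit_sq_def m by (simp add: algebra_simps)
  also have "\<dots> = real n * (real n - 1) * (2 * real n - 1) / (4 * (2 * real n - 3))"
    by (rule cancel) (use n5 in simp)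
  finally show ?thesis .
qed

text \<open>Convergence is asserted on its own because \<open>Lim\<close> is meaningful only for an
  existing limit, and \<open>is_arg_min\<close> expresses that the infimum is attained.\<close>

theorem mainTheorem2:
  "(\<forall>n\<ge>5.
      (\<forall>m\<ge>1. \<exists>l. ((\<lambda>\<rho>. uncertainty_product n (poisson_wavelet n m \<rho>)) \<longlongrightarrow> l) (at_right 0)) \<and>
      (INF m\<in>{1..}. limit_uncertainty n m) =
        1/2 * sqrt (real n * (real n - 1) * (2 * real n - 1) / (2 * real n - 3)) \<and>
      is_arg_min (limit_uncertainty n) (\<lambda>m. m \<ge> 1) ((n - 1) div 2)) \<and>
   (\<lambda>n. (INF m\<in>{1..}. limit_uncertainty n m) / (real n / 2)) \<longlonglongrightarrow> 1"
proof -
  define v where "v n = 1/2 * sqrt (real n * (real n - 1) * (2 * real n - 1) / (2 * real n - 3))" for n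
  have v: "v n = sqrt (real n * (real n - 1) * (2 * real n - 1) / (4 * (2 * real n - 3)))" for n
  proof -
    have "u / (4 * q) = u / q / 4" for u q :: real by simp
    then have "sqrt (u / (4 * q)) = 1 / 2 * sqrt (u / q)" for u q :: real
      by (simp only: real_sqrt_divide[of _ 4] real_sqrt_four)
    then show ?thesis by (simp only: v_def)
  qed
  have lower: "v n \<le> limit_uncertainty n m" if "n \<ge> 5" "m \<ge> 1" for n m
    using limit_sq_lower[OF that] that by (simp add: limit_uncertainty_eq v)
  have opt: "limit_uncertainty n ((n - 1) div 2) = v n" if "n \<ge> 5" for n
  proof -
    have "n \<ge> 2" "(n - 1) div 2 \<ge> 1" using that by auto
    then show ?thesis using limit_sq_optimal[OF that] by (simp only: limit_uncertainty_eq v)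
  qed
  have inf: "(INF m\<in>{1..}. limit_uncertainty n m) = v n" if n: "n \<ge> 5" for n
  proof (rule cInf_eq_minimum)
    have "(n - 1) div 2 \<in> {1..}" using n by auto
    then show "v n \<in> limit_uncertainty n ` {1..}" using opt[OF n] by (metis imageI)
  qed (use lower n in auto)
  have arg: "is_arg_min (limit_uncertainty n) (\<lambda>m. m \<ge> 1) ((n - 1) div 2)" if n: "n \<ge> 5" for n
    unfolding is_arg_min_def opt[OF n] using lower[OF n] n by (auto simp: not_less)
  have "(\<lambda>n. v n / (real n / 2)) \<longlonglongrightarrow> 1"
    unfolding v_def by real_asymp
  \<comment> \<open>The formula for the infimum is available from n = 5 on, which is enough for the
    limit.\<close>
  moreover have "eventually (\<lambda>n. v n / (real n / 2) = (INF m\<in>{1..}. limit_uncertainty n m) / (real n / 2)) sequentially"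
    using eventually_ge_at_top[of 5] by eventually_elim (simp only: inf)
  ultimately have "(\<lambda>n. (INF m\<in>{1..}. limit_uncertainty n m) / (real n / 2)) \<longlonglongrightarrow> 1"
    by (rule Lim_transform_eventually)
  moreover have "\<exists>l. ((\<lambda>\<rho>. uncertainty_product n (poisson_wavelet n m \<rho>)) \<longlongrightarrow> l) (at_right 0)" if "n \<ge> 5" "m \<ge> 1" for n m
    using uncertainty_tendsto[of n m] that by auto
  ultimately show ?thesis
    using inf arg unfolding v_def by blast
qed

end
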